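(* Let $\mathcal{P}$ be a periodic cyclic quadrilateral tiling of the plane, let $v$ be a vertex of $\mathcal{P}$, and let $\gamma$ be a petal based at $v$, contained in a parallel foliation $\mathcal{F}$. Suppose that there is another petal $\gamma'\neq\gamma$ based at the same vertex $v$ and contained in the same parallel foliation $\mathcal{F}$. Then the conclusion of the Bounded Flower Conjecture holds for $\gamma$: there is an edge $e$ of $\mathcal{P}$ with endpoint $v$ such that $\gamma$ intersects (the interiors of) the two neighbouring tiles $P$ and $P_e$ with $P\cap P_e=e$, and $e$ is contained in the closed domain $\overline{\Omega_\gamma}$, where $\Omega_{\gamma}$ is the bounded domain enclosed by $\gamma$.
   Context: **Tiling.** Let $P_0$ be a (nondegenerate, convex) cyclic quadrilateral, i.e. one inscribed in a circle. The periodic cyclic quadrilateral tiling $\mathcal{P}$ is the edge-to-edge tiling of the plane in which any two tiles sharing an edge are images of each other under the central symmetry about the midpoint of this edge. **Tiling billiard.** A tiling billiard trajectory is a path that is straight inside each tile and that, each time it crosses an edge (at an interior point of the edge), continues into the neighbouring tile with the line of the new segment being the reflection in that edge of the line of the old one (Snell's law of refraction with coefficient $-1$). **Folding and parallel foliations.** There is a unique continuous map $F:\mathbb{R}^2\to\mathbb{R}^2$ that is the identity on $P_0$, restricts on each tile $P$ to a Euclidean isometry $F_P$ (viewed as an isometry of the whole plane), and satisfies $F_{P'}=F_P\circ\sigma_e$ whenever tiles $P,P'$ share an edge $e$, where $\sigma_e$ is the reflection in the line containing $e$. Every tiling billiard trajectory is folded by $F$ into a straight line. A parallel foliation $\mathcal{F}$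 is the preimage under $F$ of the foliation of the plane by all lines parallel to one fixed direction. It is a foliation of the plane singular only at vertices of the tiling; its restriction to each tile is a foliation by parallel segments, and its non-singular leaves are tiling billiard trajectories. Its singular leaves are those passing through vertices of the tiling. **Petals.** A petal (singular periodic trajectory) based at a vertex $v$ in $\mathcal{F}$ is a closed curve contained in a singular leaf of $\mathcal{F}$ which starts at $v$ along a segment inside a tile, follows the tiling billiard law (crossing edges at interior points), and ends when it returns to $v$ for the first time. It is a simple closed curve, and $\Omega_\gamma$ denotes the bounded component of the complement of the petal $\gamma$. *)

theory Defs
  imports "HOL-Analysis.Analysis"
begin

section \<open>Periodic cyclic quadrilateral tilings\<close>

text \<open>
  Tiles are closed subsets of the Euclidean plane, which is identified with the type of
  complex numbers.  Four distinct points of a circle are automatically in convex position,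
  so their convex hull is a nondegenerate convex quadrilateral.
\<close>

definition cyclic_quadrilateral :: "complex set \<Rightarrow> bool" where
  "cyclic_quadrilateral P \<longleftrightarrow>
     (\<exists>V z r. card V = 4 \<and> V \<subseteq> sphere z r \<and> P = convex hull V)"

definition central_symmetry :: "complex \<Rightarrow> complex \<Rightarrow> complex" where
  "central_symmetry m x = 2 * m - x"

text \<open>The orthogonal reflection in the line through two distinct points.\<close>

definition line_reflection :: "complex \<Rightarrow> complex \<Rightarrow> complex \<Rightarrow> complex" where
  "line_reflection a b x = a + (b - a) * cnj ((x - a) / (b - a))"

text \<open>
  Local finiteness is the usual standing convention for tilings.  Edge-to-edge means that
  two distinct tiles meet in a common face: nothing, a common vertex or a common edge.
\<close>

definition edge_to_edge_tiling :: "complex set set \<Rightarrow> bool" where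
  "edge_to_edge_tiling T \<longleftrightarrow>
     \<Union>T = UNIV \<and>
     locally_finite_in euclidean T \<and>
     (\<forall>P\<in>T. \<forall>Q\<in>T. P \<noteq> Q \<longrightarrow>
        interior P \<inter> interior Q = {} \<and> P \<inter> Q face_of P \<and> P \<inter> Q face_of Q)"

definition neighbours :: "complex set set \<Rightarrow> complex set \<Rightarrow> complex set \<Rightarrow> complex set \<Rightarrow> bool" where
  "neighbours T P Q e \<longleftrightarrow>
     P \<in> T \<and> Q \<in> T \<and> P \<noteq> Q \<and> e edge_of P \<and> e edge_of Q"

definition cyclic_quadrilateral_tiling :: "complex set \<Rightarrow> complex set set \<Rightarrow> bool" where
  "cyclic_quadrilateral_tiling P0 T \<longleftrightarrow>
     P0 \<in> T \<and>
     (\<forall>P\<in>T. cyclic_quadrilateral P) \<and>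
     edge_to_edge_tiling T \<and>
     (\<forall>P Q a b. neighbours T P Q (closed_segment a b) \<longrightarrow>
        Q = central_symmetry (midpoint a b) ` P)"

definition tiling_vertices :: "complex set set \<Rightarrow> complex set" where
  "tiling_vertices T = {v. \<exists>P\<in>T. v extreme_point_of P}"

definition tiling_edges :: "complex set set \<Rightarrow> complex set set" where
  "tiling_edges T = {e. \<exists>P\<in>T. e edge_of P}"


section \<open>Folding and parallel foliations\<close>

definition folding_map :: "complex set \<Rightarrow> complex set set \<Rightarrow> (complex \<Rightarrow> complex) \<Rightarrow> bool" where
  "folding_map P0 T F \<longleftrightarrow>
     continuous_on UNIV F \<and>
     (\<forall>x\<in>P0. F x = x) \<and>
     (\<exists>G. (\<forall>P\<in>T. (\<forall>x y. dist (G P x) (G P y) = dist x y) \<and> (\<forall>x\<in>P. F x = G P x)) \<and>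
          (\<forall>P Q a b. neighbours T P Q (closed_segment a b) \<longrightarrow>
             G Q = G P \<circ> line_reflection a b))"

text \<open>
  A foliation is represented by the set of its leaves.  A leaf of the pulled back foliation
  is a connected component of the preimage of a line; the component of a vertex contains
  all the segments ending there, so singular leaves may branch at vertices.
\<close>

definition parallel_foliation ::
  "complex set \<Rightarrow> complex set set \<Rightarrow> complex set set \<Rightarrow> bool" where
  "parallel_foliation P0 T \<F> \<longleftrightarrow>
     (\<exists>F d. folding_map P0 T F \<and> d \<noteq> 0 \<and>
        \<F> = (\<Union>p. components (F -` range (\<lambda>t. p + t *\<^sub>R d))))"

definition singular_leaf :: "complex set set \<Rightarrow> complex set set \<Rightarrow> complex set \<Rightarrow> bool" where
  "singular_leaf T \<F> L \<longleftrightarrow> L \<in> \<F> \<and> L \<inter> tiling_vertices T \<noteq> {}"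


section \<open>Tiling billiard trajectories and petals\<close>

text \<open>
  A finite trajectory with \<open>n\<close> segments: the \<open>i\<close>-th segment runs from \<open>x i\<close> to \<open>x (Suc i)\<close>
  inside the tile \<open>Q i\<close>, and between consecutive segments the trajectory crosses an edge at
  a relatively interior point, the supporting line being reflected in that edge.
\<close>

definition billiard_trajectory ::
  "complex set set \<Rightarrow> nat \<Rightarrow> (nat \<Rightarrow> complex) \<Rightarrow> (nat \<Rightarrow> complex set) \<Rightarrow> bool" where
  "billiard_trajectory T n x Q \<longleftrightarrow>
     (\<forall>i<n. Q i \<in> T \<and> x i \<noteq> x (Suc i) \<and> open_segment (x i) (x (Suc i)) \<subseteq> interior (Q i)) \<and>
     (\<forall>i. Suc i < n \<longrightarrow>
        (\<exists>a b. neighbours T (Q i) (Q (Suc i)) (closed_segment a b) \<and>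
           x (Suc i) \<in> open_segment a b \<and>
           affine hull {x (Suc i), x (Suc (Suc i))} =
             line_reflection a b ` (affine hull {x i, x (Suc i)})))"

text \<open>
  Petals are unparametrised curves, so a petal and its reversal are the same petal.  The
  points \<open>x i\<close> with \<open>0 < i < n\<close> are interior to edges and the open segments are interior to
  tiles, hence \<open>x n\<close> is automatically the first return to the vertex \<open>v\<close>.
\<close>

definition petal :: "complex set set \<Rightarrow> complex set set \<Rightarrow> complex \<Rightarrow> complex set \<Rightarrow> bool" where
  "petal T \<F> v \<gamma> \<longleftrightarrow>
     v \<in> tiling_vertices T \<and>
     (\<exists>n x Q. 0 < n \<and> billiard_trajectory T n x Q \<and> x 0 = v \<and> x n = v \<and>
        \<gamma> = (\<Union>i<n. closed_segment (x i) (x (Suc i)))) \<and>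
     (\<exists>L. singular_leaf T \<F> L \<and> \<gamma> \<subseteq> L)"

text \<open>
  As a petal is a simple closed curve, \<open>inside \<gamma>\<close> (the union of the bounded components of
  the complement) is the bounded domain enclosed by \<open>\<gamma>\<close>.
\<close>

abbreviation petal_domain :: "complex set \<Rightarrow> complex set" where
  "petal_domain \<gamma> \<equiv> inside \<gamma>"

end

theory Submission
  imports Defs
begin

text \<open>
  The folding carries all vertices of the tiling to one circle and the leaf to a chord.  A parity
  argument shows that the first and the last tile of the petal share a side \<open>e\<close> at \<open>v\<close>; in both
  tiles the chord separates \<open>e\<close> from the other side at \<open>v\<close>.  If \<open>e\<close> is not in the closure of
  the domain, the domain lies on the side of the chord away from \<open>e\<close>.  The vertices met by the petal
  on that side then belong to one component (with respect to lying on a common tile) of the vertices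
  folded to an open arc of the circle; it is enclosed by the petal, hence finite, and contains the
  further endpoints of both other sides at \<open>v\<close>.  Counting the vertices of a component above a
  variable angle along the sides of the tiling shows that such a component is infinite.
\<close>

text \<open>If the ends of a side are folded to the angles \<open>s\<close> and \<open>t\<close>,
  the point reflection in its midpoint sends a corner at angle \<open>r\<close> to one at angle
  \<open>s + t - r\<close>. Modulo a full turn the angle is therefore an affine function of the
  lattice indices, up to a constant for odd vertices, and the claim about components becomes one
  about a labelling of pairs of integers. The obstacle is the wrap at \<open>2 * pi\<close>: a
  component cannot be followed monotonically. Counting copes with this. For a finite component,
  moving one parity class along one kind of side while raising the threshold by the arc of that side
  changes the count by an amount independent of the threshold, except that vertices reached from
  angle \<open>0\<close> show up only at threshold \<open>0\<close>. These exceptional terms count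
  the vertices at angle \<open>0\<close> to which the component is attached by one or the other kind
  of horizontal side, and joining the two neighbours of the origin forces them to agree. No nonzero
  angle-preserving translation maps a finite component to itself, so at the moment of joining one of
  the two numbers is zero and the other is not.\<close>

subsection \<open>Angles on the lattice of vertices\<close>

text \<open>Compare \<open>x\<close> with \<open>e x\<close>. If only \<open>x\<close> lies in
  \<open>C\<close>, the step leaves the interval at its upper end or lands on \<open>0\<close>, so
  \<open>x\<close> is above every admissible \<open>p\<close>. If only \<open>e x\<close> lies in
  \<open>C\<close>, then either \<open>x\<close> is at or above \<open>\<beta>\<close>, the step
  wraps and \<open>e x\<close> is below \<open>a\<close>, hence never counted; or \<open>x\<close>
  is at angle \<open>0\<close> and \<open>e x\<close> sits exactly at \<open>a\<close>, hence
  counted only for \<open>p = 0\<close>. So the mismatch is independent of \<open>p\<close> apart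
  from this last case.\<close>

lemma count_shift:
  fixes C :: "'a set" and \<phi> :: "'a \<Rightarrow> real" and e :: "'a \<Rightarrow> 'a"
  assumes "finite C" and "inj e"
    and onto: "\<And>h. P\<^sub>2 h \<Longrightarrow> \<exists>x. P\<^sub>1 x \<and> h = e x"
    and e: "\<And>x. P\<^sub>1 x \<Longrightarrow> P\<^sub>2 (e x) \<and> (\<phi> (e x) = \<phi> x + a \<or> \<phi> (e x) = \<phi> x + a - 2 * pi)"
    and \<phi>: "\<And>x. 0 \<le> \<phi> x \<and> \<phi> x < 2 * pi"
    and a: "0 < a" "a < 2 * pi" and "\<beta> \<le> 2 * pi"
    and C: "\<And>x. x \<in> C \<Longrightarrow> 0 < \<phi> x \<and> \<phi> x < \<beta>"
    and fwd: "\<And>x. P\<^sub>1 x \<Longrightarrow> x \<in> C \<Longrightarrow> 0 < \<phi> (e x) \<Longrightarrow> \<phi> (e x) < \<beta> \<Longrightarrow> e x \<in> C"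
    and bwd: "\<And>x. P\<^sub>1 x \<Longrightarrow> e x \<in> C \<Longrightarrow> 0 < \<phi> x \<Longrightarrow> \<phi> x < \<beta> \<Longrightarrow> x \<in> C"
  shows "\<exists>K::int. \<forall>p. 0 \<le> p \<longrightarrow> p + a \<le> \<beta> \<longrightarrow>
           int (card {h \<in> C. P\<^sub>2 h \<and> p + a \<le> \<phi> h}) =
           int (card {h \<in> C. P\<^sub>1 h \<and> p \<le> \<phi> h}) + K +
             (if p = 0 then int (card {x. P\<^sub>1 x \<and> \<phi> x = 0 \<and> e x \<in> C}) else 0)"
proof -
  define X where "X = {x. P\<^sub>1 x \<and> (x \<in> C \<or> e x \<in> C)}"
  \<comment> \<open>A wrapping step inside \<open>C\<close> costs one as well: its end is below
    every threshold \<open>p + a\<close> and its start above every \<open>p\<close>.\<close>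
  define c :: "'a \<Rightarrow> int" where
    "c = (\<lambda>x. if x \<in> C then (if e x \<in> C \<and> \<phi> (e x) = \<phi> x + a then 0 else -1) else 0)"
  have "finite (e -` C)"
    using assms(1,2) by (simp add: finite_vimageI)
  then have finX: "finite X"
    using \<open>finite C\<close> by (intro finite_subset[of X "C \<union> e -` C"]) (auto simp: X_def)
  have sumcard: "int (card {x \<in> X. Q x}) = (\<Sum>x\<in>X. of_bool (Q x))" for Q
    using finX by (simp add: Int_def)
  show ?thesis
  proof (intro exI[of _ "sum c X"] allI impI)
    fix p assume p: "0 \<le> p" "p + a \<le> \<beta>"
    have 1: "int (card {h \<in> C. P\<^sub>1 h \<and> p \<le> \<phi> h}) = (\<Sum>x\<in>X. of_bool (x \<in> C \<and> p \<le> \<phi> x))"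
    proof -
      have "{h \<in> C. P\<^sub>1 h \<and> p \<le> \<phi> h} = {x \<in> X. x \<in> C \<and> p \<le> \<phi> x}"
        by (auto simp: X_def)
      then show ?thesis by (simp only: sumcard)
    qed
    have 2: "int (card {h \<in> C. P\<^sub>2 h \<and> p + a \<le> \<phi> h}) = (\<Sum>x\<in>X. of_bool (e x \<in> C \<and> p + a \<le> \<phi> (e x)))"
    proof -
      have "{h \<in> C. P\<^sub>2 h \<and> p + a \<le> \<phi> h} = e ` {x \<in> X. e x \<in> C \<and> p + a \<le> \<phi> (e x)}"
        using onto e by (fastforce simp: X_def)
      then have "card {h \<in> C. P\<^sub>2 h \<and> p + a \<le> \<phi> h} = card {x \<in> X. e x \<in> C \<and> p + a \<le> \<phi> (e x)}"
        using \<open>inj e\<close> by (metis (no_types, lifting) card_image inj_on_subset subset_UNIV)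
      then show ?thesis by (simp only: sumcard)
    qed
    have 3: "(if p = 0 then int (card {x. P\<^sub>1 x \<and> \<phi> x = 0 \<and> e x \<in> C}) else 0)
        = (\<Sum>x\<in>X. of_bool (p = 0 \<and> \<phi> x = 0 \<and> e x \<in> C))"
    proof -
      have "{x. P\<^sub>1 x \<and> \<phi> x = 0 \<and> e x \<in> C} = {x \<in> X. \<phi> x = 0 \<and> e x \<in> C}"
        by (auto simp: X_def)
      then show ?thesis
        using sumcard[of "\<lambda>x. \<phi> x = 0 \<and> e x \<in> C"] by simp
    qed
    have "of_bool (e x \<in> C \<and> p + a \<le> \<phi> (e x)) =
        of_bool (x \<in> C \<and> p \<le> \<phi> x) + c x + of_bool (p = 0 \<and> \<phi> x = 0 \<and> e x \<in> C)" if "x \<in> X" for x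
    proof -
      have P: "P\<^sub>1 x" and or: "x \<in> C \<or> e x \<in> C" using that by (auto simp: X_def)
      note ex = e[OF P] and bx = \<phi>[of x] and be = \<phi>[of "e x"]
      consider (both) "x \<in> C" "e x \<in> C" | (left) "x \<in> C" "e x \<notin> C" | (right) "x \<notin> C" "e x \<in> C"
        using or by blast
      then show ?thesis
      proof cases
        case both
        then show ?thesis
          using C[OF both(1)] C[OF both(2)] ex p a \<open>\<beta> \<le> 2 * pi\<close> by (auto simp: c_def)
      next
        case left
        have "\<phi> (e x) = 0 \<or> \<beta> \<le> \<phi> (e x)"
          using fwd[OF P left(1)] left(2) be by force
        then have "p \<le> \<phi> x"
          using ex p a C[OF left(1)] \<open>\<beta> \<le> 2 * pi\<close> by auto
        then show ?thesis using left by (simp add: c_def)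
      next
        case right
        have "\<phi> x = 0 \<or> \<beta> \<le> \<phi> x"
          using bwd[OF P right(2)] right(1) bx by force
        then show ?thesis
          using ex p a C[OF right(2)] right bx by (auto simp: c_def)
      qed
    qed
    then have "(\<Sum>x\<in>X. of_bool (e x \<in> C \<and> p + a \<le> \<phi> (e x))) =
       (\<Sum>x\<in>X. of_bool (x \<in> C \<and> p \<le> \<phi> x) + c x + of_bool (p = 0 \<and> \<phi> x = 0 \<and> e x \<in> C))"
      by (intro sum.cong) auto
    then show "int (card {h \<in> C. P\<^sub>2 h \<and> p + a \<le> \<phi> h}) =
           int (card {h \<in> C. P\<^sub>1 h \<and> p \<le> \<phi> h}) + sum c X +
             (if p = 0 then int (card {x. P\<^sub>1 x \<and> \<phi> x = 0 \<and> e x \<in> C}) else 0)"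
      unfolding 1 2 3 by (simp add: sum.distrib)
  qed
qed

text \<open>The vertices of the tiling are indexed by pairs of integers, and the folding puts the vertex
  \<open>y\<close> at the angle \<open>phase y\<close> on a circle that the corners of a tile divide into arcs of lengths
  \<open>a\<^sub>i\<close>.  The side of a tile from \<open>y\<close> to \<open>y'\<close> turns counterclockwise by \<open>a\<close> if \<open>dstep y y' a\<close>.\<close>

locale arcs =
  fixes a\<^sub>1 a\<^sub>2 a\<^sub>3 a\<^sub>4 :: real
  assumes arcs_pos: "0 < a\<^sub>1" "0 < a\<^sub>2" "0 < a\<^sub>3" "0 < a\<^sub>4"
    and arcs_sum: "a\<^sub>1 + a\<^sub>2 + a\<^sub>3 + a\<^sub>4 = 2 * pi"
begin

text \<open>The coefficients are forced by using one linear part for both parities and by the values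
  \<open>0\<close>, \<open>a\<^sub>1\<close>, \<open>a\<^sub>1 + a\<^sub>2\<close> and
  \<open>- a\<^sub>4\<close> at the corners \<open>(0, 0)\<close>, \<open>(1, 0)\<close>,
  \<open>(1, 1)\<close> and \<open>(0, 1)\<close>, which are the partial sums of the arcs up to a
  full turn.\<close>

definition phase :: "int \<times> int \<Rightarrow> real" where
  "phase = (\<lambda>(i, j). of_int i * ((a\<^sub>1 - a\<^sub>3) / 2 + pi) + of_int j * ((a\<^sub>2 - a\<^sub>4) / 2) +
     (if odd (i + j) then (a\<^sub>1 + a\<^sub>3) / 2 - pi else 0))"

definition \<phi> :: "int \<times> int \<Rightarrow> real" where
  "\<phi> y = 2 * pi * frac (phase y / (2 * pi))"

text \<open>The fold puts the two tiles at a side on the same side of its chord, so one direction of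
  the side serves both tiles: horizontal sides start at their even end, vertical ones at their odd
  end.\<close>

definition dstep :: "int \<times> int \<Rightarrow> int \<times> int \<Rightarrow> real \<Rightarrow> bool" where
  "dstep = (\<lambda>(i, j) (i', j') a.
     (even (i + j) \<and> j' = j \<and> (i' = i + 1 \<and> a = a\<^sub>1 \<or> i' = i - 1 \<and> a = a\<^sub>3)) \<or>
     (odd (i + j) \<and> i' = i \<and> (j' = j + 1 \<and> a = a\<^sub>2 \<or> j' = j - 1 \<and> a = a\<^sub>4)))"

definition corners :: "int \<times> int \<Rightarrow> (int \<times> int) set" where
  "corners = (\<lambda>(i, j). {(i, j), (i + 1, j), (i + 1, j + 1), (i, j + 1)})"

lemma phi_range: "0 \<le> \<phi> y" "\<phi> y < 2 * pi"
  using frac_lt_1[of "phase y / (2 * pi)"] by (auto simp: \<phi>_def)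

lemma phi_eqI:
  assumes "phase y = s + 2 * pi * of_int k" "0 \<le> s" "s < 2 * pi"
  shows "\<phi> y = s"
proof -
  have "phase y / (2 * pi) = s / (2 * pi) + of_int k"
    using assms(1) by (simp add: field_simps)
  then have "frac (phase y / (2 * pi)) = frac (s / (2 * pi))" by simp
  also have "\<dots> = s / (2 * pi)" using assms(2,3) by (subst frac_eq) auto
  finally show ?thesis by (simp add: \<phi>_def)
qed

lemma phase_phi: "\<exists>k::int. phase y = \<phi> y + 2 * pi * of_int k"
proof -
  have "phase y / (2 * pi) = frac (phase y / (2 * pi)) + of_int \<lfloor>phase y / (2 * pi)\<rfloor>"
    by (simp add: frac_def)
  then have "phase y = (frac (phase y / (2 * pi)) + of_int \<lfloor>phase y / (2 * pi)\<rfloor>) * (2 * pi)"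
    by (metis nonzero_divide_eq_eq pi_neq_zero mult_eq_0_iff zero_neq_numeral)
  then have "phase y = \<phi> y + 2 * pi * of_int \<lfloor>phase y / (2 * pi)\<rfloor>"
    by (simp add: \<phi>_def algebra_simps)
  then show ?thesis by blast
qed

lemma phi_zero [simp]: "\<phi> (0, 0) = 0"
  by (rule phi_eqI[where k = 0]) (auto simp: phase_def)

lemma dstep_phase:
  assumes "dstep y y' a"
  shows "\<exists>k::int. phase y' = phase y + a + 2 * pi * of_int k"
proof -
  obtain i j where y: "y = (i, j)" by (cases y)
  obtain i' j' where y': "y' = (i', j')" by (cases y')
  consider "even (i + j)" "j' = j" "i' = i + 1" "a = a\<^sub>1" | "even (i + j)" "j' = j" "i' = i - 1" "a = a\<^sub>3"
    | "odd (i + j)" "i' = i" "j' = j + 1" "a = a\<^sub>2" | "odd (i + j)" "i' = i" "j' = j - 1" "a = a\<^sub>4"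
    using assms unfolding y y' dstep_def by auto
  then show ?thesis
  proof cases
    case 1
    then show ?thesis using arcs_sum unfolding y y' phase_def
      by (intro exI[of _ 0]) (auto simp: field_simps)
  next
    case 2
    then show ?thesis using arcs_sum unfolding y y' phase_def
      by (intro exI[of _ "-1"]) (auto simp: field_simps)
  next
    case 3
    then show ?thesis using arcs_sum unfolding y y' phase_def
      by (intro exI[of _ 0]) (auto simp: field_simps)
  next
    case 4
    then show ?thesis using arcs_sum unfolding y y' phase_def
      by (intro exI[of _ 0]) (auto simp: field_simps)
  qed
qed

lemma dstep_bounds: "dstep y y' a \<Longrightarrow> 0 < a \<and> a < 2 * pi"
  using arcs_pos arcs_sum by (cases y; cases y') (auto simp: dstep_def)

lemma dstep_phi:
  assumes "dstep y y' a"
  shows "\<phi> y' = \<phi> y + a \<or> \<phi> y' = \<phi> y + a - 2 * pi"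
proof -
  obtain k where k: "phase y' = phase y + a + 2 * pi * of_int k" using dstep_phase[OF assms] by blast
  obtain l where l: "phase y = \<phi> y + 2 * pi * of_int l" using phase_phi by blast
  have a: "0 < a" "a < 2 * pi" using dstep_bounds[OF assms] by auto
  show ?thesis
  proof (cases "\<phi> y + a < 2 * pi")
    case True
    then have "\<phi> y' = \<phi> y + a"
      using k l a phi_range[of y] by (intro phi_eqI[where k = "k + l"]) (auto simp: algebra_simps)
    then show ?thesis by simp
  next
    case False
    then have "\<phi> y' = \<phi> y + a - 2 * pi"
      using k l a phi_range[of y] by (intro phi_eqI[where k = "k + l + 1"]) (auto simp: algebra_simps)
    then show ?thesis by simp
  qed
qed

lemma phi_neighbours: "\<phi> (1, 0) = a\<^sub>1" "\<phi> (-1, 0) = a\<^sub>3"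
proof -
  have lt: "a\<^sub>1 < 2 * pi" "a\<^sub>3 < 2 * pi" using arcs_pos arcs_sum by auto
  have "\<phi> (1, 0) = 0 + a\<^sub>1 \<or> \<phi> (1, 0) = 0 + a\<^sub>1 - 2 * pi"
    using dstep_phi[of "(0, 0)" "(1, 0)" a\<^sub>1] by (simp add: dstep_def)
  then show "\<phi> (1, 0) = a\<^sub>1" using phi_range[of "(1, 0)"] lt by linarith
  have "\<phi> (-1, 0) = 0 + a\<^sub>3 \<or> \<phi> (-1, 0) = 0 + a\<^sub>3 - 2 * pi"
    using dstep_phi[of "(0, 0)" "(-1, 0)" a\<^sub>3] by (simp add: dstep_def)
  then show "\<phi> (-1, 0) = a\<^sub>3" using phi_range[of "(-1, 0)"] lt by linarith
qed

lemma phi_cong_imp: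
  assumes "\<phi> y = \<phi> y'"
  shows "\<exists>k::int. phase y = phase y' + 2 * pi * of_int k"
proof -
  obtain k where "phase y = \<phi> y + 2 * pi * of_int k" using phase_phi by blast
  moreover obtain l where "phase y' = \<phi> y' + 2 * pi * of_int l" using phase_phi by blast
  ultimately show ?thesis
    using assms by (intro exI[of _ "k - l"]) (simp add: algebra_simps)
qed

lemma phi_congI:
  assumes "phase y = phase y' + 2 * pi * of_int k"
  shows "\<phi> y = \<phi> y'"
proof -
  obtain l where "phase y' = \<phi> y' + 2 * pi * of_int l" using phase_phi by blast
  then show ?thesis
    using assms phi_range[of y'] by (intro phi_eqI[where k = "k + l"]) (auto simp: algebra_simps)
qed

lemma phase_translate:
  "even (i + j) \<Longrightarrow> phase (x + i, y + j) = phase (x, y) + phase (i, j)"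
  by (auto simp: phase_def algebra_simps add_divide_distrib diff_divide_distrib)

text \<open>An even translation adds one constant to all phases, so a single vertex whose angle is
  unchanged shows that the constant is a multiple of a full turn.\<close>

lemma phi_translate:
  assumes "even (i + j)" "\<phi> (x + i, y + j) = \<phi> (x, y)"
  shows "\<phi> (x' + i, y' + j) = \<phi> (x', y')"
proof -
  obtain k where "phase (x + i, y + j) = phase (x, y) + 2 * pi * of_int k"
    using phi_cong_imp[OF assms(2)] by blast
  then have "phase (x' + i, y' + j) = phase (x', y') + 2 * pi * of_int k"
    by (simp add: phase_translate[OF assms(1)])
  then show ?thesis by (rule phi_congI)
qed

text \<open>The four corners of a tile are traversed by directed steps whose lengths add up to a full
  turn, so exactly one of them wraps around; the cycle is started at its head.\<close>

lemma tile_cycle: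
  obtains c\<^sub>0 c\<^sub>1 c\<^sub>2 c\<^sub>3 b\<^sub>0 b\<^sub>1 b\<^sub>2 b\<^sub>3 where "corners t = {c\<^sub>0, c\<^sub>1, c\<^sub>2, c\<^sub>3}"
    and "dstep c\<^sub>0 c\<^sub>1 b\<^sub>0" "dstep c\<^sub>1 c\<^sub>2 b\<^sub>1" "dstep c\<^sub>2 c\<^sub>3 b\<^sub>2" "dstep c\<^sub>3 c\<^sub>0 b\<^sub>3"
    and "\<phi> c\<^sub>1 = \<phi> c\<^sub>0 + b\<^sub>0" "\<phi> c\<^sub>2 = \<phi> c\<^sub>1 + b\<^sub>1" "\<phi> c\<^sub>3 = \<phi> c\<^sub>2 + b\<^sub>2" "\<phi> c\<^sub>0 = \<phi> c\<^sub>3 + b\<^sub>3 - 2 * pi"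
    and "b\<^sub>0 + b\<^sub>1 + b\<^sub>2 + b\<^sub>3 = 2 * pi"
proof -
  obtain i j where t: "t = (i, j)" by (cases t)
  have "\<exists>d\<^sub>0 d\<^sub>1 d\<^sub>2 d\<^sub>3 b\<^sub>0 b\<^sub>1 b\<^sub>2 b\<^sub>3. corners t = {d\<^sub>0, d\<^sub>1, d\<^sub>2, d\<^sub>3} \<and>
      dstep d\<^sub>0 d\<^sub>1 b\<^sub>0 \<and> dstep d\<^sub>1 d\<^sub>2 b\<^sub>1 \<and> dstep d\<^sub>2 d\<^sub>3 b\<^sub>2 \<and> dstep d\<^sub>3 d\<^sub>0 b\<^sub>3 \<and> b\<^sub>0 + b\<^sub>1 + b\<^sub>2 + b\<^sub>3 = 2 * pi"
  proof (cases "even (i + j)")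
    case True
    have "corners t = {(i, j), (i + 1, j), (i + 1, j + 1), (i, j + 1)}"
      by (simp add: t corners_def)
    moreover have "dstep (i, j) (i + 1, j) a\<^sub>1" "dstep (i + 1, j) (i + 1, j + 1) a\<^sub>2"
      "dstep (i + 1, j + 1) (i, j + 1) a\<^sub>3" "dstep (i, j + 1) (i, j) a\<^sub>4"
      using True by (simp_all add: dstep_def)
    ultimately show ?thesis using arcs_sum by blast
  next
    case False
    have "corners t = {(i + 1, j), (i, j), (i, j + 1), (i + 1, j + 1)}"
      by (auto simp add: t corners_def)
    moreover have "dstep (i + 1, j) (i, j) a\<^sub>3" "dstep (i, j) (i, j + 1) a\<^sub>2"
      "dstep (i, j + 1) (i + 1, j + 1) a\<^sub>1" "dstep (i + 1, j + 1) (i + 1, j) a\<^sub>4"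
      using False by (simp_all add: dstep_def)
    moreover have "a\<^sub>3 + a\<^sub>2 + a\<^sub>1 + a\<^sub>4 = 2 * pi" using arcs_sum by simp
    ultimately show ?thesis by blast
  qed
  then obtain d\<^sub>0 d\<^sub>1 d\<^sub>2 d\<^sub>3 b\<^sub>0 b\<^sub>1 b\<^sub>2 b\<^sub>3 where c: "corners t = {d\<^sub>0, d\<^sub>1, d\<^sub>2, d\<^sub>3}"
    and d: "dstep d\<^sub>0 d\<^sub>1 b\<^sub>0" "dstep d\<^sub>1 d\<^sub>2 b\<^sub>1" "dstep d\<^sub>2 d\<^sub>3 b\<^sub>2" "dstep d\<^sub>3 d\<^sub>0 b\<^sub>3"
    and s: "b\<^sub>0 + b\<^sub>1 + b\<^sub>2 + b\<^sub>3 = 2 * pi" by blast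
  have W: "\<exists>w::real. (w = 0 \<or> w = 1) \<and> \<phi> y' = \<phi> y + b - 2 * pi * w" if "dstep y y' b" for y y' b
    using dstep_phi[OF that] by (metis diff_0_right mult_zero_right mult.right_neutral)
  obtain w\<^sub>0 :: real where w0: "w\<^sub>0 = 0 \<or> w\<^sub>0 = 1" "\<phi> d\<^sub>1 = \<phi> d\<^sub>0 + b\<^sub>0 - 2 * pi * w\<^sub>0"
    using W[OF d(1)] by blast
  obtain w\<^sub>1 :: real where w1: "w\<^sub>1 = 0 \<or> w\<^sub>1 = 1" "\<phi> d\<^sub>2 = \<phi> d\<^sub>1 + b\<^sub>1 - 2 * pi * w\<^sub>1"
    using W[OF d(2)] by blast
  obtain w\<^sub>2 :: real where w2: "w\<^sub>2 = 0 \<or> w\<^sub>2 = 1" "\<phi> d\<^sub>3 = \<phi> d\<^sub>2 + b\<^sub>2 - 2 * pi * w\<^sub>2"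
    using W[OF d(3)] by blast
  obtain w\<^sub>3 :: real where w3: "w\<^sub>3 = 0 \<or> w\<^sub>3 = 1" "\<phi> d\<^sub>0 = \<phi> d\<^sub>3 + b\<^sub>3 - 2 * pi * w\<^sub>3"
    using W[OF d(4)] by blast
  note w = w0(1) w1(1) w2(1) w3(1) and D = w0(2) w1(2) w2(2) w3(2)
  have "2 * pi * (w\<^sub>0 + w\<^sub>1 + w\<^sub>2 + w\<^sub>3) = 2 * pi * 1"
    using D s by (simp add: algebra_simps)
  then have "w\<^sub>0 + w\<^sub>1 + w\<^sub>2 + w\<^sub>3 = 1" by simp
  then consider "w\<^sub>0 = 0" "w\<^sub>1 = 0" "w\<^sub>2 = 0" "w\<^sub>3 = 1" | "w\<^sub>0 = 1" "w\<^sub>1 = 0" "w\<^sub>2 = 0" "w\<^sub>3 = 0"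
    | "w\<^sub>0 = 0" "w\<^sub>1 = 1" "w\<^sub>2 = 0" "w\<^sub>3 = 0" | "w\<^sub>0 = 0" "w\<^sub>1 = 0" "w\<^sub>2 = 1" "w\<^sub>3 = 0"
    using w by (elim disjE) simp_all
  then show ?thesis
  proof cases
    case 1
    show ?thesis by (rule that[OF c d]) (use D 1 s in simp_all)
  next
    case 2
    show ?thesis by (rule that[OF _ d(2,3,4,1)]) (use D 2 c s in auto)
  next
    case 3
    show ?thesis by (rule that[OF _ d(3,4,1,2)]) (use D 3 c s in auto)
  next
    case 4
    show ?thesis by (rule that[OF _ d(4,1,2,3)]) (use D 4 c s in auto)
  qed
qed

lemma dstep_unique:
  assumes "dstep y y' b" "dstep y y'' b''" "y' \<in> corners t" "y'' \<in> corners t"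
  shows "y' = y''"
proof -
  obtain i j i' j' i'' j'' k l where "y = (i, j)" "y' = (i', j')" "y'' = (i'', j'')" "t = (k, l)"
    by (metis surj_pair)
  note eqs = this
  have "(even (i + j) \<and> j' = j \<and> (i' = i + 1 \<or> i' = i - 1)) \<or> (odd (i + j) \<and> i' = i \<and> (j' = j + 1 \<or> j' = j - 1))"
    using assms(1) unfolding eqs dstep_def prod.case by blast
  moreover have "(even (i + j) \<and> j'' = j \<and> (i'' = i + 1 \<or> i'' = i - 1)) \<or> (odd (i + j) \<and> i'' = i \<and> (j'' = j + 1 \<or> j'' = j - 1))"
    using assms(2) unfolding eqs dstep_def prod.case by blast
  moreover have "(i' = k \<or> i' = k + 1) \<and> (j' = l \<or> j' = l + 1)" "(i'' = k \<or> i'' = k + 1) \<and> (j'' = l \<or> j'' = l + 1)"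
    using assms(3,4) by (auto simp: eqs corners_def)
  ultimately show ?thesis unfolding eqs by auto
qed

lemma dstep_in_tile:
  assumes "dstep y y' a"
  shows "\<exists>t. y \<in> corners t \<and> y' \<in> corners t"
proof -
  obtain i j where y: "y = (i, j)" by (cases y)
  obtain i' j' where y': "y' = (i', j')" by (cases y')
  consider "j' = j" "i' = i + 1" | "j' = j" "i' = i - 1" | "i' = i" "j' = j + 1" | "i' = i" "j' = j - 1"
    using assms unfolding y y' dstep_def by auto
  then have "y \<in> corners (min i i', min j j')" "y' \<in> corners (min i i', min j j')"
    by (cases, simp_all add: y y' corners_def)+
  then show ?thesis by blast
qed

text \<open>Vertices are joined through a common tile rather than a common side because the part of
  a tile on one side of the chord is convex: two corners in it cannot be separated by the
  petal.\<close>

definition tilemates :: "real set \<Rightarrow> ((int \<times> int) \<times> (int \<times> int)) set" where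
  "tilemates I = {(y, y'). \<exists>t. y \<in> corners t \<and> y' \<in> corners t \<and> \<phi> y \<in> I \<and> \<phi> y' \<in> I}"

abbreviation even_vertex :: "int \<times> int \<Rightarrow> bool" where
  "even_vertex x \<equiv> even (fst x + snd x)"

section \<open>Counting the vertices of a finite component above an angle\<close>

lemma count_shift_dstep:
  assumes "finite C" "\<beta> \<le> 2 * pi"
    and C: "\<forall>x\<in>C. 0 < \<phi> x \<and> \<phi> x < \<beta>"
    and closed: "\<forall>x\<in>C. \<forall>t y. x \<in> corners t \<longrightarrow> y \<in> corners t \<longrightarrow> 0 < \<phi> y \<longrightarrow> \<phi> y < \<beta> \<longrightarrow> y \<in> C"
    and e: "\<And>x. e x = (fst x + k, snd x + l)" "\<And>x. P\<^sub>1 x \<Longrightarrow> dstep x (e x) a" "\<And>x. P\<^sub>2 (e x) \<longleftrightarrow> P\<^sub>1 x"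
    and a: "0 < a" "a < 2 * pi"
  shows "\<exists>K::int. \<forall>p. 0 \<le> p \<longrightarrow> p + a \<le> \<beta> \<longrightarrow>
           int (card {h \<in> C. P\<^sub>2 h \<and> p + a \<le> \<phi> h}) =
           int (card {h \<in> C. P\<^sub>1 h \<and> p \<le> \<phi> h}) + K +
             (if p = 0 then int (card {x. P\<^sub>1 x \<and> \<phi> x = 0 \<and> e x \<in> C}) else 0)"
proof (rule count_shift)
  show "inj e" by (auto simp: inj_def e(1) prod_eq_iff)
  show "\<exists>x. P\<^sub>1 x \<and> h = e x" if "P\<^sub>2 h" for h
  proof -
    have "h = e (fst h - k, snd h - l)" by (simp add: e(1))
    with that e(3) show ?thesis by metis
  qed
  show "P\<^sub>2 (e x) \<and> (\<phi> (e x) = \<phi> x + a \<or> \<phi> (e x) = \<phi> x + a - 2 * pi)" if "P\<^sub>1 x" for x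
    using e(2,3) dstep_phi that by blast
  show "e x \<in> C" if "P\<^sub>1 x" "x \<in> C" "0 < \<phi> (e x)" "\<phi> (e x) < \<beta>" for x
    using dstep_in_tile[OF e(2)[OF that(1)]] closed that by blast
  show "x \<in> C" if "P\<^sub>1 x" "e x \<in> C" "0 < \<phi> x" "\<phi> x < \<beta>" for x
    using dstep_in_tile[OF e(2)[OF that(1)]] closed that by blast
qed (use assms phi_range in auto)

text \<open>Along the path the counting relations are used for steps that start at a positive angle,
  where they have no exceptional term, so a corrected count \<open>f\<close> is constant on it. At
  the two ends they are read at \<open>p = 0\<close>, which brings in \<open>card ?R\<close> at one
  end and \<open>card ?L\<close> at the other. The path may use the angle \<open>\<beta>\<close>
  itself although \<open>C\<close> lies strictly below it.\<close>

lemma balance: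
  assumes fin: "finite C" and \<beta>: "\<beta> \<le> 2 * pi"
    and C: "\<forall>x\<in>C. 0 < \<phi> x \<and> \<phi> x < \<beta>"
    and closed: "\<forall>x\<in>C. \<forall>t y. x \<in> corners t \<longrightarrow> y \<in> corners t \<longrightarrow> 0 < \<phi> y \<longrightarrow> \<phi> y < \<beta> \<longrightarrow> y \<in> C"
    and path: "((1, 0), (-1, 0)) \<in> (tilemates {0<..\<beta>})\<^sup>*" and le: "a\<^sub>1 \<le> \<beta>" "a\<^sub>3 \<le> \<beta>"
  shows "card {x. even_vertex x \<and> \<phi> x = 0 \<and> (fst x + 1, snd x) \<in> C} =
    card {x. even_vertex x \<and> \<phi> x = 0 \<and> (fst x - 1, snd x) \<in> C}" (is "card ?R = card ?L")
proof -
  define E where "E p = int (card {h \<in> C. even_vertex h \<and> p \<le> \<phi> h})" for p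
  define N where "N p = int (card {h \<in> C. odd (fst h + snd h) \<and> p \<le> \<phi> h})" for p
  have lt: "a\<^sub>1 < 2 * pi" "a\<^sub>2 < 2 * pi" "a\<^sub>3 < 2 * pi" "a\<^sub>4 < 2 * pi"
    using arcs_pos arcs_sum by auto
  have "\<exists>K::int. \<forall>p. 0 \<le> p \<longrightarrow> p + a\<^sub>1 \<le> \<beta> \<longrightarrow> N (p + a\<^sub>1) = E p + K + (if p = 0 then int (card ?R) else 0)"
    unfolding E_def N_def
    by (rule count_shift_dstep[where k = 1 and l = 0, OF fin \<beta> C closed])
      (use arcs_pos lt in \<open>auto simp: dstep_def split_beta\<close>)
  then obtain K\<^sub>1 where K1: "\<And>p. 0 \<le> p \<Longrightarrow> p + a\<^sub>1 \<le> \<beta> \<Longrightarrow> N (p + a\<^sub>1) = E p + K\<^sub>1 + (if p = 0 then int (card ?R) else 0)"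
    by blast
  have "\<exists>K::int. \<forall>p. 0 \<le> p \<longrightarrow> p + a\<^sub>3 \<le> \<beta> \<longrightarrow> N (p + a\<^sub>3) = E p + K + (if p = 0 then int (card ?L) else 0)"
    unfolding E_def N_def
    by (rule count_shift_dstep[where k = "-1" and l = 0, OF fin \<beta> C closed])
      (use arcs_pos lt in \<open>auto simp: dstep_def split_beta\<close>)
  then obtain K\<^sub>3 where K3: "\<And>p. 0 \<le> p \<Longrightarrow> p + a\<^sub>3 \<le> \<beta> \<Longrightarrow> N (p + a\<^sub>3) = E p + K\<^sub>3 + (if p = 0 then int (card ?L) else 0)"
    by blast
  have "\<exists>K::int. \<forall>p. 0 \<le> p \<longrightarrow> p + a\<^sub>2 \<le> \<beta> \<longrightarrow> E (p + a\<^sub>2) = N p + K + (if p = 0 then int (card {x. odd (fst x + snd x) \<and> \<phi> x = 0 \<and> (fst x, snd x + 1) \<in> C}) else 0)"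
    unfolding E_def N_def
    by (rule count_shift_dstep[where k = 0 and l = 1, OF fin \<beta> C closed])
      (use arcs_pos lt in \<open>auto simp: dstep_def split_beta\<close>)
  then obtain K\<^sub>2 where K2: "\<And>p. 0 < p \<Longrightarrow> p + a\<^sub>2 \<le> \<beta> \<Longrightarrow> E (p + a\<^sub>2) = N p + K\<^sub>2"
    by force
  have "\<exists>K::int. \<forall>p. 0 \<le> p \<longrightarrow> p + a\<^sub>4 \<le> \<beta> \<longrightarrow> E (p + a\<^sub>4) = N p + K + (if p = 0 then int (card {x. odd (fst x + snd x) \<and> \<phi> x = 0 \<and> (fst x, snd x - 1) \<in> C}) else 0)"
    unfolding E_def N_def
    by (rule count_shift_dstep[where k = 0 and l = "-1", OF fin \<beta> C closed])
      (use arcs_pos lt in \<open>auto simp: dstep_def split_beta\<close>)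
  then obtain K\<^sub>4 where K4: "\<And>p. 0 < p \<Longrightarrow> p + a\<^sub>4 \<le> \<beta> \<Longrightarrow> E (p + a\<^sub>4) = N p + K\<^sub>4"
    by force
  \<comment> \<open>The four increments \<open>K\<^sub>i\<close> come from one function that is affine in the coordinates, the parity
    and the angle, because the only relation among the four steps is that the arcs sum to \<open>2\<pi>\<close>.\<close>
  define w where "w = (K\<^sub>1 + K\<^sub>2 + K\<^sub>3 + K\<^sub>4) / (2 * pi)"
  define Z where "Z = (K\<^sub>1 + K\<^sub>3 - w * (a\<^sub>1 + a\<^sub>3)) / 2"
  define X where "X = (K\<^sub>1 - K\<^sub>3 - w * (a\<^sub>1 - a\<^sub>3)) / 2"
  define Y where "Y = (K\<^sub>2 - K\<^sub>4 - w * (a\<^sub>2 - a\<^sub>4)) / 2"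
  have "w * (a\<^sub>1 + a\<^sub>2 + a\<^sub>3 + a\<^sub>4) = K\<^sub>1 + K\<^sub>2 + K\<^sub>3 + K\<^sub>4"
    using arcs_sum by (simp add: w_def)
  then have rel: "X + Z + w * a\<^sub>1 = K\<^sub>1" "- X + Z + w * a\<^sub>3 = K\<^sub>3" "Y - Z + w * a\<^sub>2 = K\<^sub>2" "- Y - Z + w * a\<^sub>4 = K\<^sub>4"
    by (auto simp: X_def Y_def Z_def field_simps)
  \<comment> \<open>The count at the angle of \<open>y\<close>, minus the affine function whose
    increments along the four kinds of steps are the \<open>K\<^sub>i\<close>; what remains does not
    change along a step that does not wrap.\<close>
  define f where "f = (\<lambda>y. (if even_vertex y then E (\<phi> y) else N (\<phi> y) - Z)
    - X * fst y - Y * snd y - w * \<phi> y)"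
  have f_step: "f y' = f y" if "dstep y y' a" "\<phi> y' = \<phi> y + a" "0 < \<phi> y" "\<phi> y' \<le> \<beta>" for y y' a
  proof -
    obtain i j i' j' where y: "y = (i, j)" "y' = (i', j')" by (cases y; cases y')
    from that(1) consider
        "even (i + j)" "j' = j" "i' = i + 1" "a = a\<^sub>1" | "even (i + j)" "j' = j" "i' = i - 1" "a = a\<^sub>3"
      | "odd (i + j)" "i' = i" "j' = j + 1" "a = a\<^sub>2" | "odd (i + j)" "i' = i" "j' = j - 1" "a = a\<^sub>4"
      unfolding y dstep_def by auto
    then show ?thesis
    proof cases
      case 1
      show ?thesis using 1(1) that(2-4) K1[of "\<phi> y"] rel(1) unfolding f_def y 1(2,3,4) by (simp add: algebra_simps)
    next
      case 2
      show ?thesis using 2(1) that(2-4) K3[of "\<phi> y"] rel(2) unfolding f_def y 2(2,3,4) by (simp add: algebra_simps)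
    next
      case 3
      show ?thesis using 3(1) that(2-4) K2[of "\<phi> y"] rel(3) unfolding f_def y 3(2,3,4) by (simp add: algebra_simps)
    next
      case 4
      show ?thesis using 4(1) that(2-4) K4[of "\<phi> y"] rel(4) unfolding f_def y 4(2,3,4) by (simp add: algebra_simps)
    qed
  qed
  have f_tile: "f y' = f y" if "(y, y') \<in> tilemates {0<..\<beta>}" for y y'
  proof -
    obtain t where y: "y \<in> corners t" "y' \<in> corners t" "0 < \<phi> y" "0 < \<phi> y'" "\<phi> y \<le> \<beta>" "\<phi> y' \<le> \<beta>"
      using \<open>(y, y') \<in> tilemates {0<..\<beta>}\<close> by (auto simp: tilemates_def)
    obtain c\<^sub>0 c\<^sub>1 c\<^sub>2 c\<^sub>3 b\<^sub>0 b\<^sub>1 b\<^sub>2 b\<^sub>3 where c: "corners t = {c\<^sub>0, c\<^sub>1, c\<^sub>2, c\<^sub>3}"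
      and d: "dstep c\<^sub>0 c\<^sub>1 b\<^sub>0" "dstep c\<^sub>1 c\<^sub>2 b\<^sub>1" "dstep c\<^sub>2 c\<^sub>3 b\<^sub>2" "dstep c\<^sub>3 c\<^sub>0 b\<^sub>3"
      and \<phi>: "\<phi> c\<^sub>1 = \<phi> c\<^sub>0 + b\<^sub>0" "\<phi> c\<^sub>2 = \<phi> c\<^sub>1 + b\<^sub>1" "\<phi> c\<^sub>3 = \<phi> c\<^sub>2 + b\<^sub>2"
      by (rule tile_cycle[of t]) blast
    have b: "0 < b\<^sub>0" "0 < b\<^sub>1" "0 < b\<^sub>2" using d dstep_bounds by blast+
    have 1: "f c\<^sub>1 = f c\<^sub>0" if "0 < \<phi> c\<^sub>0" "\<phi> c\<^sub>1 \<le> \<beta>" by (rule f_step[OF d(1) \<phi>(1) that])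
    have 2: "f c\<^sub>2 = f c\<^sub>1" if "0 < \<phi> c\<^sub>1" "\<phi> c\<^sub>2 \<le> \<beta>" by (rule f_step[OF d(2) \<phi>(2) that])
    have 3: "f c\<^sub>3 = f c\<^sub>2" if "0 < \<phi> c\<^sub>2" "\<phi> c\<^sub>3 \<le> \<beta>" by (rule f_step[OF d(3) \<phi>(3) that])
    have lt: "\<phi> c\<^sub>0 < \<phi> c\<^sub>1" "\<phi> c\<^sub>1 < \<phi> c\<^sub>2" "\<phi> c\<^sub>2 < \<phi> c\<^sub>3" using \<phi> b by auto
    \<comment> \<open>The wrapping fourth step is avoided: the other three join the corners in the
      order of their angles, so the intermediate corners stay in the interval.\<close>
    have *: "f y' = f y" if "y \<in> {c\<^sub>0, c\<^sub>1, c\<^sub>2, c\<^sub>3}" "y' \<in> {c\<^sub>0, c\<^sub>1, c\<^sub>2, c\<^sub>3}" "0 < \<phi> y" "\<phi> y' \<le> \<beta>" "\<phi> y \<le> \<phi> y'" for y y'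
    proof -
      from that(1) consider "y = c\<^sub>0" | "y = c\<^sub>1" | "y = c\<^sub>2" | "y = c\<^sub>3" by blast
      then show ?thesis
        using that(2-5) lt 1 2 3 by cases auto
    qed
    show ?thesis
      using *[of y y'] *[of y' y] y c by (cases "\<phi> y \<le> \<phi> y'") auto
  qed
  have "f y = f (1, 0)" if "((1, 0), y) \<in> (tilemates {0<..\<beta>})\<^sup>*" for y
    using that by induction (auto dest: f_tile)
  then have eq: "f (-1, 0) = f (1, 0)" using path by blast
  have \<phi>: "\<phi> (1, 0) = a\<^sub>1" "\<phi> (-1, 0) = a\<^sub>3"
    by (simp_all add: phi_neighbours)
  \<comment> \<open>The right neighbour is one step of length \<open>a\<^sub>1\<close> from angle
    \<open>0\<close>, so its count is given by the relation at the exceptional value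
    \<open>p = 0\<close>.\<close>
  have "f (1, 0) = E 0 + card ?R"
    using K1[of 0] le rel(1) unfolding f_def by (simp add: \<phi>)
  moreover have "f (-1, 0) = E 0 + card ?L"
    using K3[of 0] le rel(2) unfolding f_def by (simp add: \<phi>)
  ultimately show ?thesis using eq by simp
qed

section \<open>Components of the vertices folded to an arc\<close>

lemma tilematesI:
  "y \<in> corners t \<Longrightarrow> y' \<in> corners t \<Longrightarrow> \<phi> y \<in> I \<Longrightarrow> \<phi> y' \<in> I \<Longrightarrow> (y, y') \<in> tilemates I"
  unfolding tilemates_def by blast

lemma sym_tilemates: "sym (tilemates I)"
  by (auto simp: sym_def tilemates_def)

lemma tilemates_mono: "I \<subseteq> J \<Longrightarrow> tilemates I \<subseteq> tilemates J"
  by (auto simp: tilemates_def)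

lemma tilemates_range: "(y, y') \<in> (tilemates I)\<^sup>* \<Longrightarrow> y \<noteq> y' \<Longrightarrow> \<phi> y \<in> I \<and> \<phi> y' \<in> I"
  by (induction rule: rtrancl_induct) (auto simp: tilemates_def)

lemma tilemates_translate:
  assumes "(y, y') \<in> (tilemates I)\<^sup>*" and \<phi>: "\<And>x. \<phi> (fst x + i, snd x + j) = \<phi> x"
  shows "((fst y + i, snd y + j), (fst y' + i, snd y' + j)) \<in> (tilemates I)\<^sup>*"
  using assms(1)
proof induction
  case (step y z)
  then obtain t where t: "y \<in> corners t" "z \<in> corners t" "\<phi> y \<in> I" "\<phi> z \<in> I"
    by (auto simp: tilemates_def)
  have "(fst y + i, snd y + j) \<in> corners (fst t + i, snd t + j)"
    "(fst z + i, snd z + j) \<in> corners (fst t + i, snd t + j)"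
    using t by (auto simp: corners_def split_beta)
  then have "((fst y + i, snd y + j), (fst z + i, snd z + j)) \<in> tilemates I"
    using t \<phi>[of y] \<phi>[of z] unfolding tilemates_def by auto
  then show ?case using step.IH by simp
qed simp

lemma tilemates_bounded:
  assumes "(w, y) \<in> (tilemates I)\<^sup>*" "\<And>y. (w, y) \<in> (tilemates I)\<^sup>* \<Longrightarrow> \<phi> y \<le> b" "I \<subseteq> {0<..}"
  shows "(w, y) \<in> (tilemates {0<..b})\<^sup>*"
  using assms(1)
proof induction
  case (step y z)
  have "\<phi> y \<le> b" "\<phi> z \<le> b" using assms(2) step.hyps by (meson rtrancl.rtrancl_into_rtrancl)+
  then have "(y, z) \<in> tilemates {0<..b}"
    using step.hyps(2) assms(3) by (auto simp: tilemates_def)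
  then show ?case using step.IH by simp
qed simp

text \<open>A component of the vertices inside an arc \<open>(0,\<psi>)\<close> that contains both horizontal neighbours
  of the origin is infinite: at the least level at which they become connected, the part attached
  to only one of them would violate the balance.\<close>

theorem component_infinite:
  assumes "\<psi> \<le> 2 * pi" and fin: "finite {y. ((1, 0), y) \<in> (tilemates {0<..<\<psi>})\<^sup>*}"
    and path: "((1, 0), (-1, 0)) \<in> (tilemates {0<..<\<psi>})\<^sup>*"
  shows False
proof -
  define S where "S = {y. ((1, 0), y) \<in> (tilemates {0<..<\<psi>})\<^sup>*}"
  have finS: "finite S" and rS: "(1, 0) \<in> S" and lS: "(-1, 0) \<in> S"
    using fin path by (auto simp: S_def)
  \<comment> \<open>An angle-preserving translation that moves one vertex of \<open>S\<close> to
    another maps the finite set \<open>S\<close> onto itself; comparing the sums of the coordinates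
    over \<open>S\<close> leaves only the zero vector.\<close>
  have no_translate: "i = 0 \<and> j = 0"
    if "even (i + j)" "\<phi> (fst s + i, snd s + j) = \<phi> s" "s \<in> S" "(fst s + i, snd s + j) \<in> S" for i j s
  proof -
    let ?\<tau> = "\<lambda>x. (fst x + i, snd x + j)"
    have \<phi>: "\<phi> (?\<tau> x) = \<phi> x" for x
      using phi_translate[OF that(1), of "fst s" "snd s" "fst x" "snd x"] that(2) by simp
    have "?\<tau> ` S \<subseteq> S"
    proof clarify
      fix a b assume "(a, b) \<in> S"
      then have "(s, (a, b)) \<in> (tilemates {0<..<\<psi>})\<^sup>*"
        using that(3) sym_rtrancl[OF sym_tilemates[of "{0<..<\<psi>}"]] unfolding S_def
        by (auto dest: symD intro: rtrancl_trans)
      from tilemates_translate[OF this \<phi>] show "?\<tau> (a, b) \<in> S"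
        using that(4) unfolding S_def by (auto intro: rtrancl_trans)
    qed
    moreover have inj: "inj_on ?\<tau> S" by (auto simp: inj_on_def prod_eq_iff)
    ultimately have "?\<tau> ` S = S" using finS by (simp add: endo_inj_surj)
    then have "sum fst S = sum (\<lambda>x. fst x + i) S" "sum snd S = sum (\<lambda>x. snd x + j) S"
      using sum.reindex[OF inj, of fst] sum.reindex[OF inj, of snd] by (simp_all add: comp_def)
    then show ?thesis using finS rS by (auto simp: sum.distrib)
  qed
  \<comment> \<open>With equal arcs the translation by \<open>(2, 0)\<close> would preserve angles
    and carry the left neighbour of the origin to the right one.\<close>
  have neq: "a\<^sub>1 \<noteq> a\<^sub>3"
  proof
    assume "a\<^sub>1 = a\<^sub>3"
    then have "\<phi> (1, 0) = \<phi> (-1, 0)" by (metis phi_neighbours)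
    then have "\<phi> (-1 + 2, 0 + 0) = \<phi> (-1, 0)" by simp
    then show False using no_translate[of 2 0 "(-1, 0)"] rS lS by simp
  qed
  have range_S: "0 < \<phi> y \<and> \<phi> y < \<psi>" if "y \<in> S" for y
  proof (cases "y = (1, 0)")
    case True
    then show ?thesis using tilemates_range[OF path] by simp
  next
    case False
    then show ?thesis using that tilemates_range[of "(1, 0)" y "{0<..<\<psi>}"] by (auto simp: S_def)
  qed
  \<comment> \<open>Only angles attained in the finite set \<open>S\<close> are candidates, so that
    a least joining level exists.\<close>
  define B where "B = {b \<in> \<phi> ` S. ((1, 0), (-1, 0)) \<in> (tilemates {0<..b})\<^sup>*}"
  define \<beta> where "\<beta> = Min B"
  have "finite B" using finS by (simp add: B_def)
  have "Max (\<phi> ` S) \<in> B"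
  proof -
    have "{0<..<\<psi>} \<subseteq> {0<..}" by auto
    then have "((1, 0), (-1, 0)) \<in> (tilemates {0<..Max (\<phi> ` S)})\<^sup>*"
      using finS by (intro tilemates_bounded[OF path]) (auto simp: S_def)
    moreover have "Max (\<phi> ` S) \<in> \<phi> ` S" using finS rS by (intro Max_in) auto
    ultimately show ?thesis by (simp add: B_def)
  qed
  then have \<beta>B: "\<beta> \<in> B" using \<open>finite B\<close> unfolding \<beta>_def by (intro Min_in) auto
  then have path\<beta>: "((1, 0), (-1, 0)) \<in> (tilemates {0<..\<beta>})\<^sup>*" and "\<beta> < \<psi>"
    using range_S by (auto simp: B_def)
  have le: "a\<^sub>1 \<le> \<beta>" "a\<^sub>3 \<le> \<beta>"
    using tilemates_range[OF path\<beta>] by (simp_all add: phi_neighbours)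
  have minimal: "\<beta> \<le> b" if "b \<in> \<phi> ` S" "((1, 0), (-1, 0)) \<in> (tilemates {0<..b})\<^sup>*" for b
    using that \<open>finite B\<close> unfolding \<beta>_def B_def by (intro Min_le) auto
  \<comment> \<open>The neighbour with the smaller angle lies strictly below \<open>\<beta>\<close>;
    the other one may sit at \<open>\<beta>\<close> itself.\<close>
  define w :: "int \<times> int" where "w = (if a\<^sub>1 < a\<^sub>3 then (1, 0) else (-1, 0))"
  define w' :: "int \<times> int" where "w' = (if a\<^sub>1 < a\<^sub>3 then (-1, 0) else (1, 0))"
  have w: "0 < \<phi> w" "\<phi> w < \<beta>" "w \<in> S"
    using le neq rS lS range_S by (auto simp: w_def phi_neighbours)
  define C where "C = {y. (w, y) \<in> (tilemates {0<..<\<beta>})\<^sup>*}"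
  have wC: "w \<in> C" by (simp add: C_def)
  have C: "\<forall>x\<in>C. 0 < \<phi> x \<and> \<phi> x < \<beta>"
  proof
    fix x assume "x \<in> C"
    then show "0 < \<phi> x \<and> \<phi> x < \<beta>"
      using w tilemates_range[of w x "{0<..<\<beta>}"] by (cases "x = w") (auto simp: C_def)
  qed
  have closed: "\<forall>x\<in>C. \<forall>t y. x \<in> corners t \<longrightarrow> y \<in> corners t \<longrightarrow> 0 < \<phi> y \<longrightarrow> \<phi> y < \<beta> \<longrightarrow> y \<in> C"
  proof (intro ballI allI impI)
    fix x t y assume *: "x \<in> C" "x \<in> corners t" "y \<in> corners t" "0 < \<phi> y" "\<phi> y < \<beta>"
    then have "(x, y) \<in> tilemates {0<..<\<beta>}" using C by (intro tilematesI[where t = t]) auto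
    with *(1) show "y \<in> C" unfolding C_def by (auto intro: rtrancl_into_rtrancl)
  qed
  have "C \<subseteq> S"
  proof
    fix y assume "y \<in> C"
    moreover have "tilemates {0<..<\<beta>} \<subseteq> tilemates {0<..<\<psi>}"
      using \<open>\<beta> < \<psi>\<close> by (intro tilemates_mono) auto
    ultimately have "(w, y) \<in> (tilemates {0<..<\<psi>})\<^sup>*" unfolding C_def using rtrancl_mono by blast
    then show "y \<in> S" using w(3) unfolding S_def by (auto intro: rtrancl_trans)
  qed
  then have finC: "finite C" using finS finite_subset by blast
  \<comment> \<open>Otherwise the two neighbours would already be joined at the largest angle in
    \<open>C\<close>, which is below the minimal level \<open>\<beta>\<close>.\<close>
  have w'C: "w' \<notin> C"
  proof
    assume "w' \<in> C"
    then have "(w, w') \<in> (tilemates {0<..<\<beta>})\<^sup>*" by (simp add: C_def)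
    then have "(w, w') \<in> (tilemates {0<..Max (\<phi> ` C)})\<^sup>*"
      using finC by (intro tilemates_bounded[where I = "{0<..<\<beta>}"]) (auto simp: C_def)
    then have "((1, 0), (-1, 0)) \<in> (tilemates {0<..Max (\<phi> ` C)})\<^sup>*"
      using sym_rtrancl[OF sym_tilemates] unfolding w_def w'_def by (auto split: if_splits dest: symD)
    moreover have M: "Max (\<phi> ` C) \<in> \<phi> ` C" using finC wC by (intro Max_in) auto
    ultimately have "\<beta> \<le> Max (\<phi> ` C)" using minimal \<open>C \<subseteq> S\<close> by blast
    with M C show False by force
  qed
  have "\<beta> \<le> 2 * pi" using \<open>\<beta> < \<psi>\<close> assms(1) by simp
  note bal = balance[OF finC this C closed path\<beta> le]
  \<comment> \<open>The translation by \<open>x\<close> preserves angles because \<open>x\<close>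
    and the origin are both at angle \<open>0\<close>, and it moves \<open>(k, 0)\<close> within
    \<open>S\<close>.\<close>
  have translate: "x = (0, 0)" if "even_vertex x" "\<phi> x = 0" "(fst x + k, snd x) \<in> S" "(k, 0) \<in> S" for x k
  proof -
    have "\<phi> (0 + fst x, 0 + snd x) = \<phi> (0, 0)" using that(2) by simp
    from phi_translate[OF that(1) this, of k 0] show ?thesis
      using no_translate[of "fst x" "snd x" "(k, 0)"] that by (auto simp: add.commute prod_eq_iff)
  qed
  have fin_shift: "finite {x. even_vertex x \<and> \<phi> x = 0 \<and> (fst x + k, snd x) \<in> C}" for k
  proof -
    have "finite ((\<lambda>x. (fst x + k, snd x)) -` C)"
      using finC by (intro finite_vimageI) (auto simp: inj_def prod_eq_iff)
    then show ?thesis by (rule rev_finite_subset) auto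
  qed
  show False
  proof (cases "a\<^sub>1 < a\<^sub>3")
    case True
    \<comment> \<open>The origin is counted on the side of \<open>w\<close>. Anything counted on the
      other side would have to be the origin too, which would put \<open>w'\<close> into
      \<open>C\<close>.\<close>
    have "(0, 0) \<in> {x. even_vertex x \<and> \<phi> x = 0 \<and> (fst x + 1, snd x) \<in> C}"
      using wC True by (simp add: w_def)
    moreover have "{x. even_vertex x \<and> \<phi> x = 0 \<and> (fst x - 1, snd x) \<in> C} = {}"
    proof (rule ccontr)
      assume "{x. even_vertex x \<and> \<phi> x = 0 \<and> (fst x - 1, snd x) \<in> C} \<noteq> {}"
      then obtain x where x: "even_vertex x" "\<phi> x = 0" "(fst x - 1, snd x) \<in> C" by blast
      then have "(fst x + -1, snd x) \<in> S" using \<open>C \<subseteq> S\<close> by auto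
      then have "x = (0, 0)" using translate[of x "-1"] x lS by blast
      then show False using x(3) w'C True by (simp add: w'_def)
    qed
    moreover from calculation(2) bal
    have "card {x. even_vertex x \<and> \<phi> x = 0 \<and> (fst x + 1, snd x) \<in> C} = 0" by (simp only: card.empty)
    ultimately show False unfolding card_0_eq[OF fin_shift[of 1]] by blast
  next
    case False
    have "(0, 0) \<in> {x. even_vertex x \<and> \<phi> x = 0 \<and> (fst x - 1, snd x) \<in> C}"
      using wC False by (simp add: w_def)
    moreover have "{x. even_vertex x \<and> \<phi> x = 0 \<and> (fst x + 1, snd x) \<in> C} = {}"
    proof (rule ccontr)
      assume "{x. even_vertex x \<and> \<phi> x = 0 \<and> (fst x + 1, snd x) \<in> C} \<noteq> {}"
      then obtain x where x: "even_vertex x" "\<phi> x = 0" "(fst x + 1, snd x) \<in> C" by blast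
      then have "x = (0, 0)" using translate[of x 1] \<open>C \<subseteq> S\<close> rS by blast
      then show False using x(3) w'C False by (simp add: w'_def)
    qed
    moreover from calculation(2) bal
    have "card {x. even_vertex x \<and> \<phi> x = 0 \<and> (fst x - 1, snd x) \<in> C} = 0" by (simp only: card.empty)
    moreover have "finite {x. even_vertex x \<and> \<phi> x = 0 \<and> (fst x - 1, snd x) \<in> C}"
      using fin_shift[of "-1"] by simp
    ultimately show False by (simp only: card_0_eq) blast
  qed
qed

end

subsection \<open>Plane isometries and cyclic quadrilaterals\<close>

definition plane_isometry :: "(complex \<Rightarrow> complex) \<Rightarrow> bool" where
  "plane_isometry G \<longleftrightarrow> (\<exists>u w. cmod u = 1 \<and> (G = (\<lambda>z. u * z + w) \<or> G = (\<lambda>z. u * cnj z + w)))"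

text \<open>Once \<open>0\<close> and \<open>1\<close> are made fixed, the distances to them
  determine the real part of an image and its imaginary part up to sign; the image of
  \<open>\<i>\<close> decides the sign for all points at once.\<close>

lemma plane_isometryI:
  assumes iso: "\<And>x y. dist (G x) (G y) = dist x y"
  shows "plane_isometry G"
proof -
  define u where "u = G 1 - G 0"
  define K where "K z = (G z - G 0) / u" for z
  have u: "cmod u = 1" using iso[of 1 0] by (simp add: u_def dist_norm)
  then have "u \<noteq> 0" by auto
  have K: "cmod (K x - K y) = cmod (x - y)" for x y
  proof -
    have "K x - K y = (G x - G y) / u" by (simp add: K_def diff_divide_distrib)
    then show ?thesis using iso[of x y] u by (simp add: norm_divide dist_norm)
  qed
  have K01: "K 0 = 0" "K 1 = 1" using \<open>u \<noteq> 0\<close> by (simp_all add: K_def u_def)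
  have sq: "(Re (K x) - Re (K y))\<^sup>2 + (Im (K x) - Im (K y))\<^sup>2 = (Re x - Re y)\<^sup>2 + (Im x - Im y)\<^sup>2" for x y
    using K[of x y] by (metis cmod_power2 minus_complex.sel)
  have Re: "Re (K z) = Re z" for z
    using sq[of z 0] sq[of z 1] by (simp add: K01 power2_eq_square algebra_simps)
  then have Im: "(Im (K z))\<^sup>2 = (Im z)\<^sup>2" for z
    using sq[of z 0] by (simp add: K01)
  have G: "G z = u * K z + G 0" for z using \<open>u \<noteq> 0\<close> by (simp add: K_def)
  consider "Im (K \<i>) = 1" | "Im (K \<i>) = -1"
    using Im[of \<i>] by (auto simp: power2_eq_1_iff)
  then show ?thesis
  proof cases
    case 1
    have "Im (K z) = Im z" for z
      using sq[of z \<i>] Im[of z] Re[of z] Re[of \<i>] 1 by (simp add: power2_eq_square algebra_simps)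
    then have "K z = z" for z by (simp add: complex_eq_iff Re)
    then have "G = (\<lambda>z. u * z + G 0)" by (intro ext) (metis G)
    then show ?thesis unfolding plane_isometry_def using u by blast
  next
    case 2
    have "Im (K z) = - Im z" for z
      using sq[of z \<i>] Im[of z] Re[of z] Re[of \<i>] 2 by (simp add: power2_eq_square algebra_simps)
    then have "K z = cnj z" for z by (simp add: complex_eq_iff Re)
    then have "G = (\<lambda>z. u * cnj z + G 0)" by (intro ext) (metis G)
    then show ?thesis unfolding plane_isometry_def using u by blast
  qed
qed

lemma plane_isometry_cases:
  assumes "plane_isometry G"
  obtains u w where "cmod u = 1" "G = (\<lambda>z. u * z + w)" | u w where "cmod u = 1" "G = (\<lambda>z. u * cnj z + w)"
  using assms unfolding plane_isometry_def by blast

lemma plane_isometry_dist: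
  assumes "plane_isometry G" shows "dist (G x) (G y) = dist x y"
  using assms
proof (cases rule: plane_isometry_cases)
  case (1 u w)
  then have "G x - G y = u * (x - y)" by (simp add: algebra_simps)
  with 1 show ?thesis by (simp add: dist_norm norm_mult)
next
  case (2 u w)
  then have "G x - G y = u * cnj (x - y)" by (simp add: algebra_simps)
  with 2 show ?thesis by (simp only: dist_norm norm_mult complex_mod_cnj)
qed

lemma plane_isometry_inj: "plane_isometry G \<Longrightarrow> G x = G y \<longleftrightarrow> x = y"
  using plane_isometry_dist[of G x y] by (metis dist_eq_0_iff)

lemma plane_isometry_affine:
  assumes "plane_isometry G"
  shows "G (x + of_real s * (y - x)) = G x + of_real s * (G y - G x)"
  using assms by (cases rule: plane_isometry_cases) (auto simp: algebra_simps)

text \<open>The reflection in a side followed by the point reflection in its midpoint is the reflection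
  in the perpendicular bisector; on the circle with centre \<open>0\<close> it is \<open>z \<mapsto> ab/z\<close>.\<close>

lemma isometry_reflect_neighbour:
  assumes G: "plane_isometry G" and "a \<noteq> b" and \<rho>: "0 < \<rho>" "cmod (G a) = \<rho>" "cmod (G b) = \<rho>" "cmod (G z) = \<rho>"
  shows "G (line_reflection a b (a + b - z)) = G a * G b / G z"
proof -
  define A where "A = G a"
  define B where "B = G b"
  define Z where "Z = G z"
  have ne: "A \<noteq> 0" "B \<noteq> 0" "Z \<noteq> 0" "A \<noteq> B"
    using assms by (auto simp: A_def B_def Z_def plane_isometry_inj)
  have cA: "cnj A = of_real (\<rho>\<^sup>2) / A" "cnj B = of_real (\<rho>\<^sup>2) / B" "cnj Z = of_real (\<rho>\<^sup>2) / Z"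
    using ne \<rho> complex_norm_square[of A] complex_norm_square[of B] complex_norm_square[of Z]
    by (auto simp: A_def B_def Z_def field_simps)
  define q where "q = (b - z) / (b - a)"
  have refl: "line_reflection a b (a + b - z) = a + (b - a) * cnj q"
    by (simp add: line_reflection_def q_def)
  have "G (line_reflection a b (a + b - z)) = A + (B - A) * cnj ((B - Z) / (B - A))"
    using G
  proof (cases rule: plane_isometry_cases)
    case (1 u w)
    have "u \<noteq> 0" using 1(1) by auto
    have "B - Z = u * (b - z)" "B - A = u * (b - a)"
      by (simp_all add: A_def B_def Z_def 1(2) algebra_simps)
    then have "(B - Z) / (B - A) = q"
      using \<open>u \<noteq> 0\<close> by (simp add: q_def)
    then show ?thesis unfolding refl by (simp add: A_def B_def 1(2) algebra_simps)
  next
    case (2 u w)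
    have "u \<noteq> 0" using 2(1) by auto
    have "B - Z = u * cnj (b - z)" "B - A = u * cnj (b - a)"
      by (simp_all add: A_def B_def Z_def 2(2) algebra_simps)
    then have "(B - Z) / (B - A) = cnj q"
      using \<open>u \<noteq> 0\<close> by (simp add: q_def)
    then show ?thesis unfolding refl by (simp add: A_def B_def 2(2) algebra_simps)
  qed
  also have "\<dots> = A + (B - A) * ((cnj B - cnj Z) / (cnj B - cnj A))" by simp
  also have "\<dots> = A * B / Z"
  proof -
    have d1: "cnj B - cnj Z = of_real (\<rho>\<^sup>2) * (Z - B) / (B * Z)" and d2: "cnj B - cnj A = of_real (\<rho>\<^sup>2) * (A - B) / (B * A)"
      unfolding cA using ne by (simp_all add: field_simps)
    have r: "complex_of_real (\<rho>\<^sup>2) \<noteq> 0" using \<rho> by simp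
    have "R * x / (B * Z) / (R * y / (B * A)) = A * x / (Z * y)" if "R \<noteq> 0" for R x y
      using that ne by simp
    then have "(cnj B - cnj Z) / (cnj B - cnj A) = A * (Z - B) / (Z * (A - B))"
      unfolding d1 d2 using r by blast
    moreover have "(B - A) * (A * (Z - B) / (Z * (A - B))) = - (A * (Z - B) / Z)"
    proof -
      have "(B - A) * (x / (Z * (A - B))) = - (x / Z)" for x
      proof -
        have "(B - A) * (x / (Z * (A - B))) = - ((A - B) * x / ((A - B) * Z))"
          by (metis minus_diff_eq mult.commute mult_minus_left times_divide_eq_right minus_divide_left)
        also have "\<dots> = - (x / Z)" using ne by simp
        finally show ?thesis .
      qed
      then show ?thesis .
    qed
    moreover have "A + - (A * (Z - B) / Z) = A * B / Z"
      using ne by (simp add: right_diff_distrib diff_divide_distrib)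
    ultimately show ?thesis by simp
  qed
  finally show ?thesis by (simp add: A_def B_def Z_def)
qed

lemma isometry_functional:
  assumes "plane_isometry G" "cmod n = 1"
  obtains a k where "norm a = 1" "\<And>z. Re (cnj n * G z) = a \<bullet> z + k"
  using assms(1)
proof (cases rule: plane_isometry_cases)
  case (1 u w)
  show ?thesis
  proof (rule that[of "n * cnj u" "Re (cnj n * w)"])
    show "norm (n * cnj u) = 1" using 1 assms by (simp add: norm_mult)
    show "Re (cnj n * G z) = (n * cnj u) \<bullet> z + Re (cnj n * w)" for z
      by (simp add: 1 inner_complex_def algebra_simps)
  qed
next
  case (2 u w)
  show ?thesis
  proof (rule that[of "cnj n * u" "Re (cnj n * w)"])
    show "norm (cnj n * u) = 1" using 2 assms by (simp add: norm_mult)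
    show "Re (cnj n * G z) = (cnj n * u) \<bullet> z + Re (cnj n * w)" for z
      by (simp add: 2 inner_complex_def algebra_simps)
  qed
qed

text \<open>The hyperplane on which the functional attains its bound exposes a face, and a face of a
  polytope is spanned by the generators that it contains. The functional is expressed after folding,
  where the corners are on a known circle.\<close>

lemma supporting_face:
  assumes G: "plane_isometry G" "cmod n = 1" and "finite V"
    and le: "\<And>v. v \<in> V \<Longrightarrow> Re (cnj n * G v) \<le> b"
  shows "convex hull {v \<in> V. Re (cnj n * G v) = b} face_of convex hull V"
proof -
  obtain a k where ak: "\<And>z. Re (cnj n * G z) = a \<bullet> z + k" using isometry_functional[OF G] by blast
  have eq: "{v \<in> V. Re (cnj n * G v) = b} = {v \<in> V. a \<bullet> v = b - k}"
    unfolding ak by auto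
  have "convex hull V \<subseteq> {z. a \<bullet> z \<le> b - k}"
    using le unfolding ak by (intro hull_minimal convex_halfspace_le) force
  then have F: "convex hull V \<inter> {z. a \<bullet> z = b - k} face_of convex hull V"
    by (intro face_of_Int_supporting_hyperplane_le) auto
  obtain S where S: "S \<subseteq> V" "convex hull V \<inter> {z. a \<bullet> z = b - k} = convex hull S"
    using face_of_convex_hull_subset[OF _ F] \<open>finite V\<close> by (metis finite_imp_compact)
  have "S \<subseteq> {z. a \<bullet> z = b - k}" using S(2) hull_subset[of S convex] by blast
  then have "convex hull S \<subseteq> convex hull {v \<in> V. Re (cnj n * G v) = b}"
    using S(1) unfolding eq by (intro hull_mono) auto
  moreover have "convex hull {v \<in> V. Re (cnj n * G v) = b} \<subseteq> convex hull V \<inter> {z. a \<bullet> z = b - k}"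
    unfolding eq by (intro hull_minimal convex_Int convex_convex_hull convex_hyperplane) (auto intro: hull_inc)
  ultimately show ?thesis using F S(2) by (metis subset_antisym)
qed

lemma cos_less_symmetric:
  assumes "\<bar>y\<bar> < x" "x < 2 * pi - \<bar>y\<bar>"
  shows "cos x < cos (y :: real)"
proof -
  have "cos y - cos x = 2 * sin ((y + x) / 2) * sin ((x - y) / 2)"
    by (rule cos_diff_cos)
  moreover have "- x < y" "y < x" "x + y < 2 * pi" "x - y < 2 * pi"
    using assms by (auto simp: abs_if split: if_splits)
  then have "0 < sin ((y + x) / 2)" "0 < sin ((x - y) / 2)"
    by (auto intro!: sin_gt_zero)
  ultimately show ?thesis by (metis diff_gt_0_iff_gt mult_pos_pos zero_less_numeral)
qed

lemma Re_cis_cnj: "Re (cnj (cis m) * (of_real \<rho> * cis t)) = \<rho> * cos (t - m)"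
  by (simp add: cos_diff algebra_simps)

section \<open>Quadrilaterals with corners folded to a circle in cyclic order\<close>

definition folded_quad :: "(complex \<Rightarrow> complex) \<Rightarrow> real \<Rightarrow> complex \<Rightarrow> complex \<Rightarrow> complex \<Rightarrow> complex \<Rightarrow> bool" where
  "folded_quad G \<rho> c\<^sub>0 c\<^sub>1 c\<^sub>2 c\<^sub>3 \<longleftrightarrow> plane_isometry G \<and> 0 < \<rho> \<and>
     (\<exists>t\<^sub>0 t\<^sub>1 t\<^sub>2 t\<^sub>3. t\<^sub>0 < t\<^sub>1 \<and> t\<^sub>1 < t\<^sub>2 \<and> t\<^sub>2 < t\<^sub>3 \<and> t\<^sub>3 < t\<^sub>0 + 2 * pi \<and>
        G c\<^sub>0 = of_real \<rho> * cis t\<^sub>0 \<and> G c\<^sub>1 = of_real \<rho> * cis t\<^sub>1 \<and>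
        G c\<^sub>2 = of_real \<rho> * cis t\<^sub>2 \<and> G c\<^sub>3 = of_real \<rho> * cis t\<^sub>3)"

lemma folded_quad_rotate:
  assumes "folded_quad G \<rho> c\<^sub>0 c\<^sub>1 c\<^sub>2 c\<^sub>3"
  shows "folded_quad G \<rho> c\<^sub>1 c\<^sub>2 c\<^sub>3 c\<^sub>0"
proof -
  obtain t\<^sub>0 t\<^sub>1 t\<^sub>2 t\<^sub>3 where "t\<^sub>0 < t\<^sub>1" "t\<^sub>1 < t\<^sub>2" "t\<^sub>2 < t\<^sub>3" "t\<^sub>3 < t\<^sub>0 + 2 * pi"
     "G c\<^sub>0 = of_real \<rho> * cis t\<^sub>0" "G c\<^sub>1 = of_real \<rho> * cis t\<^sub>1" "G c\<^sub>2 = of_real \<rho> * cis t\<^sub>2" "G c\<^sub>3 = of_real \<rho> * cis t\<^sub>3"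
    using assms unfolding folded_quad_def by blast
  moreover have "cis (t\<^sub>0 + 2 * pi) = cis t\<^sub>0" by (simp add: cis_mult[symmetric])
  moreover have "plane_isometry G" "0 < \<rho>" using assms unfolding folded_quad_def by blast+
  ultimately show ?thesis
    unfolding folded_quad_def
    by (intro conjI exI[of _ t\<^sub>1] exI[of _ t\<^sub>2] exI[of _ t\<^sub>3] exI[of _ "t\<^sub>0 + 2 * pi"]) simp_all
qed

text \<open>In the direction of the midpoint of the arc from the first to the second corner, these
  two corners are equally far out, and the other two, being further along the circle, are strictly
  less far out.\<close>

lemma folded_quad_side_face:
  assumes "folded_quad G \<rho> c\<^sub>0 c\<^sub>1 c\<^sub>2 c\<^sub>3"
  shows "closed_segment c\<^sub>0 c\<^sub>1 face_of convex hull {c\<^sub>0, c\<^sub>1, c\<^sub>2, c\<^sub>3}" "c\<^sub>0 \<noteq> c\<^sub>1"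
proof -
  obtain t\<^sub>0 t\<^sub>1 t\<^sub>2 t\<^sub>3 where t: "t\<^sub>0 < t\<^sub>1" "t\<^sub>1 < t\<^sub>2" "t\<^sub>2 < t\<^sub>3" "t\<^sub>3 < t\<^sub>0 + 2 * pi" and G: "plane_isometry G" and \<rho>: "0 < \<rho>"
    and c: "G c\<^sub>0 = of_real \<rho> * cis t\<^sub>0" "G c\<^sub>1 = of_real \<rho> * cis t\<^sub>1" "G c\<^sub>2 = of_real \<rho> * cis t\<^sub>2" "G c\<^sub>3 = of_real \<rho> * cis t\<^sub>3"
    using assms unfolding folded_quad_def by blast
  define m where "m = (t\<^sub>0 + t\<^sub>1) / 2"
  define b where "b = \<rho> * cos ((t\<^sub>1 - t\<^sub>0) / 2)"
  have f: "Re (cnj (cis m) * G c\<^sub>0) = b" "Re (cnj (cis m) * G c\<^sub>1) = b"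
  proof -
    have "t\<^sub>0 - m = - ((t\<^sub>1 - t\<^sub>0) / 2)" "t\<^sub>1 - m = (t\<^sub>1 - t\<^sub>0) / 2" by (simp_all add: m_def field_simps)
    then show "Re (cnj (cis m) * G c\<^sub>0) = b" "Re (cnj (cis m) * G c\<^sub>1) = b"
      unfolding c Re_cis_cnj b_def by (simp_all only: cos_minus)
  qed
  have lt: "Re (cnj (cis m) * G c\<^sub>2) < b" "Re (cnj (cis m) * G c\<^sub>3) < b"
  proof -
    have *: "\<bar>(t\<^sub>1 - t\<^sub>0) / 2\<bar> = (t\<^sub>1 - t\<^sub>0) / 2" using t by simp
    have "cos (t\<^sub>2 - m) < cos ((t\<^sub>1 - t\<^sub>0) / 2)" "cos (t\<^sub>3 - m) < cos ((t\<^sub>1 - t\<^sub>0) / 2)"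
      by (rule cos_less_symmetric; unfold * m_def; use t in argo)+
    then show "Re (cnj (cis m) * G c\<^sub>2) < b" "Re (cnj (cis m) * G c\<^sub>3) < b"
      unfolding c Re_cis_cnj b_def using \<rho> by simp_all
  qed
  have "convex hull {v \<in> {c\<^sub>0, c\<^sub>1, c\<^sub>2, c\<^sub>3}. Re (cnj (cis m) * G v) = b} face_of convex hull {c\<^sub>0, c\<^sub>1, c\<^sub>2, c\<^sub>3}"
    by (rule supporting_face[OF G]) (use f lt in auto)
  moreover have "{v \<in> {c\<^sub>0, c\<^sub>1, c\<^sub>2, c\<^sub>3}. Re (cnj (cis m) * G v) = b} = {c\<^sub>0, c\<^sub>1}"
    using f lt by auto
  ultimately show "closed_segment c\<^sub>0 c\<^sub>1 face_of convex hull {c\<^sub>0, c\<^sub>1, c\<^sub>2, c\<^sub>3}"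
    by (simp only: segment_convex_hull)
  show "c\<^sub>0 \<noteq> c\<^sub>1"
  proof
    assume "c\<^sub>0 = c\<^sub>1"
    then have "Re (cnj (cis t\<^sub>0) * G c\<^sub>0) = Re (cnj (cis t\<^sub>0) * G c\<^sub>1)" by simp
    then have "cos (t\<^sub>1 - t\<^sub>0) = cos 0" unfolding c Re_cis_cnj using \<rho> by simp
    moreover have "cos (t\<^sub>1 - t\<^sub>0) < cos 0" using t by (intro cos_less_symmetric) auto
    ultimately show False by simp
  qed
qed

text \<open>The tangent of the circle at the folded corner is a supporting line that touches the
  folded quadrilateral there only.\<close>

lemma folded_quad_corner_extreme:
  assumes "folded_quad G \<rho> c\<^sub>0 c\<^sub>1 c\<^sub>2 c\<^sub>3"
  shows "c\<^sub>0 extreme_point_of convex hull {c\<^sub>0, c\<^sub>1, c\<^sub>2, c\<^sub>3}"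
proof -
  obtain t\<^sub>0 t\<^sub>1 t\<^sub>2 t\<^sub>3 where t: "t\<^sub>0 < t\<^sub>1" "t\<^sub>1 < t\<^sub>2" "t\<^sub>2 < t\<^sub>3" "t\<^sub>3 < t\<^sub>0 + 2 * pi" and G: "plane_isometry G" and \<rho>: "0 < \<rho>"
    and c: "G c\<^sub>0 = of_real \<rho> * cis t\<^sub>0" "G c\<^sub>1 = of_real \<rho> * cis t\<^sub>1" "G c\<^sub>2 = of_real \<rho> * cis t\<^sub>2" "G c\<^sub>3 = of_real \<rho> * cis t\<^sub>3"
    using assms unfolding folded_quad_def by blast
  have lt: "Re (cnj (cis t\<^sub>0) * G v) < \<rho>" if "v \<in> {c\<^sub>1, c\<^sub>2, c\<^sub>3}" for v
  proof -
    have "cos (s - t\<^sub>0) < 1" if "t\<^sub>0 < s" "s < t\<^sub>0 + 2 * pi" for s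
      using cos_less_symmetric[of 0 "s - t\<^sub>0"] that by simp
    then have "cos (t\<^sub>1 - t\<^sub>0) < 1" "cos (t\<^sub>2 - t\<^sub>0) < 1" "cos (t\<^sub>3 - t\<^sub>0) < 1" using t by auto
    then have "\<rho> * cos (t\<^sub>1 - t\<^sub>0) < \<rho> * 1" "\<rho> * cos (t\<^sub>2 - t\<^sub>0) < \<rho> * 1" "\<rho> * cos (t\<^sub>3 - t\<^sub>0) < \<rho> * 1"
      using \<rho> by (simp_all only: mult_strict_left_mono)
    then have "Re (cnj (cis t\<^sub>0) * G c\<^sub>1) < \<rho>" "Re (cnj (cis t\<^sub>0) * G c\<^sub>2) < \<rho>" "Re (cnj (cis t\<^sub>0) * G c\<^sub>3) < \<rho>"
      unfolding c Re_cis_cnj by auto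
    then show ?thesis using that by blast
  qed
  have eq: "Re (cnj (cis t\<^sub>0) * G c\<^sub>0) = \<rho>" unfolding c Re_cis_cnj by simp
  have "convex hull {v \<in> {c\<^sub>0, c\<^sub>1, c\<^sub>2, c\<^sub>3}. Re (cnj (cis t\<^sub>0) * G v) = \<rho>} face_of convex hull {c\<^sub>0, c\<^sub>1, c\<^sub>2, c\<^sub>3}"
    by (rule supporting_face[OF G]) (use eq lt in \<open>auto intro: less_imp_le\<close>)
  moreover have "{v \<in> {c\<^sub>0, c\<^sub>1, c\<^sub>2, c\<^sub>3}. Re (cnj (cis t\<^sub>0) * G v) = \<rho>} = {c\<^sub>0}"
    using eq lt by fastforce
  ultimately show ?thesis by (simp add: face_of_singleton)
qed

text \<open>This is twice the signed area of the inscribed triangle, as a product of the sines of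
  its half-arcs; it yields positivity for corners in counterclockwise order.\<close>

lemma cross_circle:
  "Im (cnj (of_real \<rho> * cis s - of_real \<rho> * cis r) * (of_real \<rho> * cis t - of_real \<rho> * cis r)) =
   4 * \<rho>\<^sup>2 * sin ((s - r) / 2) * sin ((t - s) / 2) * sin ((t - r) / 2)"
proof -
  define a b where "a = (s - r) / 2" and "b = (t - s) / 2"
  have st: "s = r + 2 * a" "t = r + 2 * a + 2 * b" "(t - r) / 2 = a + b" by (simp_all add: a_def b_def field_simps)
  have "Im (cnj (of_real \<rho> * cis s - of_real \<rho> * cis r) * (of_real \<rho> * cis t - of_real \<rho> * cis r)) =
    \<rho>\<^sup>2 * (sin (t - s) - sin (t - r) + sin (s - r))"
    by (simp add: sin_diff power2_eq_square algebra_simps)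
  also have "sin (t - s) - sin (t - r) + sin (s - r) = sin (2 * b) - sin (2 * (a + b)) + sin (2 * a)"
  proof -
    have "t - s = 2 * b" "t - r = 2 * (a + b)" "s - r = 2 * a" by (simp_all add: a_def b_def field_simps)
    then show ?thesis by (simp only:)
  qed
  also have "\<dots> = 4 * sin a * sin b * sin (a + b)"
  proof -
    have "(sin a)\<^sup>2 + (cos a)\<^sup>2 = 1" "(sin b)\<^sup>2 + (cos b)\<^sup>2 = 1" by simp_all
    moreover have "sin (2 * (a + b)) = 2 * (sin a * cos b + cos a * sin b) * (cos a * cos b - sin a * sin b)"
      unfolding sin_double[of "a + b"] sin_add cos_add by simp
    ultimately show ?thesis unfolding sin_double[of a] sin_double[of b] sin_add by algebra
  qed
  finally show ?thesis by (simp add: st(3) a_def[symmetric] b_def[symmetric])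
qed

text \<open>The position of the crossing on a diagonal is a ratio of areas of triangles cut off by
  the other diagonal. All these areas are positive, and \<open>A + B = C + D\<close> because both
  sums are twice the area of the quadrilateral.\<close>

lemma folded_quad_diagonals:
  assumes "folded_quad G \<rho> c\<^sub>0 c\<^sub>1 c\<^sub>2 c\<^sub>3"
  obtains s t where "0 < s" "s < 1" "0 < t" "t < 1"
    "c\<^sub>0 + of_real s * (c\<^sub>2 - c\<^sub>0) = c\<^sub>1 + of_real t * (c\<^sub>3 - c\<^sub>1)"
proof -
  obtain t\<^sub>0 t\<^sub>1 t\<^sub>2 t\<^sub>3 where t: "t\<^sub>0 < t\<^sub>1" "t\<^sub>1 < t\<^sub>2" "t\<^sub>2 < t\<^sub>3" "t\<^sub>3 < t\<^sub>0 + 2 * pi" and G: "plane_isometry G" and \<rho>: "0 < \<rho>"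
    and c: "G c\<^sub>0 = of_real \<rho> * cis t\<^sub>0" "G c\<^sub>1 = of_real \<rho> * cis t\<^sub>1" "G c\<^sub>2 = of_real \<rho> * cis t\<^sub>2" "G c\<^sub>3 = of_real \<rho> * cis t\<^sub>3"
    using assms unfolding folded_quad_def by blast
  define cr where "cr = (\<lambda>p q r. Im (cnj (q - p) * (r - p)))"
  have pos: "0 < cr (of_real \<rho> * cis a) (of_real \<rho> * cis b) (of_real \<rho> * cis d)"
    if "a < b" "b < d" "d < a + 2 * pi" for a b d
    unfolding cr_def cross_circle using that \<rho> by (intro mult_pos_pos sin_gt_zero) auto
  define A B C D where "A = cr (G c\<^sub>0) (G c\<^sub>1) (G c\<^sub>3)" and "B = cr (G c\<^sub>1) (G c\<^sub>2) (G c\<^sub>3)"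
    and "C = cr (G c\<^sub>0) (G c\<^sub>1) (G c\<^sub>2)" and "D = cr (G c\<^sub>0) (G c\<^sub>2) (G c\<^sub>3)"
  have P: "0 < A" "0 < B" "0 < C" "0 < D"
    unfolding A_def B_def C_def D_def c by (rule pos; use t in linarith)+
  have AB: "A + B = C + D"
    unfolding A_def B_def C_def D_def cr_def minus_complex.sel times_complex.sel cnj.sel by algebra
  define s u where "s = A / (A + B)" and "u = C / (A + B)"
  have su: "0 < s" "s < 1" "0 < u" "u < 1" using P AB by (auto simp: s_def u_def)
  have ratio: "x + s * y = p + u * q" if "(A + B) * x + A * y = (A + B) * p + C * q" for x y p q
  proof -
    have "x + s * y = ((A + B) * x + A * y) / (A + B)" "p + u * q = ((A + B) * p + C * q) / (A + B)"
      using P by (simp_all add: s_def u_def add_divide_distrib)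
    then show ?thesis using that by simp
  qed
  have "(A + B) * Re (G c\<^sub>0) + A * (Re (G c\<^sub>2) - Re (G c\<^sub>0)) = (A + B) * Re (G c\<^sub>1) + C * (Re (G c\<^sub>3) - Re (G c\<^sub>1))"
    "(A + B) * Im (G c\<^sub>0) + A * (Im (G c\<^sub>2) - Im (G c\<^sub>0)) = (A + B) * Im (G c\<^sub>1) + C * (Im (G c\<^sub>3) - Im (G c\<^sub>1))"
    unfolding A_def B_def C_def cr_def minus_complex.sel times_complex.sel cnj.sel by algebra+
  then have "Re (G c\<^sub>0) + s * (Re (G c\<^sub>2) - Re (G c\<^sub>0)) = Re (G c\<^sub>1) + u * (Re (G c\<^sub>3) - Re (G c\<^sub>1))"
    "Im (G c\<^sub>0) + s * (Im (G c\<^sub>2) - Im (G c\<^sub>0)) = Im (G c\<^sub>1) + u * (Im (G c\<^sub>3) - Im (G c\<^sub>1))"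
    using ratio by blast+
  then have "G c\<^sub>0 + of_real s * (G c\<^sub>2 - G c\<^sub>0) = G c\<^sub>1 + of_real u * (G c\<^sub>3 - G c\<^sub>1)"
    by (simp add: complex_eq_iff)
  then have "G (c\<^sub>0 + of_real s * (c\<^sub>2 - c\<^sub>0)) = G (c\<^sub>1 + of_real u * (c\<^sub>3 - c\<^sub>1))"
    by (simp add: plane_isometry_affine[OF G])
  then show ?thesis using that su plane_isometry_inj[OF G] by blast
qed

lemma folded_quad_distinct:
  assumes "folded_quad G \<rho> c\<^sub>0 c\<^sub>1 c\<^sub>2 c\<^sub>3"
  shows "distinct [c\<^sub>0, c\<^sub>1, c\<^sub>2, c\<^sub>3]"
proof -
  obtain t\<^sub>0 t\<^sub>1 t\<^sub>2 t\<^sub>3 where t: "t\<^sub>0 < t\<^sub>1" "t\<^sub>1 < t\<^sub>2" "t\<^sub>2 < t\<^sub>3" "t\<^sub>3 < t\<^sub>0 + 2 * pi" and \<rho>: "0 < \<rho>"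
    and c: "G c\<^sub>0 = of_real \<rho> * cis t\<^sub>0" "G c\<^sub>1 = of_real \<rho> * cis t\<^sub>1" "G c\<^sub>2 = of_real \<rho> * cis t\<^sub>2" "G c\<^sub>3 = of_real \<rho> * cis t\<^sub>3"
    using assms unfolding folded_quad_def by blast
  have ne: "x \<noteq> y" if "G x = of_real \<rho> * cis a" "G y = of_real \<rho> * cis b" "a < b" "b < a + 2 * pi" for x y a b
  proof
    assume "x = y"
    then have "of_real \<rho> * cis a = of_real \<rho> * cis b" by (metis that(1,2))
    then have "Re (cnj (cis a) * (of_real \<rho> * cis a)) = Re (cnj (cis a) * (of_real \<rho> * cis b))"
      by (simp only:)
    then have "cos (b - a) = 1" unfolding Re_cis_cnj using \<rho> by simp
    then show False using cos_less_symmetric[of 0 "b - a"] that by simp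
  qed
  have "c\<^sub>0 \<noteq> c\<^sub>1" "c\<^sub>0 \<noteq> c\<^sub>2" "c\<^sub>0 \<noteq> c\<^sub>3" "c\<^sub>1 \<noteq> c\<^sub>2" "c\<^sub>1 \<noteq> c\<^sub>3" "c\<^sub>2 \<noteq> c\<^sub>3"
    by (rule ne[OF c(1,2)] ne[OF c(1,3)] ne[OF c(1,4)] ne[OF c(2,3)] ne[OF c(2,4)] ne[OF c(3,4)]; use t in linarith)+
  then show ?thesis by auto
qed

lemma folded_quad_extreme:
  assumes "folded_quad G \<rho> c\<^sub>0 c\<^sub>1 c\<^sub>2 c\<^sub>3"
  shows "z extreme_point_of convex hull {c\<^sub>0, c\<^sub>1, c\<^sub>2, c\<^sub>3} \<longleftrightarrow> z \<in> {c\<^sub>0, c\<^sub>1, c\<^sub>2, c\<^sub>3}"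
proof
  note r = assms folded_quad_rotate[OF assms] folded_quad_rotate[OF folded_quad_rotate[OF assms]]
    folded_quad_rotate[OF folded_quad_rotate[OF folded_quad_rotate[OF assms]]]
  have s: "{c\<^sub>1, c\<^sub>2, c\<^sub>3, c\<^sub>0} = {c\<^sub>0, c\<^sub>1, c\<^sub>2, c\<^sub>3}" "{c\<^sub>2, c\<^sub>3, c\<^sub>0, c\<^sub>1} = {c\<^sub>0, c\<^sub>1, c\<^sub>2, c\<^sub>3}" "{c\<^sub>3, c\<^sub>0, c\<^sub>1, c\<^sub>2} = {c\<^sub>0, c\<^sub>1, c\<^sub>2, c\<^sub>3}"
    by auto
  assume "z \<in> {c\<^sub>0, c\<^sub>1, c\<^sub>2, c\<^sub>3}"
  then show "z extreme_point_of convex hull {c\<^sub>0, c\<^sub>1, c\<^sub>2, c\<^sub>3}"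
    using r[THEN folded_quad_corner_extreme] unfolding s by blast
qed (rule extreme_point_of_convex_hull)

lemma folded_quad_not_collinear:
  assumes "folded_quad G \<rho> c\<^sub>0 c\<^sub>1 c\<^sub>2 c\<^sub>3"
  shows "\<not> collinear {c\<^sub>0, c\<^sub>1, c\<^sub>2}"
proof
  assume "collinear {c\<^sub>0, c\<^sub>1, c\<^sub>2}"
  then have "c\<^sub>0 \<in> closed_segment c\<^sub>1 c\<^sub>2 \<or> c\<^sub>1 \<in> closed_segment c\<^sub>2 c\<^sub>0 \<or> c\<^sub>2 \<in> closed_segment c\<^sub>0 c\<^sub>1"
    unfolding collinear_between_cases between_mem_segment .
  moreover have "x = y \<or> x = w" if "x \<in> closed_segment y w" "x \<in> {c\<^sub>0, c\<^sub>1, c\<^sub>2}" "y \<in> {c\<^sub>0, c\<^sub>1, c\<^sub>2}" "w \<in> {c\<^sub>0, c\<^sub>1, c\<^sub>2}" for x y w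
  proof -
    have "y \<in> convex hull {c\<^sub>0, c\<^sub>1, c\<^sub>2, c\<^sub>3}" "w \<in> convex hull {c\<^sub>0, c\<^sub>1, c\<^sub>2, c\<^sub>3}"
      using that by (auto intro: hull_inc)
    moreover have "x extreme_point_of convex hull {c\<^sub>0, c\<^sub>1, c\<^sub>2, c\<^sub>3}"
      using that folded_quad_extreme[OF assms] by blast
    ultimately show ?thesis using that(1) unfolding extreme_point_of_def open_segment_def by blast
  qed
  ultimately show False using folded_quad_distinct[OF assms] by (metis distinct_length_2_or_more insertCI)
qed

lemma folded_quad_interior:
  assumes "folded_quad G \<rho> c\<^sub>0 c\<^sub>1 c\<^sub>2 c\<^sub>3"
  shows "interior (convex hull {c\<^sub>0, c\<^sub>1, c\<^sub>2, c\<^sub>3}) \<noteq> {}"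
proof -
  have "\<not> affine_dependent {c\<^sub>0, c\<^sub>1, c\<^sub>2}"
    using folded_quad_not_collinear[OF assms] by (simp add: collinear_3_eq_affine_dependent)
  moreover have "card {c\<^sub>0, c\<^sub>1, c\<^sub>2} = Suc (DIM(complex))"
    using folded_quad_distinct[OF assms] by simp
  ultimately have "interior (convex hull {c\<^sub>0, c\<^sub>1, c\<^sub>2}) \<noteq> {}"
    by (simp add: interior_convex_hull_eq_empty)
  moreover have "convex hull {c\<^sub>0, c\<^sub>1, c\<^sub>2} \<subseteq> convex hull {c\<^sub>0, c\<^sub>1, c\<^sub>2, c\<^sub>3}" by (intro hull_mono) auto
  ultimately show ?thesis using interior_mono by blast
qed

lemma folded_quad_side:
  assumes "folded_quad G \<rho> c\<^sub>0 c\<^sub>1 c\<^sub>2 c\<^sub>3"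
  shows "closed_segment c\<^sub>0 c\<^sub>1 edge_of convex hull {c\<^sub>0, c\<^sub>1, c\<^sub>2, c\<^sub>3}"
  using folded_quad_side_face[OF assms] by (simp add: edge_of_def segment_convex_hull aff_dim_convex_hull aff_dim_2)

text \<open>The diagonals cross at a point inside both, so a face containing one of them would
  contain the ends of the other, and an extreme point would lie inside a segment.\<close>

lemma folded_quad_diagonal_not_face:
  assumes "folded_quad G \<rho> c\<^sub>0 c\<^sub>1 c\<^sub>2 c\<^sub>3"
  shows "\<not> closed_segment c\<^sub>0 c\<^sub>2 face_of convex hull {c\<^sub>0, c\<^sub>1, c\<^sub>2, c\<^sub>3}"
proof
  assume F: "closed_segment c\<^sub>0 c\<^sub>2 face_of convex hull {c\<^sub>0, c\<^sub>1, c\<^sub>2, c\<^sub>3}"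
  have d: "c\<^sub>0 \<noteq> c\<^sub>1" "c\<^sub>1 \<noteq> c\<^sub>2" "c\<^sub>1 \<noteq> c\<^sub>3" using folded_quad_distinct[OF assms] by auto
  obtain s t where st: "0 < s" "s < 1" "0 < t" "t < 1"
    and X: "c\<^sub>0 + of_real s * (c\<^sub>2 - c\<^sub>0) = c\<^sub>1 + of_real t * (c\<^sub>3 - c\<^sub>1)"
    by (rule folded_quad_diagonals[OF assms])
  let ?X = "c\<^sub>0 + of_real s * (c\<^sub>2 - c\<^sub>0)"
  have "?X \<in> closed_segment c\<^sub>0 c\<^sub>2"
    unfolding in_segment using st by (intro exI[of _ s]) (simp add: scaleR_conv_of_real algebra_simps)
  moreover have "?X \<in> open_segment c\<^sub>1 c\<^sub>3"
    unfolding in_segment X using st d by (intro conjI exI[of _ t]) (simp_all add: scaleR_conv_of_real algebra_simps)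
  moreover have "c\<^sub>1 \<in> convex hull {c\<^sub>0, c\<^sub>1, c\<^sub>2, c\<^sub>3}" "c\<^sub>3 \<in> convex hull {c\<^sub>0, c\<^sub>1, c\<^sub>2, c\<^sub>3}"
    by (auto intro: hull_inc)
  ultimately have "c\<^sub>1 \<in> closed_segment c\<^sub>0 c\<^sub>2" using F unfolding face_of_def by blast
  then have "c\<^sub>1 \<in> open_segment c\<^sub>0 c\<^sub>2" using d by (simp add: open_segment_def)
  moreover have "c\<^sub>1 extreme_point_of convex hull {c\<^sub>0, c\<^sub>1, c\<^sub>2, c\<^sub>3}"
    using folded_quad_extreme[OF assms] by blast
  moreover have "c\<^sub>0 \<in> convex hull {c\<^sub>0, c\<^sub>1, c\<^sub>2, c\<^sub>3}" "c\<^sub>2 \<in> convex hull {c\<^sub>0, c\<^sub>1, c\<^sub>2, c\<^sub>3}"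
    by (auto intro: hull_inc)
  ultimately show False unfolding extreme_point_of_def by blast
qed

lemma folded_quad_edge_imp_side:
  assumes "folded_quad G \<rho> c\<^sub>0 c\<^sub>1 c\<^sub>2 c\<^sub>3" and e: "closed_segment a b edge_of convex hull {c\<^sub>0, c\<^sub>1, c\<^sub>2, c\<^sub>3}"
  shows "{a, b} \<in> {{c\<^sub>0, c\<^sub>1}, {c\<^sub>1, c\<^sub>2}, {c\<^sub>2, c\<^sub>3}, {c\<^sub>3, c\<^sub>0}}" "a \<noteq> b"
proof -
  let ?P = "convex hull {c\<^sub>0, c\<^sub>1, c\<^sub>2, c\<^sub>3}"
  have F: "closed_segment a b face_of ?P" and "aff_dim (closed_segment a b) = 1"
    using e by (auto simp: edge_of_def)
  then show "a \<noteq> b" by auto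
  have "a extreme_point_of ?P" "b extreme_point_of ?P"
    using extreme_point_of_face[OF F] by (auto simp: extreme_point_of_segment)
  then have ab: "a \<in> {c\<^sub>0, c\<^sub>1, c\<^sub>2, c\<^sub>3}" "b \<in> {c\<^sub>0, c\<^sub>1, c\<^sub>2, c\<^sub>3}"
    unfolding folded_quad_extreme[OF assms(1)] by blast+
  have "{a, b} \<noteq> {c\<^sub>0, c\<^sub>2}"
    using folded_quad_diagonal_not_face[OF assms(1)] F by (metis segment_convex_hull)
  moreover have "{a, b} \<noteq> {c\<^sub>1, c\<^sub>3}"
  proof -
    have "{c\<^sub>1, c\<^sub>2, c\<^sub>3, c\<^sub>0} = {c\<^sub>0, c\<^sub>1, c\<^sub>2, c\<^sub>3}" by auto
    then show ?thesis
      using folded_quad_diagonal_not_face[OF folded_quad_rotate[OF assms(1)]] F by (metis segment_convex_hull)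
  qed
  ultimately show "{a, b} \<in> {{c\<^sub>0, c\<^sub>1}, {c\<^sub>1, c\<^sub>2}, {c\<^sub>2, c\<^sub>3}, {c\<^sub>3, c\<^sub>0}}"
    using ab \<open>a \<noteq> b\<close> by auto
qed

subsection \<open>Neighbours in an edge-to-edge tiling\<close>

text \<open>The common face meets the relative interior of \<open>e\<close> and hence contains
  \<open>e\<close>. It is not two-dimensional because the interiors are disjoint, and a face of
  dimension one cannot properly contain another.\<close>

lemma tile_through_edge_point:
  assumes T: "edge_to_edge_tiling T" and "P \<in> T" "Q \<in> T" "P \<noteq> Q" "convex P" "interior P \<noteq> {}"
    and e: "e edge_of P" and z: "z \<in> rel_interior e" "z \<in> Q"
  shows "neighbours T P Q e \<and> P \<inter> Q = e"
proof -
  have F: "P \<inter> Q face_of P" "P \<inter> Q face_of Q" and disj: "interior P \<inter> interior Q = {}"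
    using T assms(2-4) unfolding edge_to_edge_tiling_def by blast+
  have e': "e face_of P" "aff_dim e = 1" "e \<subseteq> P" using e by (auto simp: edge_of_def face_of_imp_subset)
  have "z \<in> P" using z(1) e' rel_interior_subset by blast
  then have sub: "e \<subseteq> P \<inter> Q"
    using subset_of_face_of[OF F(1) e'(3)] z by blast
  have "P \<inter> Q \<noteq> P"
  proof
    assume "P \<inter> Q = P"
    then have "interior P \<subseteq> interior Q" using interior_mono by blast
    then show False using disj assms(6) by blast
  qed
  then have "aff_dim (P \<inter> Q) < aff_dim P" by (rule face_of_aff_dim_lt[OF assms(5) F(1)])
  moreover have "aff_dim P \<le> 2" using aff_dim_le_DIM[of P] by simp
  ultimately have dim: "aff_dim (P \<inter> Q) \<le> 1" by simp
  have "P \<inter> Q = e"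
  proof (rule ccontr)
    assume "P \<inter> Q \<noteq> e"
    moreover have "e face_of P \<inter> Q" using e'(1) sub by (rule face_of_subset) auto
    moreover have "convex (P \<inter> Q)" using F(1) face_of_imp_convex by blast
    ultimately have "aff_dim e < aff_dim (P \<inter> Q)" using face_of_aff_dim_lt by blast
    then show False using dim e' by simp
  qed
  moreover have "e edge_of Q" using F(2) e' \<open>P \<inter> Q = e\<close> by (simp add: edge_of_def)
  ultimately show ?thesis using assms by (simp add: neighbours_def)
qed

text \<open>By local finiteness the other tiles near a relative interior point of \<open>e\<close>
  have a closed union. If none of them contained the point, it would be interior to
  \<open>P\<close>, although it lies on a proper face.\<close>

lemma neighbour_exists:
  assumes T: "edge_to_edge_tiling T" and closed: "\<And>Q. Q \<in> T \<Longrightarrow> closed Q"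
    and P: "P \<in> T" "convex P" "interior P \<noteq> {}" and e: "e edge_of P"
  shows "\<exists>Q. neighbours T P Q e"
proof -
  have e': "e face_of P" "aff_dim e = 1" using e by (auto simp: edge_of_def)
  have "convex e" "e \<noteq> {}" using e' face_of_imp_convex by auto
  then obtain z where z: "z \<in> rel_interior e" using rel_interior_eq_empty by blast
  have "\<exists>Q\<in>T. Q \<noteq> P \<and> z \<in> Q"
  proof (rule ccontr)
    assume *: "\<not> ?thesis"
    have "locally_finite_in euclidean T" using T by (simp add: edge_to_edge_tiling_def)
    then have "\<exists>V. open V \<and> z \<in> V \<and> finite {U \<in> T. U \<inter> V \<noteq> {}}"
      by (simp add: locally_finite_in_def)
    then obtain V where V: "open V" "z \<in> V" "finite {U \<in> T. U \<inter> V \<noteq> {}}" by blast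
    define K where "K = \<Union>({U \<in> T. U \<inter> V \<noteq> {}} - {P})"
    have "closed K" unfolding K_def using V(3) closed by (intro closed_Union) auto
    have "V - K \<subseteq> P"
    proof
      fix w assume w: "w \<in> V - K"
      obtain U where "U \<in> T" "w \<in> U" using T unfolding edge_to_edge_tiling_def by blast
      then show "w \<in> P" using w unfolding K_def by blast
    qed
    moreover have "open (V - K)" using V(1) \<open>closed K\<close> by (rule open_Diff)
    moreover have "z \<in> V - K" using V(2) * unfolding K_def by blast
    ultimately have "z \<in> interior P" by (meson interiorI)
    moreover have "e \<noteq> P"
    proof
      assume "e = P"
      then have "aff_dim e = 2" using aff_dim_nonempty_interior[OF P(3)] by simp
      then show False using e' by simp
    qed
    ultimately show False
      using face_of_disjoint_interior[OF e'(1)] z rel_interior_subset by blast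
  qed
  then obtain Q where "Q \<in> T" "Q \<noteq> P" "z \<in> Q" by blast
  then show ?thesis using tile_through_edge_point[OF T P(1) _ _ P(2,3) e z] by blast
qed

lemma cyclic_quadrilateral_compact_convex:
  assumes "cyclic_quadrilateral P" shows "compact P" "convex P"
proof -
  obtain V where "card V = 4" "P = convex hull V" using assms unfolding cyclic_quadrilateral_def by blast
  moreover then have "finite V" using card.infinite by fastforce
  ultimately show "compact P" "convex P" by (auto simp: finite_imp_compact_convex_hull)
qed

subsection \<open>The lattice of tiles and its folding\<close>

locale folded_tiling = arcs +
  fixes T :: "complex set set" and H :: "complex set \<Rightarrow> complex \<Rightarrow> complex" and \<rho> :: real
    and A B C D :: complex
  assumes tiling: "edge_to_edge_tiling T"
    and quads: "\<And>P. P \<in> T \<Longrightarrow> cyclic_quadrilateral P"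
    and symmetric: "\<And>P Q a b. neighbours T P Q (closed_segment a b) \<Longrightarrow> Q = central_symmetry (midpoint a b) ` P"
    and H_isometry: "\<And>P. P \<in> T \<Longrightarrow> plane_isometry (H P)"
    and H_neighbours: "\<And>P Q a b. neighbours T P Q (closed_segment a b) \<Longrightarrow> H Q = H P \<circ> line_reflection a b"
    and base: "convex hull {A, B, C, D} \<in> T"
    and rho: "0 < \<rho>"
    and base_corners: "H (convex hull {A, B, C, D}) A = of_real \<rho>"
      "H (convex hull {A, B, C, D}) B = of_real \<rho> * cis a\<^sub>1"
      "H (convex hull {A, B, C, D}) C = of_real \<rho> * cis (a\<^sub>1 + a\<^sub>2)"
      "H (convex hull {A, B, C, D}) D = of_real \<rho> * cis (a\<^sub>1 + a\<^sub>2 + a\<^sub>3)"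
begin

text \<open>The even vertices are the translates of \<open>A\<close> by the lattice spanned by the
  diagonals \<open>C - A\<close> and \<open>B - D\<close>; the odd vertices form a shifted copy. The
  formula has the same shape as \<open>phase\<close>, so point reflections act on both in the same
  way.\<close>

definition pos :: "int \<times> int \<Rightarrow> complex" where
  "pos = (\<lambda>(i, j). A + of_int i * ((C - A + B - D) / 2) + of_int j * ((C - A - B + D) / 2) +
     (if odd (i + j) then (B + D - A - C) / 2 else 0))"

definition tile :: "int \<times> int \<Rightarrow> complex set" where
  "tile t = convex hull (pos ` corners t)"

definition folded_tile :: "int \<times> int \<Rightarrow> bool" where
  "folded_tile t \<longleftrightarrow> tile t \<in> T \<and> (\<forall>y\<in>corners t. H (tile t) (pos y) = of_real \<rho> * cis (phase y))"

lemma cis_phase: "cis (phase y) = cis (\<phi> y)"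
proof -
  obtain k where "phase y = \<phi> y + 2 * pi * of_int k" using phase_phi by blast
  then show ?thesis by (simp add: cis_mult[symmetric] cis_multiple_2pi)
qed

lemma pos_even: "even (i + j) \<Longrightarrow> pos (i, j) = A + of_int i * ((C - A + B - D) / 2) + of_int j * ((C - A - B + D) / 2)"
  and pos_odd: "odd (i + j) \<Longrightarrow> pos (i, j) = A + of_int i * ((C - A + B - D) / 2) + of_int j * ((C - A - B + D) / 2) + (B + D - A - C) / 2"
  by (simp_all add: pos_def)

lemma phase_even: "even (i + j) \<Longrightarrow> phase (i, j) = of_int i * ((a\<^sub>1 - a\<^sub>3) / 2 + pi) + of_int j * ((a\<^sub>2 - a\<^sub>4) / 2)"
  and phase_odd: "odd (i + j) \<Longrightarrow> phase (i, j) = of_int i * ((a\<^sub>1 - a\<^sub>3) / 2 + pi) + of_int j * ((a\<^sub>2 - a\<^sub>4) / 2) + ((a\<^sub>1 + a\<^sub>3) / 2 - pi)"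
  by (simp_all add: phase_def)

text \<open>Exactly one of the two summands is odd, and so is \<open>(k, l)\<close>: the constant
  reserved for odd vertices occurs once on each side, and the rest is linear.\<close>

lemma reflect_sum:
  assumes odd: "odd (k + l)"
  shows "pos (i, j) + pos (k - i, l - j) = A + pos (k, l)"
    and "phase (i, j) + phase (k - i, l - j) = phase (k, l)"
proof -
  have "pos (i, j) + pos (k - i, l - j) = A + pos (k, l) \<and> phase (i, j) + phase (k - i, l - j) = phase (k, l)"
  proof (cases "even (i + j)")
    case True
    then have o: "odd (k - i + (l - j))" using odd by presburger
    show ?thesis
      unfolding pos_even[OF True] phase_even[OF True] pos_odd[OF odd] phase_odd[OF odd] pos_odd[OF o] phase_odd[OF o] of_int_diff
      by (simp add: algebra_simps add_divide_distrib diff_divide_distrib)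
  next
    case False
    then have e: "even (k - i + (l - j))" using odd by presburger
    show ?thesis
      unfolding pos_odd[OF False] phase_odd[OF False] pos_odd[OF odd] phase_odd[OF odd] pos_even[OF e] phase_even[OF e] of_int_diff
      by (simp add: algebra_simps add_divide_distrib diff_divide_distrib)
  qed
  then show "pos (i, j) + pos (k - i, l - j) = A + pos (k, l)" "phase (i, j) + phase (k - i, l - j) = phase (k, l)" by auto
qed

lemma folded_tile_cycle:
  assumes "folded_tile t"
  obtains c\<^sub>0 c\<^sub>1 c\<^sub>2 c\<^sub>3 b\<^sub>0 b\<^sub>1 b\<^sub>2 b\<^sub>3 where "corners t = {c\<^sub>0, c\<^sub>1, c\<^sub>2, c\<^sub>3}"
    and "tile t = convex hull {pos c\<^sub>0, pos c\<^sub>1, pos c\<^sub>2, pos c\<^sub>3}"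
    and "dstep c\<^sub>0 c\<^sub>1 b\<^sub>0" "dstep c\<^sub>1 c\<^sub>2 b\<^sub>1" "dstep c\<^sub>2 c\<^sub>3 b\<^sub>2" "dstep c\<^sub>3 c\<^sub>0 b\<^sub>3"
    and "\<phi> c\<^sub>0 < \<phi> c\<^sub>1" "\<phi> c\<^sub>1 < \<phi> c\<^sub>2" "\<phi> c\<^sub>2 < \<phi> c\<^sub>3"
    and "folded_quad (H (tile t)) \<rho> (pos c\<^sub>0) (pos c\<^sub>1) (pos c\<^sub>2) (pos c\<^sub>3)"
proof -
  obtain c\<^sub>0 c\<^sub>1 c\<^sub>2 c\<^sub>3 b\<^sub>0 b\<^sub>1 b\<^sub>2 b\<^sub>3 where c: "corners t = {c\<^sub>0, c\<^sub>1, c\<^sub>2, c\<^sub>3}"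
    and d: "dstep c\<^sub>0 c\<^sub>1 b\<^sub>0" "dstep c\<^sub>1 c\<^sub>2 b\<^sub>1" "dstep c\<^sub>2 c\<^sub>3 b\<^sub>2" "dstep c\<^sub>3 c\<^sub>0 b\<^sub>3"
    and \<phi>: "\<phi> c\<^sub>1 = \<phi> c\<^sub>0 + b\<^sub>0" "\<phi> c\<^sub>2 = \<phi> c\<^sub>1 + b\<^sub>1" "\<phi> c\<^sub>3 = \<phi> c\<^sub>2 + b\<^sub>2" "\<phi> c\<^sub>0 = \<phi> c\<^sub>3 + b\<^sub>3 - 2 * pi"
    by (rule tile_cycle[of t]) blast
  have b: "0 < b\<^sub>0" "0 < b\<^sub>1" "0 < b\<^sub>2" "0 < b\<^sub>3" using d dstep_bounds by blast+
  have lt: "\<phi> c\<^sub>0 < \<phi> c\<^sub>1" "\<phi> c\<^sub>1 < \<phi> c\<^sub>2" "\<phi> c\<^sub>2 < \<phi> c\<^sub>3" "\<phi> c\<^sub>3 < \<phi> c\<^sub>0 + 2 * pi" using \<phi> b by auto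
  have "plane_isometry (H (tile t))" using assms H_isometry by (simp add: folded_tile_def)
  then have "folded_quad (H (tile t)) \<rho> (pos c\<^sub>0) (pos c\<^sub>1) (pos c\<^sub>2) (pos c\<^sub>3)"
    unfolding folded_quad_def using lt rho assms c
    by (intro conjI exI[of _ "\<phi> c\<^sub>0"] exI[of _ "\<phi> c\<^sub>1"] exI[of _ "\<phi> c\<^sub>2"] exI[of _ "\<phi> c\<^sub>3"])
      (simp_all add: folded_tile_def cis_phase)
  moreover have "tile t = convex hull {pos c\<^sub>0, pos c\<^sub>1, pos c\<^sub>2, pos c\<^sub>3}" by (simp add: tile_def c)
  ultimately show ?thesis using that[OF c _ d lt(1-3)] by blast
qed

lemma folded_tile_side:
  assumes "folded_tile t" "dstep y y' b" "y \<in> corners t" "y' \<in> corners t"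
  shows "closed_segment (pos y) (pos y') edge_of tile t" "pos y \<noteq> pos y'"
proof -
  obtain c\<^sub>0 c\<^sub>1 c\<^sub>2 c\<^sub>3 b\<^sub>0 b\<^sub>1 b\<^sub>2 b\<^sub>3 where c: "corners t = {c\<^sub>0, c\<^sub>1, c\<^sub>2, c\<^sub>3}"
    and t: "tile t = convex hull {pos c\<^sub>0, pos c\<^sub>1, pos c\<^sub>2, pos c\<^sub>3}"
    and d: "dstep c\<^sub>0 c\<^sub>1 b\<^sub>0" "dstep c\<^sub>1 c\<^sub>2 b\<^sub>1" "dstep c\<^sub>2 c\<^sub>3 b\<^sub>2" "dstep c\<^sub>3 c\<^sub>0 b\<^sub>3"
    and q: "folded_quad (H (tile t)) \<rho> (pos c\<^sub>0) (pos c\<^sub>1) (pos c\<^sub>2) (pos c\<^sub>3)"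
    by (rule folded_tile_cycle[OF assms(1)]) blast
  note q1 = folded_quad_rotate[OF q] and q2 = folded_quad_rotate[OF folded_quad_rotate[OF q]]
    and q3 = folded_quad_rotate[OF folded_quad_rotate[OF folded_quad_rotate[OF q]]]
  have s: "{pos c\<^sub>1, pos c\<^sub>2, pos c\<^sub>3, pos c\<^sub>0} = {pos c\<^sub>0, pos c\<^sub>1, pos c\<^sub>2, pos c\<^sub>3}"
    "{pos c\<^sub>2, pos c\<^sub>3, pos c\<^sub>0, pos c\<^sub>1} = {pos c\<^sub>0, pos c\<^sub>1, pos c\<^sub>2, pos c\<^sub>3}"
    "{pos c\<^sub>3, pos c\<^sub>0, pos c\<^sub>1, pos c\<^sub>2} = {pos c\<^sub>0, pos c\<^sub>1, pos c\<^sub>2, pos c\<^sub>3}" by auto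
  have e: "closed_segment (pos c\<^sub>0) (pos c\<^sub>1) edge_of tile t" "closed_segment (pos c\<^sub>1) (pos c\<^sub>2) edge_of tile t"
    "closed_segment (pos c\<^sub>2) (pos c\<^sub>3) edge_of tile t" "closed_segment (pos c\<^sub>3) (pos c\<^sub>0) edge_of tile t"
    using folded_quad_side[OF q] folded_quad_side[OF q1] folded_quad_side[OF q2] folded_quad_side[OF q3]
    unfolding s t by blast+
  have "c\<^sub>0 \<in> corners t" "c\<^sub>1 \<in> corners t" "c\<^sub>2 \<in> corners t" "c\<^sub>3 \<in> corners t" using c by auto
  then have u: "y = c\<^sub>0 \<Longrightarrow> y' = c\<^sub>1" "y = c\<^sub>1 \<Longrightarrow> y' = c\<^sub>2" "y = c\<^sub>2 \<Longrightarrow> y' = c\<^sub>3" "y = c\<^sub>3 \<Longrightarrow> y' = c\<^sub>0"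
    using assms d dstep_unique by blast+
  have "y = c\<^sub>0 \<or> y = c\<^sub>1 \<or> y = c\<^sub>2 \<or> y = c\<^sub>3" using assms(3) c by blast
  then show E: "closed_segment (pos y) (pos y') edge_of tile t" using u e by metis
  then show "pos y \<noteq> pos y'" by (auto simp: edge_of_def)
qed

lemma tile_compact_convex: "compact (tile t)" "convex (tile t)"
proof -
  have "finite (corners t)" by (cases t) (simp add: corners_def)
  then show "compact (tile t)" unfolding tile_def by (intro finite_imp_compact_convex_hull finite_imageI)
qed (simp add: tile_def)

lemma folded_tile_interior:
  assumes "folded_tile t" shows "interior (tile t) \<noteq> {}"
proof (rule folded_tile_cycle[OF assms])
  fix c\<^sub>0 c\<^sub>1 c\<^sub>2 c\<^sub>3
  assume "tile t = convex hull {pos c\<^sub>0, pos c\<^sub>1, pos c\<^sub>2, pos c\<^sub>3}"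
    "folded_quad (H (tile t)) \<rho> (pos c\<^sub>0) (pos c\<^sub>1) (pos c\<^sub>2) (pos c\<^sub>3)"
  then show ?thesis using folded_quad_interior by simp
qed

text \<open>The tile across a side exists and is the point reflection of the given one, which is a
  point reflection of the indices. The folded corner \<open>ab/z\<close> has angle
  \<open>phase y + phase y' - phase z\<close>, which is the phase of the reflected index.\<close>

lemma folded_tile_step:
  assumes t: "folded_tile t" and y: "dstep y y' b" "y \<in> corners t" "y' \<in> corners t"
    and t': "corners t' = (\<lambda>x. (fst y + fst y' - fst x, snd y + snd y' - snd x)) ` corners t"
  shows "folded_tile t'" "neighbours T (tile t) (tile t') (closed_segment (pos y) (pos y'))"
proof -
  let ?s = "\<lambda>x. (fst y + fst y' - fst x, snd y + snd y' - snd x)"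
  let ?e = "closed_segment (pos y) (pos y')"
  have tT: "tile t \<in> T" using t by (simp add: folded_tile_def)
  have "odd (fst y + fst y' + (snd y + snd y'))"
    using y(1) by (cases y; cases y') (auto simp: dstep_def)
  note odd = this
  have pos: "pos (?s x) = pos y + pos y' - pos x" for x
    using reflect_sum(1)[OF odd, of "fst x" "snd x"] reflect_sum(1)[OF odd, of "fst y" "snd y"] by (simp add: algebra_simps)
  have phase: "phase (?s x) = phase y + phase y' - phase x" for x
    using reflect_sum(2)[OF odd, of "fst x" "snd x"] reflect_sum(2)[OF odd, of "fst y" "snd y"] by (simp add: algebra_simps)
  have closed: "\<And>Q. Q \<in> T \<Longrightarrow> closed Q"
    using quads cyclic_quadrilateral_compact_convex compact_imp_closed by blast
  obtain Q where Q: "neighbours T (tile t) Q ?e"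
    using neighbour_exists[OF tiling closed tT tile_compact_convex(2) folded_tile_interior[OF t] folded_tile_side(1)[OF t y]]
    by blast
  have "central_symmetry (midpoint (pos y) (pos y')) = (\<lambda>z. (pos y + pos y') + (-1) *\<^sub>R z)"
    by (simp add: fun_eq_iff central_symmetry_def midpoint_def scaleR_conv_of_real field_simps)
  then have "Q = convex hull ((\<lambda>z. (pos y + pos y') + (-1) *\<^sub>R z) ` pos ` corners t)"
    using symmetric[OF Q] by (simp only: tile_def convex_hull_affinity)
  also have "(\<lambda>z. (pos y + pos y') + (-1) *\<^sub>R z) ` pos ` corners t = pos ` ?s ` corners t"
    unfolding image_image by (intro image_cong) (simp_all add: pos)
  finally have Qt: "Q = tile t'" by (simp only: tile_def t')
  with Q show "neighbours T (tile t) (tile t') ?e" by simp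
  have iso: "plane_isometry (H (tile t))" using H_isometry tT by blast
  show "folded_tile t'" unfolding folded_tile_def
  proof
    show "tile t' \<in> T" using Q Qt by (simp add: neighbours_def)
    show "\<forall>x\<in>corners t'. H (tile t') (pos x) = of_real \<rho> * cis (phase x)"
    proof
      fix x assume "x \<in> corners t'"
      then obtain z where z: "z \<in> corners t" "x = ?s z" unfolding t' by blast
      have Hc: "H (tile t) (pos w) = of_real \<rho> * cis (phase w)" if "w \<in> corners t" for w
        using t that by (simp add: folded_tile_def)
      have "H (tile t') (pos x) = H (tile t) (line_reflection (pos y) (pos y') (pos y + pos y' - pos z))"
        using H_neighbours[OF Q] Qt z pos by simp
      also have "\<dots> = H (tile t) (pos y) * H (tile t) (pos y') / H (tile t) (pos z)"
        by (rule isometry_reflect_neighbour[OF iso folded_tile_side(2)[OF t y] rho])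
          (use Hc y z rho in \<open>simp_all add: norm_mult\<close>)
      also have "\<dots> = of_real \<rho> * cis (phase x)"
      proof -
        have "of_real \<rho> * cis p * (of_real \<rho> * cis q) / (of_real \<rho> * cis r) = of_real \<rho> * cis (p + q - r)" for p q r
          using rho by (simp add: cis_mult[symmetric] cis_divide[symmetric])
        then show ?thesis using Hc[OF y(2)] Hc[OF y(3)] Hc[OF z(1)] phase[of z] z(2) by metis
      qed
      finally show "H (tile t') (pos x) = of_real \<rho> * cis (phase x)" .
    qed
  qed
qed

lemma pos_corners: "pos (0, 0) = A" "pos (1, 0) = B" "pos (1, 1) = C" "pos (0, 1) = D"
  by (simp_all add: pos_def field_simps)

lemma tile_base: "tile (0, 0) = convex hull {A, B, C, D}"
  by (simp add: tile_def corners_def pos_corners)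

lemma folded_tile_base: "folded_tile (0, 0)"
proof -
  have p: "phase (0, 0) = 0" "phase (1, 0) = a\<^sub>1" "phase (1, 1) = a\<^sub>1 + a\<^sub>2" "phase (0, 1) = a\<^sub>1 + a\<^sub>2 + a\<^sub>3 - 2 * pi"
    using arcs_sum by (simp_all add: phase_def field_simps)
  have "cis (a\<^sub>1 + a\<^sub>2 + a\<^sub>3 - 2 * pi) = cis (a\<^sub>1 + a\<^sub>2 + a\<^sub>3)" by (simp add: cis_divide[symmetric])
  then show ?thesis
    using base base_corners by (simp add: folded_tile_def tile_base corners_def pos_corners p)
qed

lemma grid_dstep:
  "(\<exists>b. dstep (i, j) (i + 1, j) b) \<or> (\<exists>b. dstep (i + 1, j) (i, j) b)"
  "(\<exists>b. dstep (i, j) (i, j + 1) b) \<or> (\<exists>b. dstep (i, j + 1) (i, j) b)"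
  by (auto simp: dstep_def)

lemma folded_tile_step':
  assumes t: "folded_tile t" and y: "y \<in> corners t" "y' \<in> corners t" and d: "(\<exists>b. dstep y y' b) \<or> (\<exists>b. dstep y' y b)"
    and t': "corners t' = (\<lambda>x. (fst y + fst y' - fst x, snd y + snd y' - snd x)) ` corners t"
  shows "folded_tile t'" "neighbours T (tile t) (tile t') (closed_segment (pos y) (pos y'))"
proof -
  have t'': "corners t' = (\<lambda>x. (fst y' + fst y - fst x, snd y' + snd y - snd x)) ` corners t"
    unfolding t' by (simp add: add.commute)
  show "folded_tile t'" "neighbours T (tile t) (tile t') (closed_segment (pos y) (pos y'))"
    using d folded_tile_step[OF t _ y t'] folded_tile_step[OF t _ y(2,1) t'']
    by (auto simp: closed_segment_commute)
qed

lemma folded_tile_adjacent: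
  assumes "folded_tile (i, j)"
  shows "folded_tile (i + 1, j)" "folded_tile (i - 1, j)" "folded_tile (i, j + 1)" "folded_tile (i, j - 1)"
proof -
  show "folded_tile (i + 1, j)"
    by (rule folded_tile_step'(1)[OF assms _ _ grid_dstep(2)[of "i + 1" j]]) (auto simp: corners_def algebra_simps)
  show "folded_tile (i - 1, j)"
    by (rule folded_tile_step'(1)[OF assms _ _ grid_dstep(2)[of i j]]) (auto simp: corners_def algebra_simps)
  show "folded_tile (i, j + 1)"
    by (rule folded_tile_step'(1)[OF assms _ _ grid_dstep(1)[of i "j + 1"]]) (auto simp: corners_def algebra_simps)
  show "folded_tile (i, j - 1)"
    by (rule folded_tile_step'(1)[OF assms _ _ grid_dstep(1)[of i j]]) (auto simp: corners_def algebra_simps)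
qed

lemma folded_tile: "folded_tile t"
proof -
  have 1: "folded_tile (i, 0)" for i
    by (induction i rule: int_induct[where k = 0])
      (simp_all add: folded_tile_base folded_tile_adjacent(1,2))
  have "folded_tile (i, j)" for i j
    by (induction j rule: int_induct[where k = 0])
      (simp_all add: 1 folded_tile_adjacent(3,4))
  then show ?thesis by (cases t) auto
qed

end

section \<open>The cyclic order of the corners of a tile\<close>

context arcs
begin

lemma phi_inj_on_corners:
  assumes "y \<in> corners t" "z \<in> corners t" "\<phi> y = \<phi> z"
  shows "y = z"
proof (rule tile_cycle[of t])
  fix c\<^sub>0 c\<^sub>1 c\<^sub>2 c\<^sub>3 b\<^sub>0 b\<^sub>1 b\<^sub>2 b\<^sub>3
  assume c: "corners t = {c\<^sub>0, c\<^sub>1, c\<^sub>2, c\<^sub>3}"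
    and d: "dstep c\<^sub>0 c\<^sub>1 b\<^sub>0" "dstep c\<^sub>1 c\<^sub>2 b\<^sub>1" "dstep c\<^sub>2 c\<^sub>3 b\<^sub>2"
    and \<phi>: "\<phi> c\<^sub>1 = \<phi> c\<^sub>0 + b\<^sub>0" "\<phi> c\<^sub>2 = \<phi> c\<^sub>1 + b\<^sub>1" "\<phi> c\<^sub>3 = \<phi> c\<^sub>2 + b\<^sub>2"
  have "0 < b\<^sub>0" "0 < b\<^sub>1" "0 < b\<^sub>2" using d dstep_bounds by blast+
  then have "\<phi> c\<^sub>0 < \<phi> c\<^sub>1" "\<phi> c\<^sub>1 < \<phi> c\<^sub>2" "\<phi> c\<^sub>2 < \<phi> c\<^sub>3" using \<phi> by auto
  then have "\<phi> c\<^sub>0 \<noteq> \<phi> c\<^sub>1" "\<phi> c\<^sub>0 \<noteq> \<phi> c\<^sub>2" "\<phi> c\<^sub>0 \<noteq> \<phi> c\<^sub>3" "\<phi> c\<^sub>1 \<noteq> \<phi> c\<^sub>2" "\<phi> c\<^sub>1 \<noteq> \<phi> c\<^sub>3" "\<phi> c\<^sub>2 \<noteq> \<phi> c\<^sub>3"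
    by linarith+
  then show "y = z" using assms unfolding c by (metis insertE singletonD)
qed

text \<open>The first case is a step that does not wrap, with no corner strictly between its ends;
  the second is the wrapping step, from the largest angle of the tile to the smallest.\<close>

lemma dstep_consecutive:
  assumes "dstep y y' b" "y \<in> corners t" "y' \<in> corners t"
  shows "(\<phi> y < \<phi> y' \<and> (\<forall>z\<in>corners t. \<phi> z \<le> \<phi> y \<or> \<phi> y' \<le> \<phi> z)) \<or>
         (\<phi> y' < \<phi> y \<and> (\<forall>z\<in>corners t. \<phi> y' \<le> \<phi> z \<and> \<phi> z \<le> \<phi> y))"
proof (rule tile_cycle[of t])
  fix c\<^sub>0 c\<^sub>1 c\<^sub>2 c\<^sub>3 b\<^sub>0 b\<^sub>1 b\<^sub>2 b\<^sub>3
  assume c: "corners t = {c\<^sub>0, c\<^sub>1, c\<^sub>2, c\<^sub>3}"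
    and d: "dstep c\<^sub>0 c\<^sub>1 b\<^sub>0" "dstep c\<^sub>1 c\<^sub>2 b\<^sub>1" "dstep c\<^sub>2 c\<^sub>3 b\<^sub>2" "dstep c\<^sub>3 c\<^sub>0 b\<^sub>3"
    and \<phi>: "\<phi> c\<^sub>1 = \<phi> c\<^sub>0 + b\<^sub>0" "\<phi> c\<^sub>2 = \<phi> c\<^sub>1 + b\<^sub>1" "\<phi> c\<^sub>3 = \<phi> c\<^sub>2 + b\<^sub>2"
  have "0 < b\<^sub>0" "0 < b\<^sub>1" "0 < b\<^sub>2" using d dstep_bounds by blast+
  then have lt: "\<phi> c\<^sub>0 < \<phi> c\<^sub>1" "\<phi> c\<^sub>1 < \<phi> c\<^sub>2" "\<phi> c\<^sub>2 < \<phi> c\<^sub>3" using \<phi> by auto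
  have m: "c\<^sub>0 \<in> corners t" "c\<^sub>1 \<in> corners t" "c\<^sub>2 \<in> corners t" "c\<^sub>3 \<in> corners t" using c by auto
  note u = dstep_unique[OF assms(1) _ assms(3)]
  consider "y = c\<^sub>0" | "y = c\<^sub>1" | "y = c\<^sub>2" | "y = c\<^sub>3" using assms(2) unfolding c by blast
  then show ?thesis
  proof cases
    case 1
    then have "y' = c\<^sub>1" using u[OF _ m(2)] d(1) by blast
    then show ?thesis using 1 lt unfolding c by simp
  next
    case 2
    then have "y' = c\<^sub>2" using u[OF _ m(3)] d(2) by blast
    then show ?thesis using 2 lt unfolding c by simp
  next
    case 3
    then have "y' = c\<^sub>3" using u[OF _ m(4)] d(3) by blast
    then show ?thesis using 3 lt unfolding c by simp
  next
    case 4
    then have "y' = c\<^sub>0" using u[OF _ m(1)] d(4) by blast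
    then show ?thesis using 4 lt unfolding c by simp
  qed
qed

end

section \<open>Injectivity and discreteness of the lattice of vertices\<close>

context folded_tiling
begin

lemma extreme_tile: "z extreme_point_of tile t \<longleftrightarrow> z \<in> pos ` corners t"
proof (rule folded_tile_cycle[OF folded_tile[of t]])
  fix c\<^sub>0 c\<^sub>1 c\<^sub>2 c\<^sub>3
  assume c: "corners t = {c\<^sub>0, c\<^sub>1, c\<^sub>2, c\<^sub>3}"
    and t: "tile t = convex hull {pos c\<^sub>0, pos c\<^sub>1, pos c\<^sub>2, pos c\<^sub>3}"
    and q: "folded_quad (H (tile t)) \<rho> (pos c\<^sub>0) (pos c\<^sub>1) (pos c\<^sub>2) (pos c\<^sub>3)"
  show ?thesis unfolding t folded_quad_extreme[OF q] c by simp
qed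

lemma tile_in: "tile t \<in> T"
  using folded_tile by (simp add: folded_tile_def)

lemma H_tile_isometry: "plane_isometry (H (tile t))"
  using H_isometry tile_in by blast

lemma base_quad: "folded_quad (H (tile (0, 0))) \<rho> A B C D"
  unfolding folded_quad_def
  using rho arcs_pos arcs_sum base_corners H_tile_isometry[of "(0, 0)"]
  by (intro conjI exI[of _ 0] exI[of _ "a\<^sub>1"] exI[of _ "a\<^sub>1 + a\<^sub>2"] exI[of _ "a\<^sub>1 + a\<^sub>2 + a\<^sub>3"])
    (simp_all add: tile_base)

text \<open>Cross products with the two diagonals serve as skew coordinates. The numbers
  \<open>s\<close> and \<open>(s' + 1) / 2\<close> locate the crossing of the diagonals on
  \<open>AC\<close> and on \<open>BD\<close>, and account for the offset of the odd
  vertices.\<close>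

lemma lattice_coordinates:
  obtains \<delta> s s' where "\<delta> \<noteq> 0" "0 < s" "s < 1"
    and "\<And>i j. Im (cnj (C - A) * (pos (i, j) - A)) = \<delta> * (of_int (i - j) + (if odd (i + j) then s' else 0))"
    and "\<And>i j. Im (cnj (D - B) * (pos (i, j) - A)) = \<delta> * (of_int (i + j) + (if odd (i + j) then 2 * s - 1 else 0))"
proof -
  obtain s t where st: "0 < s" "s < 1" "0 < t" "t < 1" and X: "A + of_real s * (C - A) = B + of_real t * (D - B)"
    by (rule folded_quad_diagonals[OF base_quad])
  define u w where "u = C - A" and "w = B - D"
  have C: "C = A + u" and B: "B = A + of_real s * u + of_real t * w" and D: "D = B - w"
    using X by (simp_all add: u_def w_def algebra_simps)
  define d where "d = Im (cnj u * w)"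
  have "d \<noteq> 0"
  proof
    assume "d = 0"
    have "u \<noteq> 0" using folded_quad_distinct[OF base_quad] by (auto simp: u_def)
    have "of_real ((cmod u)\<^sup>2) * w = u * (cnj u * w)"
      by (simp only: complex_norm_square mult.assoc)
    also have "cnj u * w = of_real (Re (cnj u * w))"
      using \<open>d = 0\<close> by (simp add: complex_eq_iff d_def)
    finally have "w = of_real (Re (cnj u * w) / (cmod u)\<^sup>2) * u"
      using \<open>u \<noteq> 0\<close> by (simp add: field_simps)
    then obtain k where k: "w = of_real k * u" by blast
    have "\<exists>c. x - y = c *\<^sub>R u" if "x \<in> {A, B, C}" "y \<in> {A, B, C}" for x y
    proof -
      have *: "\<exists>c. x = A + of_real c * u" if "x \<in> {A, B, C}" for x
      proof -
        have "A = A + of_real 0 * u" "C = A + of_real 1 * u" "B = A + of_real (s + t * k) * u"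
          by (simp_all add: C B k algebra_simps)
        then show ?thesis using that by blast
      qed
      from *[OF that(1)] obtain c where c: "x = A + of_real c * u" by blast
      from *[OF that(2)] obtain c' where c': "y = A + of_real c' * u" by blast
      have "x - y = (c - c') *\<^sub>R u" unfolding c c' by (simp add: scaleR_conv_of_real algebra_simps)
      then show ?thesis by blast
    qed
    then have "collinear {A, B, C}" unfolding collinear_def by blast
    then show False using folded_quad_not_collinear[OF base_quad] by blast
  qed
  have pos: "pos (i, j) - A = of_real ((of_int (i + j) + (if odd (i + j) then 2 * s - 1 else 0)) / 2) * u +
      of_real ((of_int (i - j) + (if odd (i + j) then 2 * t - 1 else 0)) / 2) * w" for i j
  proof (cases "odd (i + j)")
    case True
    then show ?thesis unfolding pos_odd[OF True] unfolding D C B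
      by (simp add: algebra_simps add_divide_distrib diff_divide_distrib)
  next
    case False
    then have e: "even (i + j)" by simp
    then show ?thesis unfolding pos_even[OF e] unfolding D C B
      by (simp add: algebra_simps add_divide_distrib diff_divide_distrib)
  qed
  have im: "Im (cnj u * (of_real x * u + of_real y * w)) = y * d" "Im (cnj (- w) * (of_real x * u + of_real y * w)) = x * d" for x y
    by (simp_all add: d_def algebra_simps)
  show ?thesis
  proof (rule that[of "d / 2" s "2 * t - 1"])
    have e: "C - A = u" "D - B = - w" by (simp_all add: u_def w_def)
    show "Im (cnj (C - A) * (pos (i, j) - A)) = d / 2 * (of_int (i - j) + (if odd (i + j) then 2 * t - 1 else 0))" for i j
      unfolding e(1) pos im by simp
    show "Im (cnj (D - B) * (pos (i, j) - A)) = d / 2 * (of_int (i + j) + (if odd (i + j) then 2 * s - 1 else 0))" for i j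
      unfolding e(2) pos im by simp
  qed (use \<open>d \<noteq> 0\<close> st in auto)
qed

text \<open>Since \<open>0 < s < 1\<close>, the offset \<open>2 * s - 1\<close> has absolute value
  below one and cannot compensate an odd difference of integers. So equal positions have equal
  parity, and then equal coordinates.\<close>

lemma pos_inj: "inj pos"
proof (rule injI)
  fix y y' assume eq: "pos y = pos y'"
  obtain i j where y: "y = (i, j)" by (cases y)
  obtain i' j' where y': "y' = (i', j')" by (cases y')
  obtain \<delta> s s' where \<delta>: "\<delta> \<noteq> 0" and s: "0 < s" "s < 1"
    and 1: "\<And>i j. Im (cnj (C - A) * (pos (i, j) - A)) = \<delta> * (of_int (i - j) + (if odd (i + j) then s' else 0))"
    and 2: "\<And>i j. Im (cnj (D - B) * (pos (i, j) - A)) = \<delta> * (of_int (i + j) + (if odd (i + j) then 2 * s - 1 else 0))"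
    by (rule lattice_coordinates) blast
  have e1: "of_int (i - j) + (if odd (i + j) then s' else 0) = of_int (i' - j') + (if odd (i' + j') then s' else 0)"
    using 1[of i j] 1[of i' j'] eq \<delta> unfolding y y' by simp
  have e2: "of_int (i + j) + (if odd (i + j) then 2 * s - 1 else 0) = of_int (i' + j') + (if odd (i' + j') then 2 * s - 1 else 0)"
    using 2[of i j] 2[of i' j'] eq \<delta> unfolding y y' by simp
  have par: "odd (i + j) \<longleftrightarrow> odd (i' + j')"
  proof (rule ccontr)
    assume "\<not> ?thesis"
    then have "real_of_int \<bar>(i + j) - (i' + j')\<bar> = \<bar>2 * s - 1\<bar>" "odd ((i + j) - (i' + j'))"
      using e2 by (auto split: if_splits)
    moreover have "\<bar>2 * s - 1\<bar> < 1" using s by auto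
    ultimately have "\<bar>(i + j) - (i' + j')\<bar> < 1" by linarith
    then have "(i + j) - (i' + j') = 0" by simp
    with \<open>odd ((i + j) - (i' + j'))\<close> show False by simp
  qed
  have "real_of_int (i - j) = of_int (i' - j')" "real_of_int (i + j) = of_int (i' + j')"
    using e1 e2 par by (auto split: if_splits)
  then have "i - j = i' - j'" "i + j = i' + j'" by (simp_all only: of_int_eq_iff)
  then show "y = y'" unfolding y y' by simp
qed

lemma finite_pos_vimage:
  assumes "bounded S" shows "finite (pos -` S)"
proof -
  obtain \<delta> s s' where \<delta>: "\<delta> \<noteq> 0" and s: "0 < s" "s < 1"
    and 1: "\<And>i j. Im (cnj (C - A) * (pos (i, j) - A)) = \<delta> * (of_int (i - j) + (if odd (i + j) then s' else 0))"
    and 2: "\<And>i j. Im (cnj (D - B) * (pos (i, j) - A)) = \<delta> * (of_int (i + j) + (if odd (i + j) then 2 * s - 1 else 0))"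
    by (rule lattice_coordinates) blast
  obtain M where M: "\<And>z. z \<in> S \<Longrightarrow> cmod (z - A) \<le> M"
    using bounded_any_center[of S A] assms by (auto simp: dist_norm norm_minus_commute)
  \<comment> \<open>One bound for both skew coordinates: the sum of the two estimates, plus
    \<open>\<bar>s'\<bar>\<close> and \<open>1\<close> for the offsets of odd vertices.\<close>
  define N where "N = \<lceil>(cmod (C - A) + cmod (D - B)) * M / \<bar>\<delta>\<bar> + \<bar>s'\<bar> + 1\<rceil>"
  have bound: "\<bar>i - j\<bar> \<le> N \<and> \<bar>i + j\<bar> \<le> N" if "pos (i, j) \<in> S" for i j
  proof -
    have z: "cmod (pos (i, j) - A) \<le> M" using M that by blast
    have M0: "0 \<le> M" using z norm_ge_zero order_trans by blast
    have "\<bar>\<delta>\<bar> * \<bar>of_int (i - j) + (if odd (i + j) then s' else 0)\<bar> \<le> cmod (C - A) * M"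
      using abs_Im_le_cmod[of "cnj (C - A) * (pos (i, j) - A)"] z mult_left_mono[OF z, of "cmod (C - A)"]
      unfolding 1 by (simp only: abs_mult norm_mult complex_mod_cnj) (meson norm_ge_zero order_trans)
    then have "\<bar>of_int (i - j) + (if odd (i + j) then s' else 0)\<bar> \<le> cmod (C - A) * M / \<bar>\<delta>\<bar>"
      using \<delta> by (simp add: field_simps)
    moreover have "\<bar>\<delta>\<bar> * \<bar>of_int (i + j) + (if odd (i + j) then 2 * s - 1 else 0)\<bar> \<le> cmod (D - B) * M"
      using abs_Im_le_cmod[of "cnj (D - B) * (pos (i, j) - A)"] z mult_left_mono[OF z, of "cmod (D - B)"]
      unfolding 2 by (simp only: abs_mult norm_mult complex_mod_cnj) (meson norm_ge_zero order_trans)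
    then have "\<bar>of_int (i + j) + (if odd (i + j) then 2 * s - 1 else 0)\<bar> \<le> cmod (D - B) * M / \<bar>\<delta>\<bar>"
      using \<delta> by (simp add: field_simps)
    moreover have "cmod (C - A) * M / \<bar>\<delta>\<bar> \<ge> 0" "cmod (D - B) * M / \<bar>\<delta>\<bar> \<ge> 0" using M0 by simp_all
    moreover have "(cmod (C - A) + cmod (D - B)) * M / \<bar>\<delta>\<bar> = cmod (C - A) * M / \<bar>\<delta>\<bar> + cmod (D - B) * M / \<bar>\<delta>\<bar>"
      by (simp add: distrib_right add_divide_distrib)
    moreover have "\<bar>if odd (i + j) then s' else 0\<bar> \<le> \<bar>s'\<bar>" "\<bar>if odd (i + j) then 2 * s - 1 else 0\<bar> \<le> 1"
      using s by auto
    moreover have "(cmod (C - A) + cmod (D - B)) * M / \<bar>\<delta>\<bar> + \<bar>s'\<bar> + 1 \<le> of_int N"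
      unfolding N_def by (rule le_of_int_ceiling)
    ultimately have "\<bar>real_of_int (i - j)\<bar> \<le> of_int N" "\<bar>real_of_int (i + j)\<bar> \<le> of_int N"
      by linarith+
    then show ?thesis by (simp only: of_int_abs[symmetric] of_int_le_iff)
  qed
  have "pos -` S \<subseteq> {-N..N} \<times> {-N..N}"
  proof clarify
    fix i j assume "pos (i, j) \<in> S"
    from bound[OF this] show "i \<in> {-N..N} \<and> j \<in> {-N..N}" by auto
  qed
  then show ?thesis by (rule finite_subset) simp
qed

lemma tile_inj: "tile t = tile t' \<Longrightarrow> t = t'"
proof -
  assume "tile t = tile t'"
  then have "pos ` corners t = pos ` corners t'" using extreme_tile[of _ t] extreme_tile[of _ t'] by auto
  then have c: "corners t = corners t'" using pos_inj by (simp add: inj_image_eq_iff)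
  obtain i j k l where t: "t = (i, j)" "t' = (k, l)" by (cases t; cases t')
  have "(i, j) \<in> corners t'" unfolding c[symmetric] by (simp add: t corners_def)
  then have 1: "i = k \<or> i = k + 1" "j = l \<or> j = l + 1" by (auto simp: t corners_def)
  have "(k, l) \<in> corners t" unfolding c by (simp add: t corners_def)
  then have "k = i \<or> k = i + 1" "l = j \<or> l = j + 1" by (auto simp: t corners_def)
  with 1 show "t = t'" unfolding t by auto
qed

lemma edge_of_tile:
  assumes "closed_segment a b edge_of tile t"
  obtains y y' l where "dstep y y' l" "y \<in> corners t" "y' \<in> corners t" "{a, b} = {pos y, pos y'}"
proof (rule folded_tile_cycle[OF folded_tile[of t]])
  fix c\<^sub>0 c\<^sub>1 c\<^sub>2 c\<^sub>3 b\<^sub>0 b\<^sub>1 b\<^sub>2 b\<^sub>3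
  assume c: "corners t = {c\<^sub>0, c\<^sub>1, c\<^sub>2, c\<^sub>3}"
    and t: "tile t = convex hull {pos c\<^sub>0, pos c\<^sub>1, pos c\<^sub>2, pos c\<^sub>3}"
    and d: "dstep c\<^sub>0 c\<^sub>1 b\<^sub>0" "dstep c\<^sub>1 c\<^sub>2 b\<^sub>1" "dstep c\<^sub>2 c\<^sub>3 b\<^sub>2" "dstep c\<^sub>3 c\<^sub>0 b\<^sub>3"
    and q: "folded_quad (H (tile t)) \<rho> (pos c\<^sub>0) (pos c\<^sub>1) (pos c\<^sub>2) (pos c\<^sub>3)"
  have m: "{a, b} \<in> {{pos c\<^sub>0, pos c\<^sub>1}, {pos c\<^sub>1, pos c\<^sub>2}, {pos c\<^sub>2, pos c\<^sub>3}, {pos c\<^sub>3, pos c\<^sub>0}}"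
    by (rule folded_quad_edge_imp_side(1)[OF q assms[unfolded t]])
  have "c\<^sub>0 \<in> corners t" "c\<^sub>1 \<in> corners t" "c\<^sub>2 \<in> corners t" "c\<^sub>3 \<in> corners t"
    unfolding c by simp_all
  note r = that[OF d(1) this(1,2)] that[OF d(2) this(2,3)] that[OF d(3) this(3,4)] that[OF d(4) this(4,1)]
  from m show thesis
  proof (rule insertE)
    assume "{a, b} \<in> {{pos c\<^sub>1, pos c\<^sub>2}, {pos c\<^sub>2, pos c\<^sub>3}, {pos c\<^sub>3, pos c\<^sub>0}}"
    then show thesis
    proof (rule insertE)
      assume "{a, b} \<in> {{pos c\<^sub>2, pos c\<^sub>3}, {pos c\<^sub>3, pos c\<^sub>0}}"
      then show thesis
      proof (rule insertE)
        assume "{a, b} \<in> {{pos c\<^sub>3, pos c\<^sub>0}}"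
        then show thesis by (intro r(4)) (rule singletonD)
      qed (rule r(3))
    qed (rule r(2))
  qed (rule r(1))
qed

text \<open>The symmetry condition leaves only one neighbour across a side, so \<open>Q\<close> is
  the lattice tile obtained by reflecting the indices.\<close>

lemma neighbour_tile:
  assumes "neighbours T (tile t) Q (closed_segment a b)"
  obtains y y' l t' where "dstep y y' l" "y \<in> corners t" "y' \<in> corners t" "y \<in> corners t'" "y' \<in> corners t'"
    "{a, b} = {pos y, pos y'}" "Q = tile t'" "even_vertex t' \<longleftrightarrow> \<not> even_vertex t"
proof -
  have "closed_segment a b edge_of tile t" using assms unfolding neighbours_def by blast
  then obtain y y' l where y: "dstep y y' l" "y \<in> corners t" "y' \<in> corners t" "{a, b} = {pos y, pos y'}"
    by (rule edge_of_tile)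
  obtain i j k m k' m' where e: "t = (i, j)" "y = (k, m)" "y' = (k', m')" by (metis surj_pair)
  \<comment> \<open>A tile is indexed by its lowest corner, and under the reflection this comes from
    the opposite corner \<open>(i + 1, j + 1)\<close>.\<close>
  define t' where "t' = (k + k' - i - 1, m + m' - j - 1)"
  have odd: "odd (k + k' + (m + m'))" using y(1) by (auto simp: e dstep_def)
  have c: "corners t' = (\<lambda>x. (fst y + fst y' - fst x, snd y + snd y' - snd x)) ` corners t"
  proof -
    have "corners (K - i - 1, M - j - 1) = (\<lambda>x. (K - fst x, M - snd x)) ` corners (i, j)" for K M i j
      by (simp add: corners_def insert_commute diff_diff_eq)
    then show ?thesis by (simp only: t'_def e fst_conv snd_conv)
  qed
  have n: "neighbours T (tile t) (tile t') (closed_segment (pos y) (pos y'))"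
    by (rule folded_tile_step(2)[OF folded_tile y(1-3) c])
  have seg: "closed_segment a b = closed_segment (pos y) (pos y')" using y(4) by (metis segment_convex_hull)
  have "neighbours T (tile t) Q (closed_segment (pos y) (pos y'))" using assms seg by simp
  then have "Q = tile t'" using symmetric[OF n] symmetric by metis
  moreover have "y \<in> corners t'" "y' \<in> corners t'"
    unfolding c by (rule image_eqI[OF _ y(3)], simp) (rule image_eqI[OF _ y(2)], simp)
  moreover have "even_vertex t' \<longleftrightarrow> \<not> even_vertex t" using odd by (simp add: t'_def e) presburger
  ultimately show ?thesis using that y by blast
qed

end

subsection \<open>Level lines\<close>

locale level_line = folded_tiling +
  fixes \<omega> :: real
  assumes omega: "0 < \<omega>" "\<omega> < pi"
begin

text \<open>The signed distance, after folding, from the line through the points of the circle at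
  angles \<open>0\<close> and \<open>2 * \<omega>\<close>, whose unit normal is
  \<open>cis \<omega>\<close>. It is positive towards the arc between these angles.\<close>

definition height :: "int \<times> int \<Rightarrow> complex \<Rightarrow> real" where
  "height t z = Re (cnj (cis \<omega>) * H (tile t) z) - \<rho> * cos \<omega>"

lemma height_corner:
  assumes "y \<in> corners t"
  shows "height t (pos y) = \<rho> * (cos (\<phi> y - \<omega>) - cos \<omega>)"
proof -
  have "H (tile t) (pos y) = of_real \<rho> * cis (\<phi> y)"
    using folded_tile[of t] assms by (simp add: folded_tile_def cis_phase)
  then show ?thesis unfolding height_def by (simp only: Re_cis_cnj right_diff_distrib)
qed

lemma height_corner_pos:
  assumes "y \<in> corners t" "0 < \<phi> y" "\<phi> y < 2 * \<omega>" shows "0 < height t (pos y)"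
proof -
  have "\<bar>\<phi> y - \<omega>\<bar> < \<omega>" "\<omega> < 2 * pi - \<bar>\<phi> y - \<omega>\<bar>" using assms omega by auto
  from cos_less_symmetric[OF this] show ?thesis using rho by (simp add: height_corner assms)
qed

lemma height_corner_neg:
  assumes "y \<in> corners t" "2 * \<omega> < \<phi> y" shows "height t (pos y) < 0"
proof -
  have "\<bar>\<omega>\<bar> < \<phi> y - \<omega>" "\<phi> y - \<omega> < 2 * pi - \<bar>\<omega>\<bar>" using assms omega phi_range[of y] by auto
  from cos_less_symmetric[OF this] show ?thesis using rho by (simp add: height_corner assms mult_pos_neg)
qed

lemma height_corner_zero:
  assumes "y \<in> corners t" "\<phi> y = 0 \<or> \<phi> y = 2 * \<omega>" shows "height t (pos y) = 0"
  using assms by (auto simp: height_corner)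

lemma height_affine:
  obtains a k where "norm a = 1" "\<And>z. height t z = a \<bullet> z + k"
proof -
  obtain a k where "norm a = 1" "\<And>z. Re (cnj (cis \<omega>) * H (tile t) z) = a \<bullet> z + k"
    using isometry_functional[OF H_tile_isometry[of t], of "cis \<omega>"] by auto
  then show ?thesis using that[of a "k - \<rho> * cos \<omega>"] by (simp add: height_def)
qed

lemma height_sign:
  assumes "y \<in> corners t"
  shows "(0 < height t (pos y) \<and> 0 < \<phi> y \<and> \<phi> y < 2 * \<omega>) \<or> (height t (pos y) < 0 \<and> 2 * \<omega> < \<phi> y) \<or>
    (height t (pos y) = 0 \<and> (\<phi> y = 0 \<or> \<phi> y = 2 * \<omega>))"
proof -
  consider "0 < \<phi> y" "\<phi> y < 2 * \<omega>" | "2 * \<omega> < \<phi> y" | "\<phi> y = 0 \<or> \<phi> y = 2 * \<omega>"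
    using phi_range(1)[of y] by linarith
  then show ?thesis
    using height_corner_pos[OF assms] height_corner_neg[OF assms] height_corner_zero[OF assms] by cases auto
qed

lemma convex_height: "convex {z. height t z < 0}" "convex {z. 0 < height t z}"
proof -
  obtain a k where h: "\<And>z. height t z = a \<bullet> z + k" using height_affine by blast
  have "{z. height t z < 0} = {z. a \<bullet> z < - k}" "{z. 0 < height t z} = {z. a \<bullet> z > - k}" by (auto simp: h)
  then show "convex {z. height t z < 0}" "convex {z. 0 < height t z}"
    by (simp_all add: convex_halfspace_lt convex_halfspace_gt)
qed

text \<open>If all corners were weakly on one side of the line, the tile would lie in a closed
  half-plane, and a point on the boundary line could not be interior.\<close>

lemma height_interior:
  assumes z: "z \<in> interior (tile t)" "height t z = 0"
  shows "\<exists>y\<in>corners t. 0 < \<phi> y \<and> \<phi> y < 2 * \<omega>" "\<exists>y\<in>corners t. 2 * \<omega> < \<phi> y"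
proof -
  obtain a k where a: "norm a = 1" and h: "\<And>z. height t z = a \<bullet> z + k" using height_affine by blast
  have "a \<noteq> 0" using a by auto
  show "\<exists>y\<in>corners t. 0 < \<phi> y \<and> \<phi> y < 2 * \<omega>"
  proof (rule ccontr)
    assume "\<not> ?thesis"
    then have "pos ` corners t \<subseteq> {z. a \<bullet> z \<le> - k}"
      using height_sign[of _ t] h by force
    then have "tile t \<subseteq> {z. a \<bullet> z \<le> - k}"
      unfolding tile_def by (rule hull_minimal) (rule convex_halfspace_le)
    then have "z \<in> interior {z. a \<bullet> z \<le> - k}" using z(1) interior_mono by blast
    then show False using \<open>a \<noteq> 0\<close> z(2) by (simp add: h)
  qed
  show "\<exists>y\<in>corners t. 2 * \<omega> < \<phi> y"
  proof (rule ccontr)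
    assume "\<not> ?thesis"
    then have "pos ` corners t \<subseteq> {z. a \<bullet> z \<ge> - k}"
      using height_sign[of _ t] h by force
    then have "tile t \<subseteq> {z. a \<bullet> z \<ge> - k}"
      unfolding tile_def by (rule hull_minimal) (rule convex_halfspace_ge)
    then have "z \<in> interior {z. a \<bullet> z \<ge> - k}" using z(1) interior_mono by blast
    then show False using \<open>a \<noteq> 0\<close> z(2) by (simp add: h)
  qed
qed

definition straddles :: "int \<times> int \<Rightarrow> int \<times> int \<Rightarrow> bool" where
  "straddles y y' \<longleftrightarrow> (0 < \<phi> y \<and> \<phi> y < 2 * \<omega> \<and> 2 * \<omega> < \<phi> y') \<or> (2 * \<omega> < \<phi> y \<and> 0 < \<phi> y' \<and> \<phi> y' < 2 * \<omega>)"

text \<open>A zero in the open side makes the ends have opposite signs or both be zero. In the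
  latter case the side lies along the chord, and being consecutive its ends leave no corner strictly
  on one of the two sides of the chord, against \<open>height_interior\<close>.\<close>

lemma crossing_straddles:
  assumes z: "z \<in> interior (tile t)" "height t z = 0"
    and y: "dstep y y' l" "y \<in> corners t" "y' \<in> corners t"
    and x: "x \<in> open_segment (pos y) (pos y')" "height t x = 0"
  shows "straddles y y'"
proof -
  obtain a k where h: "\<And>z. height t z = a \<bullet> z + k" using height_affine by blast
  obtain u where u: "0 < u" "u < 1" "x = (1 - u) *\<^sub>R pos y + u *\<^sub>R pos y'"
    using x(1) by (auto simp: in_segment)
  have "height t x = (1 - u) * height t (pos y) + u * height t (pos y')"
    unfolding h u(3) by (simp add: inner_right_distrib algebra_simps)
  then have sum: "(1 - u) * height t (pos y) + u * height t (pos y') = 0" using x(2) by simp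
  define p q where "p = height t (pos y)" and "q = height t (pos y')"
  have q: "q = - ((1 - u) / u * p)" using sum u(1) by (simp add: p_def q_def field_simps)
  have c: "0 < (1 - u) / u" using u by simp
  have sgn: "(0 < p \<and> q < 0) \<or> (p < 0 \<and> 0 < q) \<or> (p = 0 \<and> q = 0)"
    using c mult_pos_pos[OF c, of p] mult_pos_neg[OF c, of p] unfolding q by (cases p "0::real" rule: linorder_cases) auto
  have "\<not> (p = 0 \<and> q = 0)"
  proof
    assume "p = 0 \<and> q = 0"
    then have "\<phi> y = 0 \<or> \<phi> y = 2 * \<omega>" "\<phi> y' = 0 \<or> \<phi> y' = 2 * \<omega>"
      using height_sign[OF y(2)] height_sign[OF y(3)] by (auto simp: p_def q_def)
    moreover obtain z\<^sub>1 where "z\<^sub>1 \<in> corners t" "0 < \<phi> z\<^sub>1" "\<phi> z\<^sub>1 < 2 * \<omega>" using height_interior(1)[OF z] by blast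
    moreover obtain z\<^sub>2 where "z\<^sub>2 \<in> corners t" "2 * \<omega> < \<phi> z\<^sub>2" using height_interior(2)[OF z] by blast
    moreover from calculation have "(\<phi> y < \<phi> y' \<and> (\<phi> z\<^sub>1 \<le> \<phi> y \<or> \<phi> y' \<le> \<phi> z\<^sub>1)) \<or> (\<phi> y' < \<phi> y \<and> \<phi> z\<^sub>2 \<le> \<phi> y)"
      using dstep_consecutive[OF y] by blast
    ultimately show False using omega by linarith
  qed
  with sgn have "(0 < height t (pos y) \<and> height t (pos y') < 0) \<or> (height t (pos y) < 0 \<and> 0 < height t (pos y'))"
    by (auto simp: p_def q_def)
  then show ?thesis
    using height_sign[OF y(2)] height_sign[OF y(3)] unfolding straddles_def by auto
qed

text \<open>A straddling side either passes the angle \<open>2 * \<omega>\<close> or is the wrapping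
  side passing angle \<open>0\<close>, and a tile has at most one side of each kind.\<close>

lemma straddle_unique:
  assumes "dstep y y' l" "y \<in> corners t" "y' \<in> corners t" "straddles y y'"
    and "dstep z z' l'" "z \<in> corners t" "z' \<in> corners t" "straddles z z'"
    and "\<phi> y < \<phi> y' \<longleftrightarrow> \<phi> z < \<phi> z'"
  shows "y = z" "y' = z'"
proof -
  have "\<phi> y = \<phi> z"
  proof (cases "\<phi> y < \<phi> y'")
    case True
    then have y: "\<phi> y < 2 * \<omega>" "2 * \<omega> < \<phi> y'" using assms(4) by (auto simp: straddles_def)
    from True have z: "\<phi> z < 2 * \<omega>" "2 * \<omega> < \<phi> z'" using assms(8,9) by (auto simp: straddles_def)
    have "\<phi> z \<le> \<phi> y \<or> \<phi> y' \<le> \<phi> z" using dstep_consecutive[OF assms(1-3)] True assms(6) by auto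
    moreover have "\<phi> y \<le> \<phi> z \<or> \<phi> z' \<le> \<phi> y" using dstep_consecutive[OF assms(5-7)] True assms(2,9) by auto
    ultimately show ?thesis using y z by linarith
  next
    case False
    have "\<phi> z \<le> \<phi> y" using dstep_consecutive[OF assms(1-3)] False assms(6) by auto
    moreover have "\<phi> y \<le> \<phi> z" using dstep_consecutive[OF assms(5-7)] False assms(2,9) by auto
    ultimately show ?thesis by simp
  qed
  then show "y = z" using phi_inj_on_corners assms(2,6) by blast
  then show "y' = z'" using dstep_unique[OF assms(1) _ assms(3,7)] assms(5) by blast
qed

text \<open>In a tile at the origin the wrapping side ends at the origin itself, which is on the
  chord, so this side does not straddle.\<close>

lemma straddle_at_origin:
  assumes "dstep y y' l" "y \<in> corners t" "y' \<in> corners t" "straddles y y'" "(0, 0) \<in> corners t"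
  shows "\<phi> y < \<phi> y'"
proof (rule ccontr)
  assume "\<not> ?thesis"
  then have "\<phi> y' \<le> \<phi> (0, 0)" using dstep_consecutive[OF assms(1-3)] assms(5) by blast
  then show False using assms(4) omega unfolding straddles_def by auto
qed

lemma zero_on_edge_unique:
  assumes "y \<in> corners t" "y' \<in> corners t" "straddles y y'"
    and "x \<in> open_segment (pos y) (pos y')" "height t x = 0" "x' \<in> open_segment (pos y) (pos y')" "height t x' = 0"
  shows "x = x'"
proof -
  obtain a k where h: "\<And>z. height t z = a \<bullet> z + k" using height_affine by blast
  obtain u where u: "x = (1 - u) *\<^sub>R pos y + u *\<^sub>R pos y'" using assms(4) by (auto simp: in_segment)
  obtain u' where u': "x' = (1 - u') *\<^sub>R pos y + u' *\<^sub>R pos y'" using assms(6) by (auto simp: in_segment)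
  have "height t x - height t x' = (u - u') * (height t (pos y') - height t (pos y))"
    unfolding h u u' by (simp add: inner_right_distrib algebra_simps)
  moreover have "height t (pos y') - height t (pos y) \<noteq> 0"
    using assms(1-3) height_corner_pos[of y t] height_corner_neg[of y t] height_corner_pos[of y' t] height_corner_neg[of y' t]
    unfolding straddles_def by auto
  ultimately have "u = u'" using assms(5,7) by simp
  then show ?thesis using u u' by simp
qed

lemma tile_disjoint_interior: "t \<noteq> t' \<Longrightarrow> tile t \<inter> interior (tile t') = {}"
proof -
  assume "t \<noteq> t'"
  then have ne: "tile t \<noteq> tile t'" using tile_inj by blast
  then have F: "tile t \<inter> tile t' face_of tile t'" and d: "interior (tile t) \<inter> interior (tile t') = {}"
    using tiling tile_in unfolding edge_to_edge_tiling_def by blast+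
  have "tile t \<inter> tile t' \<noteq> tile t'"
  proof
    assume "tile t \<inter> tile t' = tile t'"
    then have "interior (tile t') \<subseteq> interior (tile t)" using interior_mono by blast
    then show False using d folded_tile_interior[OF folded_tile[of t']] by blast
  qed
  from face_of_disjoint_interior[OF F this] show ?thesis using interior_subset by blast
qed

end

subsection \<open>Trajectories on a level line\<close>

text \<open>The condition \<open>level\<close> concerns every lattice tile containing the point and
  not only the tile being traversed, so the two open halves of any tile avoid the whole
  petal.\<close>

locale level_trajectory = level_line +
  fixes n :: nat and x :: "nat \<Rightarrow> complex" and Q :: "nat \<Rightarrow> complex set"
  assumes n: "0 < n"
    and trajectory: "billiard_trajectory T n x Q"
    and start: "Q 0 = tile (0, 0)" "x 0 = A" "x n = A"
    and level: "\<And>i z t. i < n \<Longrightarrow> z \<in> closed_segment (x i) (x (Suc i)) \<Longrightarrow> z \<in> tile t \<Longrightarrow> height t z = 0"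
begin

text \<open>For \<open>i < n\<close> the index exists and \<open>tile_inj\<close> makes it unique;
  for later \<open>i\<close> it may be an arbitrary value.\<close>

definition \<tau> :: "nat \<Rightarrow> int \<times> int" where
  "\<tau> i = (SOME t. Q i = tile t)"

lemma segment_nondegenerate: "i < n \<Longrightarrow> x i \<noteq> x (Suc i)"
  and segment_interior: "i < n \<Longrightarrow> open_segment (x i) (x (Suc i)) \<subseteq> interior (Q i)"
  and trajectory_neighbours: "Suc i < n \<Longrightarrow> \<exists>a b. neighbours T (Q i) (Q (Suc i)) (closed_segment a b) \<and> x (Suc i) \<in> open_segment a b"
  using trajectory unfolding billiard_trajectory_def by blast+

lemma tau_unique: "Q i = tile t \<Longrightarrow> \<tau> i = t"
  unfolding \<tau>_def by (rule some_equality) (auto dest: tile_inj)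

lemma tau_parity: "i < n \<Longrightarrow> Q i = tile (\<tau> i) \<and> (even_vertex (\<tau> i) \<longleftrightarrow> even i)"
proof (induction i)
  case 0
  have "\<tau> 0 = (0, 0)" using start(1) by (rule tau_unique)
  then show ?case using start by simp
next
  case (Suc i)
  then have IH: "Q i = tile (\<tau> i)" "even_vertex (\<tau> i) \<longleftrightarrow> even i" by auto
  obtain a b where "neighbours T (tile (\<tau> i)) (Q (Suc i)) (closed_segment a b)"
    using trajectory_neighbours[OF Suc.prems] IH by auto
  then obtain t' where t': "Q (Suc i) = tile t'" "even_vertex t' \<longleftrightarrow> \<not> even_vertex (\<tau> i)"
    by (rule neighbour_tile)
  then show ?case using IH unfolding tau_unique[OF t'(1)] even_Suc by blast
qed

lemma Q_tile: "i < n \<Longrightarrow> Q i = tile (\<tau> i)"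
  using tau_parity by blast

lemma tau_0: "\<tau> 0 = (0, 0)"
  using start(1) by (rule tau_unique)

lemma segment_in_tile: "i < n \<Longrightarrow> closed_segment (x i) (x (Suc i)) \<subseteq> tile (\<tau> i)"
proof -
  assume i: "i < n"
  have "open_segment (x i) (x (Suc i)) \<subseteq> tile (\<tau> i)"
    using segment_interior[OF i] interior_subset Q_tile[OF i] by blast
  then have "closure (open_segment (x i) (x (Suc i))) \<subseteq> tile (\<tau> i)"
    using compact_imp_closed[OF tile_compact_convex(1)] by (rule closure_minimal)
  then show ?thesis using segment_nondegenerate[OF i] by simp
qed

lemma segment_midpoint:
  assumes "i < n"
  shows "midpoint (x i) (x (Suc i)) \<in> interior (tile (\<tau> i))" "height (\<tau> i) (midpoint (x i) (x (Suc i))) = 0"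
proof -
  have "midpoint (x i) (x (Suc i)) \<in> open_segment (x i) (x (Suc i))"
    using segment_nondegenerate[OF assms] by simp
  then show 1: "midpoint (x i) (x (Suc i)) \<in> interior (tile (\<tau> i))"
    using segment_interior[OF assms] Q_tile[OF assms] by auto
  show "height (\<tau> i) (midpoint (x i) (x (Suc i))) = 0"
    using level[OF assms _ subsetD[OF interior_subset 1]] by simp
qed

definition crossing :: "nat \<Rightarrow> int \<times> int \<Rightarrow> int \<times> int \<Rightarrow> bool" where
  "crossing i y y' \<longleftrightarrow> (\<exists>l. dstep y y' l) \<and> y \<in> corners (\<tau> i) \<and> y' \<in> corners (\<tau> i) \<and>
     y \<in> corners (\<tau> (Suc i)) \<and> y' \<in> corners (\<tau> (Suc i)) \<and> x (Suc i) \<in> open_segment (pos y) (pos y') \<and> straddles y y'"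

lemma x_height:
  assumes "i < n" shows "height (\<tau> i) (x i) = 0 \<and> height (\<tau> i) (x (Suc i)) = 0"
proof -
  have "x i \<in> closed_segment (x i) (x (Suc i))" "x (Suc i) \<in> closed_segment (x i) (x (Suc i))" by simp_all
  then show ?thesis using level[OF assms] segment_in_tile[OF assms] by blast
qed

lemma crossing_exists:
  assumes "Suc i < n"
  shows "\<exists>y y'. crossing i y y'"
proof -
  have i: "i < n" using assms by simp
  obtain a b where ab: "neighbours T (tile (\<tau> i)) (Q (Suc i)) (closed_segment a b)" "x (Suc i) \<in> open_segment a b"
    using trajectory_neighbours[OF assms] Q_tile[OF i] by auto
  from ab(1) obtain y y' l t' where y: "dstep y y' l" "y \<in> corners (\<tau> i)" "y' \<in> corners (\<tau> i)"
      "y \<in> corners t'" "y' \<in> corners t'" and e: "{a, b} = {pos y, pos y'}" "Q (Suc i) = tile t'"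
    by (rule neighbour_tile)
  have t': "t' = \<tau> (Suc i)" using tau_unique[OF e(2)] by simp
  have os: "open_segment a b = open_segment (pos y) (pos y')"
    unfolding open_segment_def segment_convex_hull e(1) ..
  have xo: "x (Suc i) \<in> open_segment (pos y) (pos y')" using ab(2) unfolding os .
  have "straddles y y'"
    by (rule crossing_straddles[OF segment_midpoint[OF i] y(1-3) xo]) (use x_height[OF i] in blast)
  then show ?thesis unfolding crossing_def using y xo t' by blast
qed

text \<open>Two crossings of the same kind in one tile would use the same side, which the chord
  meets only once, so the segment between them would be degenerate.\<close>

lemma crossing_alternate:
  assumes i: "Suc (Suc i) < n" and c: "crossing i y y'" "crossing (Suc i) z z'"
  shows "\<phi> y < \<phi> y' \<longleftrightarrow> \<not> \<phi> z < \<phi> z'"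
proof (rule ccontr)
  assume "\<not> ?thesis"
  then have same: "\<phi> y < \<phi> y' \<longleftrightarrow> \<phi> z < \<phi> z'" by blast
  obtain l l' where "dstep y y' l" "dstep z z' l'" using c unfolding crossing_def by blast
  then have eq: "y = z" "y' = z'"
    using straddle_unique[of y y' l "\<tau> (Suc i)" z z' l'] same c unfolding crossing_def by blast+
  have "x (Suc i) = x (Suc (Suc i))"
    using zero_on_edge_unique[of y "\<tau> (Suc i)" y' "x (Suc i)" "x (Suc (Suc i))"]
      c[unfolded crossing_def] eq x_height[of "Suc i"] i by simp
  then show False using segment_nondegenerate[of "Suc i"] i by simp
qed

lemma crossing_at_origin:
  assumes "crossing i y y'" "t = \<tau> i \<or> t = \<tau> (Suc i)" "(0, 0) \<in> corners t"
  shows "\<phi> y < \<phi> y'"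
proof -
  obtain l where "dstep y y' l" using assms(1) unfolding crossing_def by blast
  then show ?thesis using straddle_at_origin[of y y' l t] assms unfolding crossing_def by blast
qed

lemma origin_in_base: "(0, 0) \<in> corners (0, 0)"
  by (simp add: corners_def)

lemma crossing_parity:
  "Suc i < n \<Longrightarrow> crossing i y y' \<Longrightarrow> \<phi> y < \<phi> y' \<longleftrightarrow> even i"
proof (induction i arbitrary: y y')
  case 0
  have "\<phi> y < \<phi> y'"
    using crossing_at_origin[OF 0(2) disjI1[OF refl]] origin_in_base tau_0 by simp
  then show ?case by simp
next
  case (Suc i)
  obtain z z' where z: "crossing i z z'" using crossing_exists[of i] Suc.prems by force
  show ?case using crossing_alternate[OF Suc.prems(1) z Suc.prems(2)] Suc.IH[OF _ z] Suc.prems by auto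
qed

text \<open>In an edge-to-edge tiling a corner of one tile is extreme in the common face, hence a
  corner of every tile containing it.\<close>

lemma origin_corner: "i < n \<Longrightarrow> A \<in> tile (\<tau> i) \<Longrightarrow> (0, 0) \<in> corners (\<tau> i)"
proof (cases "\<tau> i = (0, 0)")
  case True
  then show ?thesis by (simp add: corners_def)
next
  case False
  assume A: "A \<in> tile (\<tau> i)"
  have "A extreme_point_of tile (0, 0)"
    unfolding extreme_tile using pos_corners(1) by (auto simp: corners_def)
  moreover have "tile (0, 0) \<noteq> tile (\<tau> i)" using False tile_inj by metis
  then have F: "tile (0, 0) \<inter> tile (\<tau> i) face_of tile (0, 0)" "tile (0, 0) \<inter> tile (\<tau> i) face_of tile (\<tau> i)"
    using tiling tile_in unfolding edge_to_edge_tiling_def by blast+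
  moreover have "A \<in> tile (0, 0)" using calculation(1) by (simp add: extreme_point_of_def)
  ultimately have "A extreme_point_of tile (\<tau> i)"
    using A extreme_point_of_face[OF F(1)] extreme_point_of_face[OF F(2)] by blast
  then have "A \<in> pos ` corners (\<tau> i)" unfolding extreme_tile .
  then obtain y where y: "A = pos y" "y \<in> corners (\<tau> i)" by (rule imageE)
  have "y = (0, 0)" using y(1) pos_corners(1) by (intro injD[OF pos_inj]) simp
  then show ?thesis using y(2) by simp
qed

lemma n_ge_2: "2 \<le> n"
proof (rule ccontr)
  assume "\<not> ?thesis"
  then have "n = 1" using n by simp
  then show False using segment_nondegenerate[of 0] start by simp
qed

lemma last_tile_origin: "(0, 0) \<in> corners (\<tau> (n - 1))"
proof -
  have "A \<in> closed_segment (x (n - 1)) (x (Suc (n - 1)))" using start(3) n by simp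
  then have "A \<in> tile (\<tau> (n - 1))" using segment_in_tile[of "n - 1"] n by auto
  then show ?thesis using origin_corner n by simp
qed

text \<open>The trajectory leaves the first and enters the last tile through a side where the angle
  passes \<open>2\<omega>\<close>, and the two kinds of crossings alternate.\<close>

lemma n_even: "even n"
proof -
  define i where "i = n - 2"
  have i: "Suc i < n" "Suc i = n - 1" "n = i + 2" using n_ge_2 by (auto simp: i_def)
  obtain y y' where c: "crossing i y y'" using crossing_exists[OF i(1)] by blast
  have "\<phi> y < \<phi> y'"
    using crossing_at_origin[OF c disjI2[OF refl]] last_tile_origin i(2) by simp
  then show ?thesis using crossing_parity[OF i(1) c] i(3) by simp
qed

text \<open>Among the four tiles at the origin the odd ones are those that share a side with the
  base tile.\<close>

lemma last_tile: "\<tau> (n - 1) = (-1, 0) \<or> \<tau> (n - 1) = (0, -1)"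
proof -
  obtain i j where t: "\<tau> (n - 1) = (i, j)" by (cases "\<tau> (n - 1)")
  have "odd (i + j)" using tau_parity[of "n - 1"] n n_even t by auto
  moreover have "(i = 0 \<or> i = -1) \<and> (j = 0 \<or> j = -1)"
    using last_tile_origin unfolding t corners_def by auto
  ultimately show ?thesis unfolding t by auto
qed

lemma tiles_through_crossing:
  assumes c: "crossing i y y'" and t: "x (Suc i) \<in> tile t" "t \<noteq> \<tau> (Suc i)"
  shows "neighbours T (tile (\<tau> (Suc i))) (tile t) (closed_segment (pos y) (pos y'))"
proof -
  obtain l where l: "dstep y y' l" using c unfolding crossing_def by blast
  note y = c[unfolded crossing_def]
  have e: "closed_segment (pos y) (pos y') edge_of tile (\<tau> (Suc i))" "pos y \<noteq> pos y'"
    using folded_tile_side[OF folded_tile l] y by blast+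
  have r: "x (Suc i) \<in> rel_interior (closed_segment (pos y) (pos y'))"
    using y e(2) by (simp add: rel_interior_closed_segment)
  have "tile (\<tau> (Suc i)) \<noteq> tile t" using t(2) tile_inj by blast
  from tile_through_edge_point[OF tiling tile_in tile_in this tile_compact_convex(2) folded_tile_interior[OF folded_tile] e(1) r t(1)]
  show ?thesis by blast
qed

lemma tau_step:
  assumes "Suc i < n" shows "\<tau> i \<noteq> \<tau> (Suc i)"
proof
  assume "\<tau> i = \<tau> (Suc i)"
  then have "even i \<longleftrightarrow> even (Suc i)"
    using tau_parity[of i] tau_parity[of "Suc i"] assms by simp
  then show False by simp
qed

text \<open>By parity, a tile visited twice is entered by crossings of the same kind, hence through
  the same side and from the same tile. This descends to a return to the base tile, which would be
  entered at an odd crossing, while a tile at the origin allows only the kind that occurs at even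
  ones.\<close>

lemma tau_distinct: "i < j \<Longrightarrow> j < n \<Longrightarrow> \<tau> i \<noteq> \<tau> j"
proof (induction i arbitrary: j)
  case 0
  show ?case
  proof
    assume eq: "\<tau> 0 = \<tau> j"
    then have tj: "\<tau> j = (0, 0)" using tau_0 by simp
    have "even j" using tau_parity[OF 0(2)] by (simp add: tj)
    with 0 obtain k where j: "j = Suc k" "odd k" by (cases j) auto
    obtain y y' where c: "crossing k y y'" using crossing_exists[of k] 0 j by force
    have "\<phi> y < \<phi> y'"
      using crossing_at_origin[OF c disjI2[OF refl]] origin_in_base tau_0 eq j by simp
    then show False using crossing_parity[OF _ c] j 0 by simp
  qed
next
  case (Suc i)
  show ?case
  proof
    assume eq: "\<tau> (Suc i) = \<tau> j"
    obtain k where j: "j = Suc k" "i < k" using Suc.prems by (cases j) auto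
    have par: "even i \<longleftrightarrow> even k"
      using tau_parity[of "Suc i"] tau_parity[of j] eq Suc.prems j(1) by (metis even_Suc less_trans)
    obtain y y' where c: "crossing i y y'" using crossing_exists[of i] Suc.prems by force
    obtain z z' where d: "crossing k z z'" using crossing_exists[of k] Suc.prems j by force
    have same: "\<phi> y < \<phi> y' \<longleftrightarrow> \<phi> z < \<phi> z'"
      using crossing_parity[OF _ c] crossing_parity[OF _ d] par Suc.prems j by auto
    obtain l l' where "dstep y y' l" "dstep z z' l'" using c d unfolding crossing_def by blast
    moreover have "z \<in> corners (\<tau> (Suc i))" "z' \<in> corners (\<tau> (Suc i))"
      using d unfolding crossing_def j(1)[symmetric] eq[symmetric] by blast+
    ultimately have yz: "y = z" "y' = z'"
      using straddle_unique[of y y' l "\<tau> (Suc i)" z z' l'] same c d unfolding crossing_def by blast+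
    have N: "neighbours T (tile (\<tau> (Suc i))) (tile (\<tau> i)) (closed_segment (pos y) (pos y'))"
    proof (rule tiles_through_crossing[OF c])
      show "x (Suc i) \<in> tile (\<tau> i)" using segment_in_tile[of i] Suc.prems by auto
      show "\<tau> i \<noteq> \<tau> (Suc i)" using tau_step Suc.prems by simp
    qed
    have N': "neighbours T (tile (\<tau> (Suc k))) (tile (\<tau> k)) (closed_segment (pos z) (pos z'))"
    proof (rule tiles_through_crossing[OF d])
      show "x (Suc k) \<in> tile (\<tau> k)" using segment_in_tile[of k] Suc.prems j by auto
      show "\<tau> k \<noteq> \<tau> (Suc k)" using tau_step Suc.prems j by simp
    qed
    have "tile (\<tau> i) = tile (\<tau> k)"
      using symmetric[OF N] symmetric[OF N'] eq j yz by simp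
    then have "\<tau> i = \<tau> k" by (rule tile_inj)
    then show False using Suc.IH[of k] j Suc.prems by simp
  qed
qed

lemma tile_of_crossing_point:
  assumes "0 < a" "a < n" "c < n" "x a \<in> tile (\<tau> c)"
  shows "c = a \<or> Suc c = a"
proof (rule ccontr)
  assume not: "\<not> ?thesis"
  obtain i where a: "a = Suc i" using assms(1) by (cases a) auto
  have i: "i < n" "c < n" using assms a by auto
  obtain y y' where cr: "crossing i y y'" using crossing_exists[of i] assms a by force
  have dis: "\<tau> c \<noteq> \<tau> m" if "c \<noteq> m" "m < n" for m
    using tau_distinct[of c m] tau_distinct[of m c] that i(2) by (cases "c < m") auto
  have ne: "\<tau> c \<noteq> \<tau> (Suc i)" "\<tau> c \<noteq> \<tau> i"
    using dis[of "Suc i"] dis[of i] not a assms(2) i by auto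
  have "neighbours T (tile (\<tau> (Suc i))) (tile (\<tau> c)) (closed_segment (pos y) (pos y'))"
    using tiles_through_crossing[OF cr _ ne(1)] assms(4) a by simp
  moreover have "x (Suc i) \<in> tile (\<tau> i)" using segment_in_tile[of i] i by auto
  then have "neighbours T (tile (\<tau> (Suc i))) (tile (\<tau> i)) (closed_segment (pos y) (pos y'))"
    using tiles_through_crossing[OF cr] tau_step[of i] assms a by simp
  ultimately have "tile (\<tau> c) = tile (\<tau> i)" using symmetric by metis
  then show False using ne(2) tile_inj by blast
qed

text \<open>The tiles are distinct, so segments can meet only at endpoints, and a crossing point
  lies in just the two tiles of the trajectory that are adjacent there.\<close>

lemma segments_meet:
  assumes ij: "i < j" "j < n" and z: "z \<in> closed_segment (x i) (x (Suc i))" "z \<in> closed_segment (x j) (x (Suc j))"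
  shows "z = x j \<and> j = Suc i \<or> z = A \<and> i = 0 \<and> Suc j = n"
proof -
  have zt: "z \<in> tile (\<tau> i)" "z \<in> tile (\<tau> j)" using z segment_in_tile[of i] segment_in_tile[of j] ij by auto
  have "z \<notin> interior (tile (\<tau> j))" "z \<notin> interior (tile (\<tau> i))"
    using tile_disjoint_interior[of "\<tau> i" "\<tau> j"] tile_disjoint_interior[of "\<tau> j" "\<tau> i"] tau_distinct[OF ij] zt by auto
  then have "z \<notin> open_segment (x j) (x (Suc j))" "z \<notin> open_segment (x i) (x (Suc i))"
    using segment_interior[of i] segment_interior[of j] Q_tile[of i] Q_tile[of j] ij by auto
  then have ends: "z = x i \<or> z = x (Suc i)" "z = x j \<or> z = x (Suc j)"
    using z by (auto simp: open_segment_def)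
  have in_only: "i = a \<or> Suc i = a" "j = a \<or> Suc j = a" if "z = x a" "0 < a" "a < n" for a
    using tile_of_crossing_point[OF that(2,3)] zt that(1) ij by auto
  show ?thesis
  proof (cases "z = x (Suc i)")
    case True
    have "Suc i < n" using ij by simp
    then have "j = Suc i \<or> Suc j = Suc i" using in_only(2)[OF True] by simp
    then have "j = Suc i" using ij by simp
    then show ?thesis using True by simp
  next
    case False
    then have zi: "z = x i" using ends by blast
    have "i = 0"
    proof (rule ccontr)
      assume "i \<noteq> 0"
      then have "j = i \<or> Suc j = i" using in_only(2)[OF zi] ij by simp
      then show False using ij by simp
    qed
    then have zA: "z = A" using zi start by simp
    show ?thesis
    proof (cases "Suc j = n")
      case True
      then show ?thesis using \<open>i = 0\<close> zA by simp
    next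
      case False
      have "z \<noteq> x (Suc j)"
      proof
        assume "z = x (Suc j)"
        then have "i = Suc j \<or> Suc i = Suc j" using in_only(1)[of "Suc j"] False ij by simp
        then show False using ij by simp
      qed
      then have zj: "z = x j" using ends(2) by blast
      then have "i = j \<or> Suc i = j" using in_only(1)[OF zj] ij by simp
      then show ?thesis using zj ij by auto
    qed
  qed
qed

end

subsection \<open>The domain enclosed by the petal\<close>

context level_trajectory
begin

definition petal_curve :: "complex set" where
  "petal_curve = (\<Union>i<n. closed_segment (x i) (x (Suc i)))"

lemma initial_arc:
  assumes "Suc k < n"
  shows "\<exists>g. arc g \<and> pathstart g = A \<and> pathfinish g = x (Suc k) \<and>
    path_image g = (\<Union>i<Suc k. closed_segment (x i) (x (Suc i)))"
  using assms
proof (induction k)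
  case 0
  have "arc (linepath (x 0) (x (Suc 0)))" using segment_nondegenerate[of 0] n by (intro arc_linepath) simp
  then show ?case using start(2)
    by (intro exI[of _ "linepath (x 0) (x (Suc 0))"]) (simp add: lessThan_Suc)
next
  case (Suc k)
  then obtain g where g: "arc g" "pathstart g = A" "pathfinish g = x (Suc k)"
    and im: "path_image g = (\<Union>i<Suc k. closed_segment (x i) (x (Suc i)))" by auto
  let ?l = "linepath (x (Suc k)) (x (Suc (Suc k)))"
  have "arc ?l" using segment_nondegenerate[of "Suc k"] Suc.prems by (intro arc_linepath) simp
  moreover have "path_image g \<inter> path_image ?l \<subseteq> {pathstart ?l}"
  proof
    fix z assume "z \<in> path_image g \<inter> path_image ?l"
    then obtain i where "i < Suc k" "z \<in> closed_segment (x i) (x (Suc i))" "z \<in> closed_segment (x (Suc k)) (x (Suc (Suc k)))"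
      unfolding im by auto
    then show "z \<in> {pathstart ?l}" using segments_meet[of i "Suc k" z] Suc.prems by auto
  qed
  ultimately have "arc (g +++ ?l)" using g by (intro arc_join) auto
  moreover have "path_image (g +++ ?l) = (\<Union>i<Suc (Suc k). closed_segment (x i) (x (Suc i)))"
    using g by (subst path_image_join) (auto simp: im lessThan_Suc)
  ultimately show ?case using g by (intro exI[of _ "g +++ ?l"]) auto
qed

lemma petal_loop: "\<exists>g. simple_path g \<and> pathfinish g = pathstart g \<and> path_image g = petal_curve"
proof -
  define k where "k = n - 2"
  have k: "n = Suc (Suc k)" using n_ge_2 by (simp add: k_def)
  obtain g where g: "arc g" "pathstart g = A" "pathfinish g = x (Suc k)"
    and im: "path_image g = (\<Union>i<Suc k. closed_segment (x i) (x (Suc i)))"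
    using initial_arc[of k] k by auto
  let ?l = "linepath (x (Suc k)) A"
  have xn: "x (Suc (Suc k)) = A" using start(3) k by simp
  have "arc ?l" using segment_nondegenerate[of "Suc k"] k xn by (intro arc_linepath) simp
  moreover have "path_image g \<inter> path_image ?l \<subseteq> {pathstart g, pathstart ?l}"
  proof
    fix z assume "z \<in> path_image g \<inter> path_image ?l"
    then obtain i where "i < Suc k" "z \<in> closed_segment (x i) (x (Suc i))" "z \<in> closed_segment (x (Suc k)) (x (Suc (Suc k)))"
      unfolding im xn by auto
    then show "z \<in> {pathstart g, pathstart ?l}" using segments_meet[of i "Suc k" z] k g by auto
  qed
  ultimately have "simple_path (g +++ ?l)" using g by (intro simple_path_join_loop) auto
  moreover have "path_image (g +++ ?l) = petal_curve"
    unfolding petal_curve_def unfolding k using g by (subst path_image_join) (auto simp: im lessThan_Suc xn)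
  ultimately show ?thesis using g by (intro exI[of _ "g +++ ?l"]) auto
qed

lemma inside_connected:
  assumes "connected S" "S \<inter> petal_curve = {}" "p \<in> S" "p \<in> inside petal_curve"
  shows "S \<subseteq> inside petal_curve"
proof
  fix q assume "q \<in> S"
  then have "connected_component (- petal_curve) p q"
    using assms unfolding connected_component_def by blast
  then show "q \<in> inside petal_curve" using assms(4) inside_same_component by blast
qed

lemma petal_height: "z \<in> petal_curve \<Longrightarrow> z \<in> tile t \<Longrightarrow> height t z = 0"
  using level unfolding petal_curve_def by blast

lemma tile_side_connected:
  "connected {z \<in> tile t. 0 < height t z}" "connected {z \<in> tile t. height t z < 0}"
  using convex_connected[OF convex_Int[OF tile_compact_convex(2) convex_height(2)]]
    convex_connected[OF convex_Int[OF tile_compact_convex(2) convex_height(1)]]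
  by (simp_all add: Int_def)

lemma tile_side_disjoint:
  "{z \<in> tile t. 0 < height t z} \<inter> petal_curve = {}" "{z \<in> tile t. height t z < 0} \<inter> petal_curve = {}"
  using petal_height by fastforce+

lemma pos_in_tile: "y \<in> corners t \<Longrightarrow> pos y \<in> tile t"
  unfolding tile_def by (rule hull_inc) (rule imageI)

text \<open>As the end of the step from the origin, \<open>(1, 0)\<close> has the least positive
  angle in the base tile, and some corner of this tile is above the chord.\<close>

lemma right_neighbour: "0 < \<phi> (1, 0)" "\<phi> (1, 0) < 2 * \<omega>" "(1, 0) \<in> corners (0, 0)"
proof -
  obtain w where w: "w \<in> corners (0, 0)" "0 < \<phi> w" "\<phi> w < 2 * \<omega>"
    using height_interior(1)[OF segment_midpoint[OF n]] tau_0 by auto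
  show c: "(1, 0) \<in> corners (0, 0)" by (simp add: corners_def)
  show p: "0 < \<phi> (1, 0)" using arcs_pos by (simp add: phi_neighbours)
  have "dstep (0, 0) (1, 0) a\<^sub>1" by (simp add: dstep_def)
  from dstep_consecutive[OF this origin_in_base c] w p show "\<phi> (1, 0) < 2 * \<omega>" by force
qed

lemma left_neighbour:
  assumes "\<tau> (n - 1) = (-1, 0)"
  shows "0 < \<phi> (-1, 0)" "\<phi> (-1, 0) < 2 * \<omega>" "(-1, 0) \<in> corners (-1, 0)"
proof -
  obtain w where w: "w \<in> corners (-1, 0)" "0 < \<phi> w" "\<phi> w < 2 * \<omega>"
    using height_interior(1)[OF segment_midpoint[of "n - 1"]] n assms by auto
  show c: "(-1, 0) \<in> corners (-1, 0)" by (simp add: corners_def)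
  have o: "(0, 0) \<in> corners (-1, 0)" by (simp add: corners_def)
  show p: "0 < \<phi> (-1, 0)" using arcs_pos by (simp add: phi_neighbours)
  have "dstep (0, 0) (-1, 0) a\<^sub>3" by (simp add: dstep_def)
  from dstep_consecutive[OF this o c] w p show "\<phi> (-1, 0) < 2 * \<omega>" by force
qed

text \<open>The step from \<open>(0, 1)\<close> ends at the origin and wraps, so
  \<open>(0, 1)\<close> has the largest angle in the base tile, and some corner is beyond
  \<open>2 * \<omega>\<close>.\<close>

lemma upper_neighbour: "2 * \<omega> < \<phi> (0, 1)" "(0, 1) \<in> corners (0, 0)"
proof -
  obtain w where w: "w \<in> corners (0, 0)" "2 * \<omega> < \<phi> w"
    using height_interior(2)[OF segment_midpoint[OF n]] tau_0 by auto
  show c: "(0, 1) \<in> corners (0, 0)" by (simp add: corners_def)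
  have "dstep (0, 1) (0, 0) a\<^sub>4" by (simp add: dstep_def)
  from dstep_consecutive[OF this c origin_in_base] have "\<phi> w \<le> \<phi> (0, 1)"
    using w phi_range(1)[of "(0, 1)"] by auto
  then show "2 * \<omega> < \<phi> (0, 1)" using w by simp
qed

text \<open>Consecutive tiles of the petal share the end above the chord of the side that is
  crossed.\<close>

lemma chain:
  "i < n \<Longrightarrow> z \<in> corners (\<tau> i) \<Longrightarrow> 0 < \<phi> z \<Longrightarrow> \<phi> z < 2 * \<omega> \<Longrightarrow> ((1, 0), z) \<in> (tilemates {0<..<2 * \<omega>})\<^sup>*"
proof (induction i arbitrary: z)
  case 0
  then have "((1, 0), z) \<in> tilemates {0<..<2 * \<omega>}"
    using right_neighbour tau_0 by (intro tilematesI[where t = "(0, 0)"]) auto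
  then show ?case by blast
next
  case (Suc i)
  obtain y y' where c: "crossing i y y'" using crossing_exists[OF Suc.prems(1)] by blast
  then obtain w where w: "w \<in> corners (\<tau> i)" "w \<in> corners (\<tau> (Suc i))" "0 < \<phi> w" "\<phi> w < 2 * \<omega>"
    unfolding crossing_def straddles_def by blast
  then have "((1, 0), w) \<in> (tilemates {0<..<2 * \<omega>})\<^sup>*" using Suc.IH Suc.prems(1) by simp
  moreover have "(w, z) \<in> tilemates {0<..<2 * \<omega>}"
    using w Suc.prems by (intro tilematesI[where t = "\<tau> (Suc i)"]) auto
  ultimately show ?case by (rule rtrancl_into_rtrancl)
qed

lemma upper_edge_in_closure:
  assumes last: "\<tau> (n - 1) = (-1, 0)"
  shows "closed_segment A D \<subseteq> closure (inside petal_curve)"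
proof (rule ccontr)
  assume not: "\<not> ?thesis"
  let ?N = "{z \<in> tile (0, 0). height (0, 0) z < 0}" and ?P = "{z \<in> tile (0, 0). 0 < height (0, 0) z}"
  obtain g where g: "simple_path g" "pathfinish g = pathstart g" "path_image g = petal_curve" using petal_loop by blast
  note J = Jordan_inside_outside[OF g(1,2), unfolded g(3)]
  have frontier: "frontier (inside petal_curve) = petal_curve" and bounded: "bounded (inside petal_curve)"
    using J by blast+
  have fc: "petal_curve \<subseteq> closure (inside petal_curve)"
    using frontier unfolding frontier_def by blast
  have A0: "height (0, 0) A = 0" "A \<in> petal_curve"
    using height_corner_zero[OF origin_in_base] pos_corners(1) start(2) n
    by (auto simp: petal_curve_def intro!: bexI[of _ 0])
  have D0: "height (0, 0) D < 0" using height_corner_neg[OF upper_neighbour(2,1)] pos_corners(4) by simp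
  have AD: "A \<in> tile (0, 0)" "D \<in> tile (0, 0)"
    using pos_in_tile[OF origin_in_base] pos_in_tile[OF upper_neighbour(2)] pos_corners by auto
  obtain a k where a: "norm a = 1" and h: "\<And>z. height (0, 0) z = a \<bullet> z + k" using height_affine by blast
  have seg: "closed_segment A D \<subseteq> insert A ?N"
  proof
    fix z assume z: "z \<in> closed_segment A D"
    then obtain u where u: "0 \<le> u" "z = (1 - u) *\<^sub>R A + u *\<^sub>R D" by (auto simp: in_segment)
    have "height (0, 0) z = (1 - u) * height (0, 0) A + u * height (0, 0) D"
      unfolding h u(2) by (simp add: inner_right_distrib algebra_simps)
    then have hz: "height (0, 0) z = u * height (0, 0) D" using A0 by simp
    have zt: "z \<in> tile (0, 0)" using z closed_segment_subset[OF AD tile_compact_convex(2)] by blast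
    show "z \<in> insert A ?N"
    proof (cases "u = 0")
      case False
      then have "height (0, 0) z < 0" using u(1) D0 hz by (simp add: mult_pos_neg)
      then show ?thesis using zt by simp
    qed (use u in simp)
  qed
  \<comment> \<open>One enclosed point in the lower half of the base tile would enclose the whole
    half, and with it put the side \<open>AD\<close> into the closure.\<close>
  have N: "?N \<inter> inside petal_curve = {}"
  proof (rule ccontr)
    assume "?N \<inter> inside petal_curve \<noteq> {}"
    then have "?N \<subseteq> inside petal_curve" using inside_connected[OF tile_side_connected(2) tile_side_disjoint(2)] by blast
    then have "insert A ?N \<subseteq> closure (inside petal_curve)" using fc A0(2) closure_subset by blast
    then show False using seg not by blast
  qed
  define m where "m = midpoint (x 0) (x (Suc 0))"
  have mo: "m \<in> open_segment (x 0) (x (Suc 0))" using segment_nondegenerate[OF n] by (simp add: m_def)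
  have m: "m \<in> interior (tile (0, 0))" "height (0, 0) m = 0"
    using segment_midpoint[OF n] tau_0 by (simp_all add: m_def)
  have "m \<in> petal_curve" using mo n unfolding petal_curve_def open_segment_def by blast
  then have mc: "m \<in> closure (inside petal_curve)" using fc by blast
  obtain \<epsilon> where \<epsilon>: "0 < \<epsilon>" "ball m \<epsilon> \<subseteq> interior (tile (0, 0))"
    using m(1) open_contains_ball open_interior by blast
  \<comment> \<open>Within half the length of the first segment from its midpoint, every point of
    height \<open>0\<close> lies on the segment and hence on the petal, so an enclosed point there
    is strictly above or below the chord.\<close>
  define \<delta> where "\<delta> = min \<epsilon> (dist (x 0) (x (Suc 0)) / 2)"
  have \<delta>: "0 < \<delta>" using \<epsilon>(1) segment_nondegenerate[OF n] by (simp add: \<delta>_def)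
  obtain q where q: "q \<in> inside petal_curve" "dist q m < \<delta>"
    using mc \<delta> by (meson closure_approachable)
  have qt: "q \<in> tile (0, 0)"
  proof -
    have "q \<in> ball m \<epsilon>" using q(2) by (simp add: \<delta>_def dist_commute)
    then show ?thesis using \<epsilon>(2) interior_subset by blast
  qed
  have qn: "height (0, 0) q \<noteq> 0"
  proof
    assume q0: "height (0, 0) q = 0"
    \<comment> \<open>In the plane, vectors orthogonal to the unit vector \<open>a\<close> are real
      multiples of \<open>\<i> * a\<close>; both \<open>q - m\<close> and the first segment are of
      this form.\<close>
    have perp: "w = (Im (cnj a * w)) *\<^sub>R (\<i> * a)" if "a \<bullet> w = 0" for w
    proof -
      have "Re (cnj a * w) = 0" using that by (simp add: inner_complex_def)
      then have "cnj a * w = \<i> * of_real (Im (cnj a * w))" by (simp add: complex_eq_iff)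
      then have "a * (cnj a * w) = of_real (Im (cnj a * w)) * (\<i> * a)" by (metis mult.assoc mult.commute)
      moreover have "a * cnj a = 1" using a by (simp add: complex_norm_square[symmetric])
      ultimately show ?thesis by (metis mult.assoc mult_1 scaleR_conv_of_real)
    qed
    have h01: "height (0, 0) (x 0) = 0" "height (0, 0) (x (Suc 0)) = 0" using x_height[OF n] tau_0 by auto
    obtain s where s: "q - m = s *\<^sub>R (\<i> * a)"
      using perp[of "q - m"] q0 m(2) by (auto simp: h inner_diff_right)
    obtain r where r: "x (Suc 0) - x 0 = r *\<^sub>R (\<i> * a)"
      using perp[of "x (Suc 0) - x 0"] h01 by (auto simp: h inner_diff_right)
    have nr: "dist (x 0) (x (Suc 0)) = \<bar>r\<bar>" using r a by (metis dist_commute dist_norm mult.commute mult_1 norm_ii norm_mult norm_scaleR)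
    have ns: "dist q m = \<bar>s\<bar>" using s a by (metis dist_norm mult.commute mult_1 norm_ii norm_mult norm_scaleR)
    have r0: "r \<noteq> 0" using nr segment_nondegenerate[OF n] by auto
    have sr: "\<bar>s / r\<bar> < 1 / 2" using q(2) nr ns r0 by (simp add: \<delta>_def field_simps)
    have "q = (1 - (1 / 2 + s / r)) *\<^sub>R x 0 + (1 / 2 + s / r) *\<^sub>R x (Suc 0)"
    proof -
      have "q = m + s *\<^sub>R (\<i> * a)" using s by (simp add: algebra_simps)
      also have "s *\<^sub>R (\<i> * a) = (s / r) *\<^sub>R (x (Suc 0) - x 0)" using r r0 by simp
      also have "m = x 0 + (1 / 2) *\<^sub>R (x (Suc 0) - x 0)"
        by (simp add: m_def midpoint_def scaleR_conv_of_real field_simps)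
      finally show ?thesis by (simp add: scaleR_conv_of_real algebra_simps)
    qed
    moreover have "0 \<le> 1 / 2 + s / r" "1 / 2 + s / r \<le> 1" using sr by linarith+
    ultimately have "q \<in> closed_segment (x 0) (x (Suc 0))" unfolding in_segment by blast
    then have "q \<in> petal_curve" using n unfolding petal_curve_def by blast
    then show False using q(1) inside_no_overlap by blast
  qed
  have "\<not> height (0, 0) q < 0" using N q(1) qt by blast
  with qn have "0 < height (0, 0) q" by linarith
  then have "?P \<subseteq> inside petal_curve"
    using inside_connected[OF tile_side_connected(1) tile_side_disjoint(1)] qt q(1) by blast
  moreover have "pos (1, 0) \<in> ?P"
    using height_corner_pos[OF right_neighbour(3,1,2)] pos_in_tile[OF right_neighbour(3)] by simp
  ultimately have start_inside: "pos (1, 0) \<in> inside petal_curve" by blast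
  \<comment> \<open>The upper half of a tile is connected and avoids the petal, so being enclosed
    passes from each vertex to its tilemates.\<close>
  have inside: "pos y \<in> inside petal_curve" if "((1, 0), y) \<in> (tilemates {0<..<2 * \<omega>})\<^sup>*" for y
    using that
  proof induction
    case (step y z)
    then obtain t where t: "y \<in> corners t" "z \<in> corners t" "0 < \<phi> y" "\<phi> y < 2 * \<omega>" "0 < \<phi> z" "\<phi> z < 2 * \<omega>"
      by (auto simp: tilemates_def)
    have "pos y \<in> {z \<in> tile t. 0 < height t z}" "pos z \<in> {z \<in> tile t. 0 < height t z}"
      using t height_corner_pos pos_in_tile by auto
    then show ?case
      using inside_connected[OF tile_side_connected(1) tile_side_disjoint(1)] step.IH by blast
  qed (rule start_inside)
  have "{y. ((1, 0), y) \<in> (tilemates {0<..<2 * \<omega>})\<^sup>*} \<subseteq> pos -` inside petal_curve" using inside by blast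
  then have fin: "finite {y. ((1, 0), y) \<in> (tilemates {0<..<2 * \<omega>})\<^sup>*}"
    using finite_pos_vimage[OF bounded] finite_subset by blast
  have "((1, 0), (-1, 0)) \<in> (tilemates {0<..<2 * \<omega>})\<^sup>*"
    using chain[of "n - 1" "(-1, 0)"] left_neighbour[OF last] n last by simp
  then show False using component_infinite[OF _ fin] omega by simp
qed

lemma bounded_flower_left:
  assumes last: "\<tau> (n - 1) = (-1, 0)"
  shows "\<exists>e\<in>tiling_edges T. A extreme_point_of e \<and>
           (\<exists>P\<in>T. \<exists>P\<^sub>e\<in>T. P \<noteq> P\<^sub>e \<and> P \<inter> P\<^sub>e = e \<and>
              petal_curve \<inter> interior P \<noteq> {} \<and> petal_curve \<inter> interior P\<^sub>e \<noteq> {}) \<and>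
           e \<subseteq> closure (inside petal_curve)"
proof -
  have d: "dstep (0, 1) (0, 0) a\<^sub>4" by (simp add: dstep_def)
  have c: "(0, 0) \<in> corners (-1, 0)" "(0, 1) \<in> corners (-1, 0)" by (simp_all add: corners_def)
  have e: "closed_segment D A edge_of tile (0, 0)" "D \<noteq> A"
    using folded_tile_side[OF folded_tile d upper_neighbour(2) origin_in_base] by (simp_all add: pos_corners)
  have "midpoint D A \<in> rel_interior (closed_segment D A)" using e(2) by (simp add: rel_interior_closed_segment)
  moreover have "A \<in> tile (-1, 0)" "D \<in> tile (-1, 0)" using c[THEN pos_in_tile] by (simp_all add: pos_corners)
  then have "midpoint D A \<in> tile (-1, 0)"
    using closed_segment_subset[OF _ _ tile_compact_convex(2)] midpoint_in_closed_segment by blast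
  moreover have ne: "tile (0, 0) \<noteq> tile (-1, 0)" using tile_inj[of "(0, 0)" "(-1, 0)"] by auto
  ultimately have meet: "tile (0, 0) \<inter> tile (-1, 0) = closed_segment D A"
    using tile_through_edge_point[OF tiling tile_in tile_in _ tile_compact_convex(2) folded_tile_interior[OF folded_tile] e(1)] by blast
  have hit: "petal_curve \<inter> interior (tile (\<tau> i)) \<noteq> {}" if "i < n" for i
  proof -
    have "midpoint (x i) (x (Suc i)) \<in> petal_curve" unfolding petal_curve_def by (rule UN_I[of i]) (use that in simp_all)
    then show ?thesis using segment_midpoint(1)[OF that] by blast
  qed
  have "closed_segment D A \<in> tiling_edges T" using e(1) tile_in by (auto simp: tiling_edges_def)
  moreover have "A extreme_point_of closed_segment D A" by (simp add: extreme_point_of_segment)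
  moreover have "petal_curve \<inter> interior (tile (0, 0)) \<noteq> {}" using hit[OF n] tau_0 by simp
  moreover have "petal_curve \<inter> interior (tile (-1, 0)) \<noteq> {}" using hit[of "n - 1"] n last by simp
  moreover have "closed_segment D A \<subseteq> closure (inside petal_curve)"
    using upper_edge_in_closure[OF last] by (simp add: closed_segment_commute)
  ultimately show ?thesis using meet ne tile_in by blast
qed

end

text \<open>The tangent of the circle at angle \<open>0\<close> supports every folded tile. This is
  what excludes a trajectory leaving the base vertex along the tangent.\<close>

lemma (in folded_tiling) folded_interior:
  assumes "z \<in> interior (tile t)" shows "Re (H (tile t) z) < \<rho>"
proof -
  obtain a k where a: "norm a = 1" and h: "\<And>z. Re (cnj 1 * H (tile t) z) = a \<bullet> z + k"
    using isometry_functional[OF H_tile_isometry[of t], of 1] by auto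
  have "pos ` corners t \<subseteq> {z. a \<bullet> z \<le> \<rho> - k}"
  proof
    fix w assume "w \<in> pos ` corners t"
    then obtain y where y: "w = pos y" "y \<in> corners t" by (rule imageE)
    have "Re (H (tile t) (pos y)) = \<rho> * cos (\<phi> y)"
      using folded_tile[of t] y(2) by (simp add: folded_tile_def cis_phase)
    also have "\<dots> \<le> \<rho>" using rho by (simp add: mult_left_le)
    finally show "w \<in> {z. a \<bullet> z \<le> \<rho> - k}" using h[of "pos y"] y(1) by simp
  qed
  then have "tile t \<subseteq> {z. a \<bullet> z \<le> \<rho> - k}"
    unfolding tile_def by (rule hull_minimal) (rule convex_halfspace_le)
  then have "z \<in> interior {z. a \<bullet> z \<le> \<rho> - k}" using assms interior_mono by blast
  moreover have "a \<noteq> 0" using a by auto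
  ultimately show ?thesis using h[of z] by simp
qed

section \<open>The other side at the base vertex, by a mirror image\<close>

context level_trajectory
begin

text \<open>Conjugation after folding reverses the circle, so the same tile is read as
  \<open>A\<close>, \<open>D\<close>, \<open>C\<close>, \<open>B\<close> with the arcs in reverse
  order. The tiling itself is unchanged; only its indices are transposed.\<close>

lemma mirror_folded_tiling:
  "folded_tiling a\<^sub>4 a\<^sub>3 a\<^sub>2 a\<^sub>1 T (\<lambda>P z. cnj (H P z)) \<rho> A D C B"
proof unfold_locales
  show "0 < a\<^sub>1" "0 < a\<^sub>2" "0 < a\<^sub>3" "0 < a\<^sub>4" "a\<^sub>4 + a\<^sub>3 + a\<^sub>2 + a\<^sub>1 = 2 * pi" using arcs_pos arcs_sum by auto
  show "edge_to_edge_tiling T" "0 < \<rho>" by (fact tiling rho)+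
  show "cyclic_quadrilateral P" if "P \<in> T" for P using quads that .
  show "Q = central_symmetry (midpoint a b) ` P" if "neighbours T P Q (closed_segment a b)" for P Q a b
    using symmetric that .
  show "plane_isometry (\<lambda>z. cnj (H P z))" if "P \<in> T" for P
  proof (rule plane_isometryI)
    fix x y
    have "cmod (cnj (H P x) - cnj (H P y)) = cmod (H P x - H P y)" by (metis complex_cnj_diff complex_mod_cnj)
    then show "dist (cnj (H P x)) (cnj (H P y)) = dist x y"
      using plane_isometry_dist[OF H_isometry[OF that]] by (simp add: dist_norm)
  qed
  show "(\<lambda>z. cnj (H Q z)) = (\<lambda>z. cnj (H P z)) \<circ> line_reflection a b"
    if "neighbours T P Q (closed_segment a b)" for P Q a b
    using H_neighbours[OF that] by (simp add: comp_def)
  have hull: "convex hull {A, D, C, B} = convex hull {A, B, C, D}" by (simp add: insert_commute)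
  show "convex hull {A, D, C, B} \<in> T" unfolding hull by (fact base)
  have cis: "cnj (of_real \<rho> * cis s) = of_real \<rho> * cis t" if "s + t = 2 * pi" for s t
  proof -
    have "t = 2 * pi + - s" using that by simp
    then have "cis t = cis (- s)" by (metis cis_2pi cis_mult mult_1)
    then show ?thesis by (simp add: cis_cnj)
  qed
  show "cnj (H (convex hull {A, D, C, B}) A) = of_real \<rho>"
    "cnj (H (convex hull {A, D, C, B}) D) = of_real \<rho> * cis a\<^sub>4"
    "cnj (H (convex hull {A, D, C, B}) C) = of_real \<rho> * cis (a\<^sub>4 + a\<^sub>3)"
    "cnj (H (convex hull {A, D, C, B}) B) = of_real \<rho> * cis (a\<^sub>4 + a\<^sub>3 + a\<^sub>2)"
    unfolding hull base_corners by (simp, (rule cis, use arcs_sum in linarith)+)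
qed

lemma mirror_tile: "folded_tiling.tile A D C B (i, j) = tile (j, i)"
proof -
  interpret m: folded_tiling a\<^sub>4 a\<^sub>3 a\<^sub>2 a\<^sub>1 T "\<lambda>P z. cnj (H P z)" \<rho> A D C B by (rule mirror_folded_tiling)
  have "m.pos (k, l) = pos (l, k)" for k l
    by (simp add: m.pos_def pos_def add.commute) (simp add: field_simps)
  then have "m.pos ` corners (i, j) = pos ` corners (j, i)" by (auto simp: corners_def)
  then show ?thesis unfolding m.tile_def tile_def by simp
qed

text \<open>The far end of the chord moves from \<open>2 * \<omega>\<close> to
  \<open>2 * pi - 2 * \<omega>\<close>, so the two sides of the chord are exchanged and the height
  changes sign.\<close>

lemma mirror: "level_trajectory a\<^sub>4 a\<^sub>3 a\<^sub>2 a\<^sub>1 T (\<lambda>P z. cnj (H P z)) \<rho> A D C B (pi - \<omega>) n x Q"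
proof -
  interpret m: folded_tiling a\<^sub>4 a\<^sub>3 a\<^sub>2 a\<^sub>1 T "\<lambda>P z. cnj (H P z)" \<rho> A D C B by (rule mirror_folded_tiling)
  interpret m: level_line a\<^sub>4 a\<^sub>3 a\<^sub>2 a\<^sub>1 T "\<lambda>P z. cnj (H P z)" \<rho> A D C B "pi - \<omega>"
    by unfold_locales (use omega in auto)
  have "m.height (i, j) z = - height (j, i) z" for i j z
    by (simp add: m.height_def height_def mirror_tile algebra_simps)
  then have height: "m.height t z = - height (snd t, fst t) z" for t z by (cases t) simp
  have tile: "m.tile t = tile (snd t, fst t)" for t using mirror_tile by (cases t) simp
  show ?thesis
  proof unfold_locales
    show "m.height t z = 0" if "i < n" "z \<in> closed_segment (x i) (x (Suc i))" "z \<in> m.tile t" for i z t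
      using level[OF that(1,2), of "(snd t, fst t)"] that(3) unfolding height tile by simp
    show "Q 0 = m.tile (0, 0)" using start(1) unfolding tile by simp
  qed (fact n trajectory start)+
qed

lemma bounded_flower:
  "\<exists>e\<in>tiling_edges T. A extreme_point_of e \<and>
     (\<exists>P\<in>T. \<exists>P\<^sub>e\<in>T. P \<noteq> P\<^sub>e \<and> P \<inter> P\<^sub>e = e \<and>
        petal_curve \<inter> interior P \<noteq> {} \<and> petal_curve \<inter> interior P\<^sub>e \<noteq> {}) \<and>
     e \<subseteq> closure (inside petal_curve)"
  using last_tile
proof
  assume last: "\<tau> (n - 1) = (0, -1)"
  interpret m: level_trajectory a\<^sub>4 a\<^sub>3 a\<^sub>2 a\<^sub>1 T "\<lambda>P z. cnj (H P z)" \<rho> A D C B "pi - \<omega>" n x Q by (rule mirror)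
  have "Q (n - 1) = m.tile (-1, 0)" using Q_tile[of "n - 1"] n last mirror_tile by simp
  from m.bounded_flower_left[OF m.tau_unique[OF this]] show ?thesis
    unfolding m.petal_curve_def petal_curve_def .
qed (rule bounded_flower_left)

end

section \<open>Normalisation of an arbitrary petal\<close>

lemma least_element_exists:
  fixes f :: "'a \<Rightarrow> 'b :: linorder"
  assumes "finite S" "S \<noteq> {}" "inj_on f S"
  obtains b where "b \<in> S" "\<And>x. x \<in> S - {b} \<Longrightarrow> f b < f x"
proof -
  have "Min (f ` S) \<in> f ` S" using assms by simp
  then obtain b where b: "b \<in> S" "f b = Min (f ` S)" by auto
  have "f b < f x" if "x \<in> S - {b}" for x
  proof -
    have "f b \<le> f x" unfolding b(2) using assms(1) that by simp
    moreover have "f b \<noteq> f x" using inj_onD[OF assms(3)] b(1) that by blast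
    ultimately show ?thesis by simp
  qed
  with b(1) show ?thesis by (rule that)
qed

lemma four_sorted:
  fixes f :: "'a \<Rightarrow> real"
  assumes "card V = 4" "inj_on f V" "a \<in> V" "f a = 0" "\<And>x. x \<in> V \<Longrightarrow> 0 \<le> f x"
  obtains b c d where "V = {a, b, c, d}" "0 < f b" "f b < f c" "f c < f d"
proof -
  have fin: "finite V" using assms(1) card.infinite by fastforce
  have 1: "card (V - {a}) = 3" using assms(1,3) fin by simp
  then have "V - {a} \<noteq> {}" by force
  then obtain b where b: "b \<in> V - {a}" and b_least: "\<And>x. x \<in> V - {a} - {b} \<Longrightarrow> f b < f x"
    using least_element_exists[OF _ _ inj_on_subset[OF assms(2)], of "V - {a}"] fin by blast
  have 2: "card (V - {a} - {b}) = 2" using 1 b fin by simp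
  then have "V - {a} - {b} \<noteq> {}" by force
  then obtain c where c: "c \<in> V - {a} - {b}" and c_least: "\<And>x. x \<in> V - {a} - {b} - {c} \<Longrightarrow> f c < f x"
    using least_element_exists[OF _ _ inj_on_subset[OF assms(2)], of "V - {a} - {b}"] fin by blast
  have "card (V - {a} - {b} - {c}) = 1" using 2 c fin by simp
  then obtain d where d: "V - {a} - {b} - {c} = {d}" by (rule card_1_singletonE)
  have "f b \<noteq> 0" using inj_onD[OF assms(2), of b a] assms(3,4) b by auto
  then have "0 < f b" using assms(5)[of b] b by auto
  moreover have "V = {a, b, c, d}" using d b c assms(3) by blast
  ultimately show ?thesis using that b_least[OF c] c_least[of d] d by blast
qed

text \<open>The normal is a quarter turn ahead of the angle \<open>arctan\<close> of the slope,
  which lies strictly between \<open>- pi / 2\<close> and \<open>pi / 2\<close>.\<close>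

lemma unit_normal:
  assumes "Re w \<noteq> 0"
  obtains \<omega> where "0 < \<omega>" "\<omega> < pi" "Re (cnj (cis \<omega>) * w) = 0"
proof -
  define a where "a = arctan (Im w / Re w)"
  have "- (pi / 2) < a" "a < pi / 2" using arctan_bounded by (simp_all add: a_def)
  moreover have "sin a = Im w / Re w * cos a"
    using tan_arctan[of "Im w / Re w"] cos_arctan_not_zero[of "Im w / Re w"]
    by (simp add: a_def tan_def nonzero_divide_eq_eq)
  then have "Re (cnj (cis (pi / 2 + a)) * w) = 0"
    using assms by (simp add: sin_add cos_add)
  ultimately show ?thesis using that[of "pi / 2 + a"] by auto
qed

lemma petal_bounded_flower:
  assumes tiling: "cyclic_quadrilateral_tiling P0 T"
    and folding: "folding_map P0 T F" and d: "d \<noteq> 0"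
    and v: "v \<in> tiling_vertices T"
    and n: "0 < n" and trajectory: "billiard_trajectory T n x Q" and ends: "x 0 = v" "x n = v"
    and \<gamma>: "\<gamma> = (\<Union>i<n. closed_segment (x i) (x (Suc i)))"
    and line: "\<gamma> \<subseteq> F -` range (\<lambda>t. p + t *\<^sub>R d)"
  shows "\<exists>e\<in>tiling_edges T. v extreme_point_of e \<and>
           (\<exists>P\<in>T. \<exists>P\<^sub>e\<in>T. P \<noteq> P\<^sub>e \<and> P \<inter> P\<^sub>e = e \<and>
              \<gamma> \<inter> interior P \<noteq> {} \<and> \<gamma> \<inter> interior P\<^sub>e \<noteq> {}) \<and>
           e \<subseteq> closure (inside \<gamma>)"
proof -
  have edge: "edge_to_edge_tiling T" and quads: "\<And>P. P \<in> T \<Longrightarrow> cyclic_quadrilateral P"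
    and symmetric: "\<And>P Q a b. neighbours T P Q (closed_segment a b) \<Longrightarrow> Q = central_symmetry (midpoint a b) ` P"
    using tiling unfolding cyclic_quadrilateral_tiling_def by blast+
  obtain G where G_dist: "\<And>P x y. P \<in> T \<Longrightarrow> dist (G P x) (G P y) = dist x y"
    and GF: "\<And>P x. P \<in> T \<Longrightarrow> x \<in> P \<Longrightarrow> F x = G P x"
    and G_neighbours: "\<And>P Q a b. neighbours T P Q (closed_segment a b) \<Longrightarrow> G Q = G P \<circ> line_reflection a b"
  proof -
    obtain G where "(\<forall>P\<in>T. (\<forall>x y. dist (G P x) (G P y) = dist x y) \<and> (\<forall>x\<in>P. F x = G P x)) \<and>
        (\<forall>P Q a b. neighbours T P Q (closed_segment a b) \<longrightarrow> G Q = G P \<circ> line_reflection a b)"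
      using folding unfolding folding_map_def by (elim conjE exE) (rule that, intro conjI)
    then show ?thesis by (intro that[of G]) simp_all
  qed
  have Q0: "Q 0 \<in> T" and x01: "x 0 \<noteq> x (Suc 0)" and open0: "open_segment (x 0) (x (Suc 0)) \<subseteq> interior (Q 0)"
    using trajectory n unfolding billiard_trajectory_def by blast+
  obtain V c r where V: "card V = 4" "V \<subseteq> sphere c r" "Q 0 = convex hull V"
    using quads[OF Q0] unfolding cyclic_quadrilateral_def by blast
  have v0: "v \<in> Q 0"
  proof -
    have "closure (open_segment (x 0) (x (Suc 0))) \<subseteq> Q 0"
      using open0 interior_subset compact_imp_closed[OF cyclic_quadrilateral_compact_convex(1)[OF quads[OF Q0]]]
      by (meson closure_minimal subset_trans)
    then show ?thesis using x01 ends(1) by auto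
  qed
  obtain P where P: "P \<in> T" "v extreme_point_of P" using v unfolding tiling_vertices_def by blast
  have "v extreme_point_of Q 0"
  proof (cases "P = Q 0")
    case False
    then have "P \<inter> Q 0 face_of P" "P \<inter> Q 0 face_of Q 0"
      using edge P(1) Q0 unfolding edge_to_edge_tiling_def by blast+
    moreover have "v \<in> P \<inter> Q 0" using P(2) v0 by (simp add: extreme_point_of_def)
    ultimately show ?thesis using P(2) extreme_point_of_face by blast
  qed (use P in simp)
  then have vV: "v \<in> V" using V(3) extreme_point_of_convex_hull by metis
  have r: "0 < r"
  proof (rule ccontr)
    assume "\<not> 0 < r"
    then have "V \<subseteq> {c}" using V(2) by (auto simp: sphere_def)
    then have "card V \<le> 1" using card_mono[of "{c}" V] by simp
    then show False using V(1) by simp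
  qed
  \<comment> \<open>Multiplication by \<open>u\<close> is the rotation that, after the centre of the
    folded first tile is moved to \<open>0\<close>, puts the folded \<open>v\<close> on the positive
    real axis.\<close>
  define u where "u = cnj (G (Q 0) v - G (Q 0) c) / of_real r"
  define H where "H P z = (G P z - G (Q 0) c) * u" for P z
  have radius: "cmod (G (Q 0) w - G (Q 0) c) = r" if "w \<in> V" for w
    using V(2) that G_dist[OF Q0, of c w] by (auto simp: dist_norm norm_minus_commute)
  have "cmod (cnj (G (Q 0) v - G (Q 0) c)) = r" using radius[OF vV] by (simp only: complex_mod_cnj)
  then have u: "cmod u = 1" unfolding u_def norm_divide using r by simp
  have H_isometry: "plane_isometry (H P)" if "P \<in> T" for P
  proof (rule plane_isometryI)
    fix x y
    have "dist (H P x) (H P y) = dist (G P x) (G P y) * cmod u"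
      unfolding dist_norm H_def by (simp add: norm_mult[symmetric] algebra_simps)
    then show "dist (H P x) (H P y) = dist x y" using G_dist[OF that] u by simp
  qed
  have Hv: "H (Q 0) v = of_real r"
  proof -
    have "H (Q 0) v = (G (Q 0) v - G (Q 0) c) * cnj (G (Q 0) v - G (Q 0) c) / of_real r"
      unfolding H_def u_def by simp
    also have "\<dots> = of_real (r\<^sup>2) / of_real r"
      unfolding complex_norm_square[symmetric] radius[OF vV] by simp
    finally show ?thesis using r by (simp add: power2_eq_square)
  qed
  have Hr: "cmod (H (Q 0) w) = r" if "w \<in> V" for w
    using radius[OF that] u by (simp add: H_def norm_mult)
  \<comment> \<open>\<open>Arg2pi\<close> takes values from \<open>0\<close> up to a full turn, so
    \<open>v\<close> comes first when the corners are sorted by angle, and the remaining arcs are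
    differences.\<close>
  define \<theta> where "\<theta> w = Arg2pi (H (Q 0) w)" for w
  have polar: "H (Q 0) w = of_real r * cis (\<theta> w)" if "w \<in> V" for w
    using Arg2pi_eq[of "H (Q 0) w"] Hr[OF that] by (simp add: \<theta>_def cis_conv_exp)
  have "inj_on \<theta> V"
    using polar plane_isometry_inj[OF H_isometry[OF Q0]] by (intro inj_onI) metis
  moreover have "\<theta> v = 0" using r by (simp add: \<theta>_def Hv Arg2pi_of_real)
  moreover have "0 \<le> \<theta> w" "\<theta> w < 2 * pi" for w using Arg2pi unfolding \<theta>_def by blast+
  note \<theta> = this
  ultimately obtain B C D where BCD: "V = {v, B, C, D}" "0 < \<theta> B" "\<theta> B < \<theta> C" "\<theta> C < \<theta> D"
    using four_sorted[OF V(1) _ vV, of \<theta>] by blast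
  have hull: "convex hull {v, B, C, D} = Q 0" using BCD(1) V(3) by simp
  interpret folded_tiling "\<theta> B" "\<theta> C - \<theta> B" "\<theta> D - \<theta> C" "2 * pi - \<theta> D" T H r v B C D
  proof
    show "0 < \<theta> B" "0 < \<theta> C - \<theta> B" "0 < \<theta> D - \<theta> C" "0 < 2 * pi - \<theta> D"
      "\<theta> B + (\<theta> C - \<theta> B) + (\<theta> D - \<theta> C) + (2 * pi - \<theta> D) = 2 * pi"
      using BCD(2-4) \<theta>(2)[of D] by simp_all
    show "H P' = H P \<circ> line_reflection a b" if "neighbours T P P' (closed_segment a b)" for P P' a b
      unfolding fun_eq_iff H_def by (simp add: G_neighbours[OF that])
    show "convex hull {v, B, C, D} \<in> T" unfolding hull by (fact Q0)
    show "H (convex hull {v, B, C, D}) v = of_real r" unfolding hull by (fact Hv)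
    have "\<theta> B + (\<theta> C - \<theta> B) = \<theta> C" "\<theta> C + (\<theta> D - \<theta> C) = \<theta> D" by simp_all
    note sums = this
    show "H (convex hull {v, B, C, D}) B = of_real r * cis (\<theta> B)"
      "H (convex hull {v, B, C, D}) C = of_real r * cis (\<theta> B + (\<theta> C - \<theta> B))"
      "H (convex hull {v, B, C, D}) D = of_real r * cis (\<theta> B + (\<theta> C - \<theta> B) + (\<theta> D - \<theta> C))"
      unfolding hull sums by (rule polar, unfold BCD(1), blast)+
  qed (fact edge r quads symmetric H_isometry | assumption)+
  have tile0: "tile (0, 0) = Q 0" using tile_base hull by simp
  define w where "w = d * u"
  have on_line: "\<exists>s. H P z = of_real r + of_real s * w" if z: "z \<in> \<gamma>" "z \<in> P" "P \<in> T" for z P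
  proof -
    have "v \<in> \<gamma>" unfolding \<gamma> using ends(1) n by (intro UN_I[of 0]) auto
    then obtain t\<^sub>0 where t0: "F v = p + t\<^sub>0 *\<^sub>R d" using line by blast
    obtain t where t: "F z = p + t *\<^sub>R d" using line z(1) by blast
    have "H P z - H (Q 0) v = (F z - F v) * u"
      using GF[OF z(3,2)] GF[OF Q0 v0] by (simp add: H_def algebra_simps)
    also have "\<dots> = of_real (t - t\<^sub>0) * w" by (simp add: t t0 w_def scaleR_conv_of_real algebra_simps)
    finally have "H P z = of_real r + of_real (t - t\<^sub>0) * w" by (simp add: Hv algebra_simps)
    then show ?thesis by blast
  qed
  \<comment> \<open>A vertical line through the folded \<open>v\<close> is tangent to the circle,
    whereas the first segment runs through the interior of a tile.\<close>
  have "Re w \<noteq> 0"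
  proof
    assume "Re w = 0"
    let ?m = "midpoint (x 0) (x (Suc 0))"
    have m: "?m \<in> interior (Q 0)" using open0 x01 by auto
    have "?m \<in> \<gamma>" unfolding \<gamma> using n by (intro UN_I[of 0]) auto
    then obtain s where "H (Q 0) ?m = of_real r + of_real s * w"
      using on_line[OF _ _ Q0] m interior_subset by blast
    then have "Re (H (Q 0) ?m) = r" using \<open>Re w = 0\<close> by simp
    then show False using folded_interior[of ?m "(0, 0)"] m tile0 by simp
  qed
  then obtain \<omega> where \<omega>: "0 < \<omega>" "\<omega> < pi" "Re (cnj (cis \<omega>) * w) = 0" by (rule unit_normal)
  interpret level_line "\<theta> B" "\<theta> C - \<theta> B" "\<theta> D - \<theta> C" "2 * pi - \<theta> D" T H r v B C D \<omega>
    by unfold_locales (use \<omega> in auto)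
  interpret level_trajectory "\<theta> B" "\<theta> C - \<theta> B" "\<theta> D - \<theta> C" "2 * pi - \<theta> D" T H r v B C D \<omega> n x Q
  proof
    show "height t z = 0" if z: "i < n" "z \<in> closed_segment (x i) (x (Suc i))" "z \<in> tile t" for i z t
    proof -
      have "z \<in> \<gamma>" unfolding \<gamma> using z(1,2) by blast
      then obtain s where "H (tile t) z = of_real r + of_real s * w" using on_line z(3) tile_in by blast
      then have "height t z = s * Re (cnj (cis \<omega>) * w)" by (simp add: height_def algebra_simps)
      then show ?thesis using \<omega>(3) by simp
    qed
  qed (use n trajectory ends tile0 in simp_all)
  show ?thesis using bounded_flower unfolding petal_curve_def \<gamma> .
qed

theorem mainTheorem2:
  fixes P0 :: "complex set" and T \<F> :: "complex set set"
    and v :: complex and \<gamma> \<gamma>' :: "complex set"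
  assumes "cyclic_quadrilateral_tiling P0 T"
    and "parallel_foliation P0 T \<F>"
    and "v \<in> tiling_vertices T"
    and "petal T \<F> v \<gamma>"
    and "petal T \<F> v \<gamma>'"
    and "\<gamma>' \<noteq> \<gamma>"
  shows "\<exists>e\<in>tiling_edges T. v extreme_point_of e \<and>
           (\<exists>P\<in>T. \<exists>P\<^sub>e\<in>T. P \<noteq> P\<^sub>e \<and> P \<inter> P\<^sub>e = e \<and>
              \<gamma> \<inter> interior P \<noteq> {} \<and> \<gamma> \<inter> interior P\<^sub>e \<noteq> {}) \<and>
           e \<subseteq> closure (petal_domain \<gamma>)"
proof -
  obtain F d where F: "folding_map P0 T F" "d \<noteq> 0"
    and \<F>: "\<F> = (\<Union>p. components (F -` range (\<lambda>t. p + t *\<^sub>R d)))"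
    using assms(2) unfolding parallel_foliation_def by blast
  obtain n x Q where n: "0 < n" "billiard_trajectory T n x Q" "x 0 = v" "x n = v"
    "\<gamma> = (\<Union>i<n. closed_segment (x i) (x (Suc i)))"
    using assms(4) unfolding petal_def by blast
  obtain L where L: "L \<in> \<F>" "\<gamma> \<subseteq> L"
    using assms(4) unfolding petal_def singular_leaf_def by blast
  from L(1) obtain p where "L \<in> components (F -` range (\<lambda>t. p + t *\<^sub>R d))"
    unfolding \<F> by (rule UN_E)
  then have "\<gamma> \<subseteq> F -` range (\<lambda>t. p + t *\<^sub>R d)" by (rule subset_trans[OF L(2) in_components_subset])
  from petal_bounded_flower[OF assms(1) F assms(3) n this] show ?thesis .
qed

end
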